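(* There exists a universal constant $K'$ such that for every quantum XOR game $G$, $$\beta^*(G)\leq K'\,\beta_{owc}(G).$$
   Context: A bipartite quantum XOR game on $\mathbb{C}^n\otimes\mathbb{C}^m$ ($n,m\ge1$) is given by bipartite quantum states (positive semidefinite trace-one operators) $\rho_1,\dots,\rho_N$ on $\mathbb{C}^n\otimes\mathbb{C}^m$, signs $c_x\in\{-1,1\}$ and a probability distribution $(p_x)_{x=1}^N$. The game is identified with the operator $G=\sum_{x=1}^N c_xp_x\rho_x$. The operators arising in this way are identified with the selfadjoint operators $G$ on $\mathbb{C}^n\otimes\mathbb{C}^m$ with trace norm $\|G\|_{S_1^{nm}}\le 1$. The entangled bias of $G$ is $$\beta^*(G)=\sup\ \mathrm{tr}\big((A\otimes B)(G\otimes\rho_{A'B'})\big),$$ where the supremum runs over all complex Hilbert spaces $H_{A'},H_{B'}$, all bipartite quantum states $\rho_{A'B'}$ on $H_{A'}\otimes H_{B'}$, and all selfadjoint contractions $A$ on $\mathbb{C}^n\otimes H_{A'}$ and $B$ on $\mathbb{C}^m\otimes H_{B'}$ (with the tensor factors reordered in the obvious way). The one-way classical communication bias of $G$ is $$\beta_{owc}(G)=\sup\ \sum_{k=1}^{2^c}\mathrm{tr}\big((A_k\otimes B_k)G\big),\qquad A_k=E_{1,k}-E_{-1,k},\quad B_k=F_{1,k}-F_{-1,k},$$ where the supremum runs over all $c\in\mathbb{N}$, all families of positive semidefinite operators $\{E_{a,k}\}_{a=\pm1,\,1\le k\le 2^c}$ on $\mathbb{C}^n$ with $\sum_{a,k}E_{a,k}=1_{M_n}$,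 and all families of positive semidefinite operators $\{F_{b,k}\}_{b=\pm1,\,1\le k\le 2^c}$ on $\mathbb{C}^m$ with $\sum_bF_{b,k}=1_{M_m}$ for every $k$. The constant $K'$ is independent of $n$, $m$ and $G$. *)

theory Defs
  imports "HOL-Analysis.Analysis" "HOL-Library.Extended_Real" "HOL-Library.Nonpos_Ints"
begin

text \<open>
  Hilbert spaces are modelled as \<open>\<ell>\<^sup>2(X)\<close> for an arbitrary index set \<open>X\<close>: choosing an orthonormal
  basis identifies every complex Hilbert space with such a space. Thus \<open>\<complex>\<^sup>n\<close> is
  \<open>\<ell>\<^sup>2({..<n})\<close>, and the Hilbert space tensor product of \<open>\<ell>\<^sup>2(X)\<close> and \<open>\<ell>\<^sup>2(Y)\<close> is \<open>\<ell>\<^sup>2(X \<times> Y)\<close>.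
  Operators are maps on vectors; only their values on \<open>\<ell>\<^sup>2(X)\<close> matter.
\<close>

type_synonym 'x vector = "'x \<Rightarrow> complex"
type_synonym 'x operator = "'x vector \<Rightarrow> 'x vector"

definition ell2 :: "'x set \<Rightarrow> 'x vector set" where
  "ell2 X = {v. (\<forall>x. x \<notin> X \<longrightarrow> v x = 0) \<and> (\<lambda>x. (cmod (v x))\<^sup>2) summable_on X}"

definition ell2_inner :: "'x set \<Rightarrow> 'x vector \<Rightarrow> 'x vector \<Rightarrow> complex" where
  "ell2_inner X u v = (\<Sum>\<^sub>\<infinity>x\<in>X. cnj (u x) * v x)"

definition ell2_norm :: "'x set \<Rightarrow> 'x vector \<Rightarrow> real" where
  "ell2_norm X v = sqrt (\<Sum>\<^sub>\<infinity>x\<in>X. (cmod (v x))\<^sup>2)"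

definition ket :: "'x \<Rightarrow> 'x vector" where
  "ket x = (\<lambda>y. if y = x then 1 else 0)"

definition linear_op :: "'x set \<Rightarrow> 'x operator \<Rightarrow> bool" where
  "linear_op X T \<longleftrightarrow>
     (\<forall>v\<in>ell2 X. T v \<in> ell2 X) \<and>
     (\<forall>u\<in>ell2 X. \<forall>v\<in>ell2 X. T (\<lambda>x. u x + v x) = (\<lambda>x. T u x + T v x)) \<and>
     (\<forall>a. \<forall>v\<in>ell2 X. T (\<lambda>x. a * v x) = (\<lambda>x. a * T v x))"

definition bounded_op :: "'x set \<Rightarrow> 'x operator \<Rightarrow> bool" where
  "bounded_op X T \<longleftrightarrow> linear_op X T \<and> (\<exists>C. \<forall>v\<in>ell2 X. ell2_norm X (T v) \<le> C * ell2_norm X v)"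

definition positive_op :: "'x set \<Rightarrow> 'x operator \<Rightarrow> bool" where
  "positive_op X T \<longleftrightarrow> bounded_op X T \<and> (\<forall>v\<in>ell2 X. ell2_inner X v (T v) \<in> \<real>\<^sub>\<ge>\<^sub>0)"

definition selfadjoint_contraction :: "'x set \<Rightarrow> 'x operator \<Rightarrow> bool" where
  "selfadjoint_contraction X T \<longleftrightarrow> linear_op X T \<and>
     (\<forall>v\<in>ell2 X. ell2_norm X (T v) \<le> ell2_norm X v) \<and>
     (\<forall>u\<in>ell2 X. \<forall>v\<in>ell2 X. ell2_inner X u (T v) = ell2_inner X (T u) v)"

text \<open>The trace in the standard basis; it is used for trace class operators only, where it does
  not depend on the basis.\<close>

definition op_trace :: "'x set \<Rightarrow> 'x operator \<Rightarrow> complex" where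
  "op_trace X T = (\<Sum>\<^sub>\<infinity>x\<in>X. ell2_inner X (ket x) (T (ket x)))"

text \<open>A divergent \<^const>\<open>infsum\<close> is \<open>0\<close>, so trace one forces a positive operator to be trace class.\<close>

definition quantum_state :: "'x set \<Rightarrow> 'x operator \<Rightarrow> bool" where
  "quantum_state X \<rho> \<longleftrightarrow> positive_op X \<rho> \<and> op_trace X \<rho> = 1"

text \<open>\<open>T \<otimes> S\<close> is \<open>(T \<otimes> 1) (1 \<otimes> S)\<close>: first \<open>S\<close> is applied to every slice \<open>w(x, \<cdot>)\<close> of a vector \<open>w\<close>, then
  \<open>T\<close> to every slice \<open>(\<cdot>, y)\<close> of the result. For bounded \<open>T\<close> and \<open>S\<close> this is the bounded operator
  determined by \<open>(T \<otimes> S) (u \<otimes> v) = T u \<otimes> S v\<close>.\<close>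

definition tensor_op :: "'x operator \<Rightarrow> 'y operator \<Rightarrow> ('x \<times> 'y) operator" where
  "tensor_op T S w = (\<lambda>(x, y). T (\<lambda>x'. S (\<lambda>y'. w (x', y')) y) x)"

lemma tensor_op_product:
  assumes "linear_op X T" "linear_op Y S" "u \<in> ell2 X" "v \<in> ell2 Y"
  shows "tensor_op T S (\<lambda>(x, y). u x * v y) = (\<lambda>(x, y). T u x * S v y)"
proof -
  have "S (\<lambda>y'. u x * v y') = (\<lambda>y. u x * S v y)" for x
    using assms(2,4) by (simp add: linear_op_def)
  moreover have "T (\<lambda>x'. u x' * S v y) = (\<lambda>x. T u x * S v y)" for y
    using assms(1,3) by (simp add: linear_op_def mult.commute[of _ "S v y"])
  ultimately show ?thesis
    by (simp add: tensor_op_def)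
qed

text \<open>The reordering of tensor factors, turning an operator on
  \<open>(\<complex>\<^sup>n \<otimes> H\<^sub>A) \<otimes> (\<complex>\<^sup>m \<otimes> H\<^sub>B)\<close> into one on \<open>(\<complex>\<^sup>n \<otimes> \<complex>\<^sup>m) \<otimes> (H\<^sub>A \<otimes> H\<^sub>B)\<close>.\<close>

definition swap_mid :: "('a \<times> 'b) \<times> ('c \<times> 'd) \<Rightarrow> ('a \<times> 'c) \<times> ('b \<times> 'd)" where
  "swap_mid = (\<lambda>((a, b), (c, d)). ((a, c), (b, d)))"

definition reorder_op ::
    "(('a \<times> 'b) \<times> ('c \<times> 'd)) operator \<Rightarrow> (('a \<times> 'c) \<times> ('b \<times> 'd)) operator" where
  "reorder_op T w = T (w \<circ> swap_mid) \<circ> swap_mid"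

text \<open>Games are given by the operator \<open>G = \<Sum>\<^sub>x c\<^sub>x p\<^sub>x \<rho>\<^sub>x\<close>.\<close>

definition xor_game :: "nat \<Rightarrow> nat \<Rightarrow> (nat \<times> nat) operator \<Rightarrow> bool" where
  "xor_game n m G \<longleftrightarrow>
     (\<exists>(N::nat) (\<rho> :: nat \<Rightarrow> (nat \<times> nat) operator) (c :: nat \<Rightarrow> real) (p :: nat \<Rightarrow> real).
        (\<forall>x\<in>{1..N}. quantum_state ({..<n} \<times> {..<m}) (\<rho> x)) \<and>
        (\<forall>x\<in>{1..N}. c x \<in> {-1, 1}) \<and>
        (\<forall>x\<in>{1..N}. 0 \<le> p x) \<and> (\<Sum>x\<in>{1..N}. p x) = 1 \<and>
        G = (\<lambda>v i. \<Sum>x\<in>{1..N}. complex_of_real (c x * p x) * \<rho> x v i))"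

text \<open>The supremum over the Hilbert spaces \<open>\<ell>\<^sup>2(I)\<close>, \<open>\<ell>\<^sup>2(J)\<close> with \<open>I\<close>, \<open>J\<close> subsets of the type \<open>'h\<close>.
  HOL cannot quantify over types inside a formula, so the supremum over \<^emph>\<open>all\<close> Hilbert spaces is
  obtained by letting \<open>'h\<close> be arbitrary. A constant independent of \<open>'h\<close> is expressed by bounding the
  bias for arbitrary \<open>'h\<close> by the one for \<^typ>\<open>nat\<close> (all separable Hilbert spaces), and the latter,
  which does not involve \<open>'h\<close>, by the constant.

  The traces are real, being those of products of two selfadjoint operators; \<^const>\<open>Re\<close> only adjusts
  the type. The suprema are taken in \<^typ>\<open>ereal\<close> so that no boundedness needs to be known.\<close>

definition entangled_bias ::
    "'h itself \<Rightarrow> nat \<Rightarrow> nat \<Rightarrow> (nat \<times> nat) operator \<Rightarrow> ereal" where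
  "entangled_bias _ n m G =
     Sup {ereal (Re (op_trace (({..<n} \<times> {..<m}) \<times> (I \<times> J))
                       (reorder_op (tensor_op A B) \<circ> tensor_op G \<rho>))) |
          (I :: 'h set) (J :: 'h set) \<rho> A B.
            quantum_state (I \<times> J) \<rho> \<and>
            selfadjoint_contraction ({..<n} \<times> I) A \<and>
            selfadjoint_contraction ({..<m} \<times> J) B}"

definition owc_bias :: "nat \<Rightarrow> nat \<Rightarrow> (nat \<times> nat) operator \<Rightarrow> ereal" where
  "owc_bias n m G =
     Sup {ereal (\<Sum>k\<in>{1..2^c}. Re (op_trace ({..<n} \<times> {..<m})
                  (tensor_op (\<lambda>v i. E 1 k v i - E (-1) k v i)
                             (\<lambda>v j. F 1 k v j - F (-1) k v j) \<circ> G))) |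
          (c :: nat) (E :: int \<Rightarrow> nat \<Rightarrow> nat operator) (F :: int \<Rightarrow> nat \<Rightarrow> nat operator).
            (\<forall>a\<in>{-1, 1}. \<forall>k\<in>{1..2^c}. positive_op {..<n} (E a k)) \<and>
            (\<forall>v\<in>ell2 {..<n}. (\<lambda>i. \<Sum>a\<in>{-1, 1}. \<Sum>k\<in>{1..2^c}. E a k v i) = v) \<and>
            (\<forall>b\<in>{-1, 1}. \<forall>k\<in>{1..2^c}. positive_op {..<m} (F b k)) \<and>
            (\<forall>k\<in>{1..2^c}. \<forall>v\<in>ell2 {..<m}. (\<lambda>j. \<Sum>b\<in>{-1, 1}. F b k v j) = v)}"

end

theory Submission
  imports Defs
begin

text \<open>
  Write \<open>u(a, b) = tr ((a \<otimes> b) G)\<close> and let \<open>\<beta>\<close> be the one-way bias. It controls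
  \<open>\<Sum>\<^sub>k u(\<xi>\<^sub>k \<xi>\<^sub>k\<^sup>*, b\<^sub>k)\<close> whenever \<open>\<Sum>\<^sub>k \<xi>\<^sub>k \<xi>\<^sub>k\<^sup>* \<le> 1\<close> and the \<open>b\<^sub>k\<close> are Hermitian
  contractions, so by the Hahn-Banach theorem there is a positive functional \<open>f\<close> with \<open>f(1) \<le> \<beta>\<close>
  and \<open>|u(\<xi> \<xi>\<^sup>*, b)| \<le> f(\<xi> \<xi>\<^sup>*)\<close>. Expanding \<open>a\<close> into columns or rows gives
  \<open>|u(a, b)|\<^sup>2 \<le> 4 \<beta> min (f(a a\<^sup>*), f(a\<^sup>* a))\<close> for all contractions \<open>b\<close>.

  The little Grothendieck inequality turns this into
  \<open>|u(a, b)|\<^sup>2 \<le> min (f(a a\<^sup>*), f(a\<^sup>* a)) (g(b\<^sup>* b) + g'(b b\<^sup>*))\<close> with positive functionals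
  \<open>g\<close>, \<open>g'\<close> of norm at most \<open>8 \<beta>\<close>; it is proved by the second variation at a unitary that
  maximizes a Hilbert space norm. An orthogonal projection then splits \<open>u = u\<^sub>1 + u\<^sub>2\<close> with
  \<open>|u\<^sub>1(a, b)|\<^sup>2 \<le> f(a a\<^sup>*) g(b\<^sup>* b)\<close> and \<open>|u\<^sub>2(a, b)|\<^sup>2 \<le> f(a\<^sup>* a) g'(b b\<^sup>*)\<close>.

  Both forms are completely bounded: for \<open>A = \<Sum> e\<^sub>i\<^sub>j \<otimes> A\<^sub>i\<^sub>j\<close> and \<open>B = \<Sum> e\<^sub>k\<^sub>l \<otimes> B\<^sub>k\<^sub>l\<close>, the number
  \<open>\<langle>\<psi>, (A\<^sub>i\<^sub>j \<otimes> B\<^sub>k\<^sub>l) \<psi>\<rangle>\<close> is both \<open>\<langle>A\<^sub>i\<^sub>j\<^sup>* \<psi>, B\<^sub>k\<^sub>l \<psi>\<rangle>\<close> and \<open>\<langle>B\<^sub>k\<^sub>l\<^sup>* \<psi>, A\<^sub>i\<^sub>j \<psi>\<rangle>\<close>, and the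
  Cauchy-Schwarz inequality in the coordinates of these vectors applies to \<open>u\<^sub>1\<close> and \<open>u\<^sub>2\<close>,
  respectively. A mixed state is a sum of vector states by a Cholesky decomposition. Only countably
  many coordinates meet the support of a state, which reduces arbitrary Hilbert spaces to separable ones.
\<close>

text \<open>The delicate point is which bound on Alice's side meets which bound on Bob's. Moving
  exactly one of the two operators across the inner product controls \<open>a a\<^sup>*\<close>
  together with \<open>b\<^sup>* b\<close>, or \<open>a\<^sup>* a\<close> together with
  \<open>b b\<^sup>*\<close>. The little Grothendieck inequality, however, yields the sum
  \<open>g + g'\<close> on Bob's side without saying which summand belongs to which bound on
  Alice's. The minimum over both bounds resolves this: once Bob's argument is split, each part of
  \<open>u\<close> takes the bound that fits. For this the same \<open>g\<close> and
  \<open>g'\<close> must serve both bounds, so the inequality is applied once, to the coordinates of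
  \<open>u\<close> for both forms on Alice's side together. The constants arise as follows. A
  contraction has two Hermitian parts, which turns \<open>sqrt \<beta>\<close> into
  \<open>2 * sqrt \<beta>\<close>; the two families of coordinates give
  \<open>4 * \<beta> + 4 * \<beta> = 8 * \<beta>\<close>; each part of \<open>u\<close> costs
  \<open>sqrt 8 * \<beta> \<le> 3 * \<beta>\<close>, and both together
  \<open>6 * \<beta>\<close>.\<close>

subsection \<open>Positive semidefinite forms\<close>

text \<open>Vectors of C^S are functions on the whole type, without a carrier set; the last clause
  makes a functional blind to the coordinates outside \<open>S\<close>.\<close>

definition linear_fun :: "'i set \<Rightarrow> (('i \<Rightarrow> complex) \<Rightarrow> complex) \<Rightarrow> bool" where
  "linear_fun S f \<longleftrightarrow>
     (\<forall>v w. f (\<lambda>i. v i + w i) = f v + f w) \<and>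
     (\<forall>c v. f (\<lambda>i. c * v i) = c * f v) \<and>
     (\<forall>v w. (\<forall>i\<in>S. v i = w i) \<longrightarrow> f v = f w)"

lemma linear_fun_add: "linear_fun S f \<Longrightarrow> f (\<lambda>i. v i + w i) = f v + f w"
  and linear_fun_scale: "linear_fun S f \<Longrightarrow> f (\<lambda>i. c * v i) = c * f v"
  and linear_fun_cong: "linear_fun S f \<Longrightarrow> (\<And>i. i \<in> S \<Longrightarrow> v i = w i) \<Longrightarrow> f v = f w"
  by (auto simp: linear_fun_def)

lemma linear_fun_zero: "linear_fun S f \<Longrightarrow> f (\<lambda>i. 0) = 0"
  using linear_fun_scale[of S f 0 "\<lambda>i. 0"] by simp

lemma linear_fun_diff:
  assumes "linear_fun S f"
  shows "f (\<lambda>i. v i - w i) = f v - f w"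
  using linear_fun_add[OF assms, of v "\<lambda>i. (-1) * w i"] linear_fun_scale[OF assms, of "-1" w]
  by simp

lemma linear_fun_sum:
  assumes "linear_fun S f"
  shows "f (\<lambda>i. \<Sum>s\<in>F. c s * z s i) = (\<Sum>s\<in>F. c s * f (z s))"
proof (induction F rule: infinite_finite_induct)
  case (insert x F)
  then show ?case
    using linear_fun_add[OF assms, of "\<lambda>i. c x * z x i" "\<lambda>i. \<Sum>s\<in>F. c s * z s i"]
      linear_fun_scale[OF assms, of "c x" "z x"] by simp
qed (simp_all add: linear_fun_zero[OF assms])

lemma linear_fun_sum':
  assumes "linear_fun S f"
  shows "f (\<lambda>i. \<Sum>s\<in>F. z s i) = (\<Sum>s\<in>F. f (z s))"
  using linear_fun_sum[OF assms, where c = "\<lambda>_. 1"] by simp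

lemma linear_fun_expand:
  assumes "linear_fun S f" "finite S"
  shows "f v = (\<Sum>i\<in>S. v i * f (ket i))"
proof -
  have "f v = f (\<lambda>j. \<Sum>i\<in>S. v i * ket i j)"
    by (rule linear_fun_cong[OF assms(1)]) (simp add: ket_def assms(2) if_distrib cong: if_cong)
  then show ?thesis
    by (simp add: linear_fun_sum[OF assms(1)])
qed

lemma linear_fun_linear_combination:
  assumes "\<And>s. s \<in> F \<Longrightarrow> linear_fun S (f s)"
  shows "linear_fun S (\<lambda>v. \<Sum>s\<in>F. c s * f s v)"
  unfolding linear_fun_def
proof (intro conjI allI impI)
  show "(\<Sum>s\<in>F. c s * f s (\<lambda>i. v i + w i)) = (\<Sum>s\<in>F. c s * f s v) + (\<Sum>s\<in>F. c s * f s w)" for v w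
    unfolding sum.distrib[symmetric]
    by (rule sum.cong) (simp_all add: linear_fun_add[OF assms] algebra_simps)
  show "(\<Sum>s\<in>F. c s * f s (\<lambda>i. d * v i)) = d * (\<Sum>s\<in>F. c s * f s v)" for d v
    unfolding sum_distrib_left
    by (rule sum.cong) (simp_all add: linear_fun_scale[OF assms] algebra_simps)
  show "(\<Sum>s\<in>F. c s * f s v) = (\<Sum>s\<in>F. c s * f s w)" if "\<forall>i\<in>S. v i = w i" for v w
  proof (rule sum.cong)
    show "c s * f s v = c s * f s w" if "s \<in> F" for s
      using linear_fun_cong[OF assms[OF that], of v w] \<open>\<forall>i\<in>S. v i = w i\<close> by simp
  qed simp
qed

lemma linear_fun_coords:
  assumes "T \<subseteq> S"
  shows "linear_fun S (\<lambda>w. \<Sum>j\<in>T. c j * w j)"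
proof (rule linear_fun_linear_combination)
  show "linear_fun S (\<lambda>w. w j)" if "j \<in> T" for j
    using that assms by (auto simp: linear_fun_def)
qed

lemma linear_fun_plus:
  assumes "linear_fun S f" "linear_fun S g"
  shows "linear_fun S (\<lambda>v. f v + g v)"
  using linear_fun_linear_combination[where F = "UNIV :: bool set" and S = S and c = "\<lambda>_. 1"
      and f = "\<lambda>b. if b then g else f"] assms
  by (simp add: UNIV_bool)

text \<open>Conjugate linear in the first argument and only semidefinite: the forms from the
  Hahn-Banach theorem and from the second variation may be degenerate, so null vectors need care
  throughout.\<close>

locale psd_form =
  fixes S :: "'i set" and R :: "('i \<Rightarrow> complex) \<Rightarrow> ('i \<Rightarrow> complex) \<Rightarrow> complex"
  assumes finite_index: "finite S"
    and lin: "linear_fun S (R u)"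
    and sym: "R v u = cnj (R u v)"
    and nonneg: "0 \<le> Re (R v v)"
begin

lemma diag_of_real: "R v v = complex_of_real (Re (R v v))"
  using sym[of v v] by (metis Reals_cnj_iff of_real_Re)

lemma add_left: "R (\<lambda>i. v i + w i) u = R v u + R w u"
  by (metis complex_cnj_add lin linear_fun_add sym)

lemma scale_left: "R (\<lambda>i. c * v i) u = cnj c * R v u"
  by (metis complex_cnj_mult lin linear_fun_scale sym)

lemma cong_left: "(\<And>i. i \<in> S \<Longrightarrow> v i = w i) \<Longrightarrow> R v u = R w u"
  by (metis lin linear_fun_cong sym)

lemma scale_diag: "Re (R (\<lambda>i. c * v i) (\<lambda>i. c * v i)) = (cmod c)\<^sup>2 * Re (R v v)"
proof -
  have "R (\<lambda>i. c * v i) (\<lambda>i. c * v i) = (cnj c * c) * R v v"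
    by (simp add: scale_left linear_fun_scale[OF lin])
  also have "cnj c * c = complex_of_real ((cmod c)\<^sup>2)"
    by (metis complex_norm_square mult.commute)
  finally show ?thesis
    by simp
qed

lemma quadratic:
  "Re (R (\<lambda>i. v i + c * w i) (\<lambda>i. v i + c * w i)) =
     Re (R v v) + 2 * Re (c * R v w) + (cmod c)\<^sup>2 * Re (R w w)"
proof -
  have "R (\<lambda>i. v i + c * w i) (\<lambda>i. v i + c * w i) =
      R v v + (c * R v w + cnj (c * R v w)) + R (\<lambda>i. c * w i) (\<lambda>i. c * w i)"
    by (simp add: add_left linear_fun_add[OF lin] linear_fun_scale[OF lin] scale_left sym[of w v])
  then show ?thesis
    by (simp add: scale_diag)
qed

lemma cauchy_schwarz: "(cmod (R v w))\<^sup>2 \<le> Re (R v v) * Re (R w w)"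
proof -
  define r where "r = (cmod (R v w))\<^sup>2"
  \<comment> \<open>The phase of \<open>c\<close> makes the cross term real, so the expansion along
    \<open>w\<close> is a real polynomial in \<open>t\<close>.\<close>
  have *: "0 \<le> Re (R v v) - 2 * t * r + t\<^sup>2 * r * Re (R w w)" for t :: real
  proof -
    define c where "c = complex_of_real (- t) * cnj (R v w)"
    have "c * R v w = complex_of_real (- t * r)"
      unfolding r_def complex_norm_square of_real_mult by (simp add: c_def)
    moreover have "(cmod c)\<^sup>2 = t\<^sup>2 * r"
      by (simp add: c_def r_def norm_mult power_mult_distrib)
    ultimately show ?thesis
      using nonneg[of "\<lambda>i. v i + c * w i"] by (simp add: quadratic)
  qed
  show ?thesis
  proof (cases "Re (R w w) = 0")
    case True
    have "r = 0"
    proof (rule ccontr)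
      assume "r \<noteq> 0"
      then show False
        \<comment> \<open>For \<open>R w w = 0\<close> the polynomial is linear in \<open>t\<close>,
          and this \<open>t\<close> gives it the value -1.\<close>
        using *[of "(Re (R v v) + 1) / (2 * r)"] True by simp
    qed
    then show ?thesis
      by (simp add: True r_def)
  next
    case False
    then have pos: "Re (R w w) > 0"
      using nonneg[of w] by linarith
    from *[of "1 / Re (R w w)"] pos have "0 \<le> Re (R v v) - r / Re (R w w)"
      by (simp add: power2_eq_square field_simps)
    with pos show ?thesis
      by (simp add: r_def field_simps)
  qed
qed

lemma null_right: "Re (R w w) = 0 \<Longrightarrow> R v w = 0"
  using cauchy_schwarz[of v w] by simp

text \<open>The second condition says that \<open>v - \<Sum>\<^sub>s R (z s) v * z s\<close> is in the kernel of \<open>R\<close>, which need not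
  be definite.\<close>

definition complete_orthonormal :: "nat \<Rightarrow> (nat \<Rightarrow> 'i \<Rightarrow> complex) \<Rightarrow> bool" where
  "complete_orthonormal N z \<longleftrightarrow>
     (\<forall>s<N. \<forall>t<N. R (z s) (z t) = (if s = t then 1 else 0)) \<and>
     (\<forall>v w. R w v = (\<Sum>s<N. R (z s) v * R w (z s)))"

text \<open>Induction on the kets. The residual of a new ket is either null, hence invisible to
  \<open>R\<close> by Cauchy-Schwarz and dropped, or it is normalized and appended; so
  \<open>N\<close> can be smaller than the size of \<open>T\<close>.\<close>

lemma gram_schmidt:
  assumes "finite T"
  shows "\<exists>N (z :: nat \<Rightarrow> 'i \<Rightarrow> complex).
           (\<forall>s<N. \<forall>t<N. R (z s) (z t) = (if s = t then 1 else 0)) \<and>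
           (\<forall>x\<in>T. \<forall>w. R w (ket x) = (\<Sum>s<N. R (z s) (ket x) * R w (z s)))"
  using assms
proof (induction T)
  case empty
  then show ?case
    by (intro exI[of _ 0]) simp
next
  case (insert x T)
  then obtain N and z :: "nat \<Rightarrow> 'i \<Rightarrow> complex" where
    on: "\<And>s t. s < N \<Longrightarrow> t < N \<Longrightarrow> R (z s) (z t) = (if s = t then 1 else 0)" and
    complete: "\<And>y w. y \<in> T \<Longrightarrow> R w (ket y) = (\<Sum>s<N. R (z s) (ket y) * R w (z s))"
    by blast
  define e where "e = (\<lambda>i. ket x i - (\<Sum>s<N. R (z s) (ket x) * z s i))"
  have Re: "R w e = R w (ket x) - (\<Sum>s<N. R (z s) (ket x) * R w (z s))" for w
    by (simp add: e_def linear_fun_diff[OF lin] linear_fun_sum[OF lin])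
  have ze: "R (z t) e = 0" if "t < N" for t
    using that by (simp add: Re on if_distrib[of "\<lambda>x. _ * x"] cong: if_cong)
  then have ez: "R e (z t) = 0" if "t < N" for t
    using that sym[of e "z t"] by simp
  show ?case
  proof (cases "Re (R e e) = 0")
    case True
    then have "R w (ket x) = (\<Sum>s<N. R (z s) (ket x) * R w (z s))" for w
      using Re[of w] null_right[of e w] by simp
    with complete on show ?thesis
      by (intro exI[of _ N] exI[of _ z]) blast
  next
    case False
    then have pos: "Re (R e e) > 0"
      using nonneg[of e] by linarith
    define c where "c = complex_of_real (1 / sqrt (Re (R e e)))"
    have c: "cnj c = c" "c * (c * R e e) = 1"
    proof -
      show "cnj c = c" by (simp add: c_def)
      have "c * c = complex_of_real (1 / Re (R e e))"
        using pos by (simp add: c_def flip: of_real_mult)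
      then have "c * (c * R e e) = complex_of_real (1 / Re (R e e)) * complex_of_real (Re (R e e))"
        by (metis diag_of_real mult.assoc)
      then show "c * (c * R e e) = 1"
        using pos by (simp flip: of_real_mult)
    qed
    define z' where "z' = z(N := \<lambda>i. c * e i)"
    have z'[simp]: "z' N = (\<lambda>i. c * e i)" "s < N \<Longrightarrow> z' s = z s" for s
      by (auto simp: z'_def)
    have "R e (ket x) = R e e"
      using ez by (simp add: Re)
    then have "R (z' N) (ket x) * R w (z' N) = (c * (c * R e e)) * R w e" for w
      by (simp add: c(1) scale_left linear_fun_scale[OF lin])
    then have "R w (ket x) = (\<Sum>s<Suc N. R (z' s) (ket x) * R w (z' s))" for w
      by (simp add: c(2) Re[of w])
    moreover have "R w (ket y) = (\<Sum>s<Suc N. R (z' s) (ket y) * R w (z' s))" if "y \<in> T" for y w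
      using complete[OF that, of w] complete[OF that, of e] ez by (simp add: scale_left)
    moreover have "R (z' s) (z' t) = (if s = t then 1 else 0)" if "s < Suc N" "t < Suc N" for s t
    proof (cases "s = N"; cases "t = N")
      assume "s = N" "t = N"
      with c show ?thesis
        by (simp add: scale_left linear_fun_scale[OF lin])
    next
      assume "s = N" "t \<noteq> N"
      with that ez[of t] show ?thesis
        by (simp add: scale_left)
    next
      assume "s \<noteq> N" "t = N"
      with that ze[of s] show ?thesis
        by (simp add: linear_fun_scale[OF lin])
    next
      assume "s \<noteq> N" "t \<noteq> N"
      with that on[of s t] show ?thesis
        by simp
    qed
    ultimately show ?thesis
      by (intro exI[of _ "Suc N"] exI[of _ z']) blast
  qed
qed

lemma complete_orthonormal_exists: "\<exists>N z. complete_orthonormal N z"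
proof -
  obtain N and z :: "nat \<Rightarrow> 'i \<Rightarrow> complex" where
    on: "\<forall>s<N. \<forall>t<N. R (z s) (z t) = (if s = t then 1 else 0)" and
    complete: "\<And>x w. x \<in> S \<Longrightarrow> R w (ket x) = (\<Sum>s<N. R (z s) (ket x) * R w (z s))"
    using gram_schmidt[OF finite_index] by blast
  have "R w v = (\<Sum>s<N. R (z s) v * R w (z s))" for v w
  proof -
    have "(\<Sum>s<N. R (z s) v * R w (z s)) = (\<Sum>s<N. \<Sum>x\<in>S. v x * (R (z s) (ket x) * R w (z s)))"
      by (subst linear_fun_expand[OF lin finite_index, of _ v])
        (simp add: sum_distrib_right mult.assoc)
    also have "\<dots> = (\<Sum>x\<in>S. v x * R w (ket x))"
      by (subst sum.swap) (simp add: complete flip: sum_distrib_left)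
    also have "\<dots> = R w v"
      by (simp add: linear_fun_expand[OF lin finite_index, of w v])
    finally show ?thesis by simp
  qed
  with on show ?thesis
    unfolding complete_orthonormal_def by blast
qed

context
  fixes N z
  assumes con: "complete_orthonormal N z"
begin

lemma orthonormal: "s < N \<Longrightarrow> t < N \<Longrightarrow> R (z s) (z t) = (if s = t then 1 else 0)"
  and complete: "R w v = (\<Sum>s<N. R (z s) v * R w (z s))"
  using con unfolding complete_orthonormal_def by blast+

lemma parseval: "Re (R v v) = (\<Sum>s<N. (cmod (R (z s) v))\<^sup>2)"
proof -
  have "R v v = (\<Sum>s<N. R (z s) v * R v (z s))"
    by (rule complete)
  also have "\<dots> = (\<Sum>s<N. complex_of_real ((cmod (R (z s) v))\<^sup>2))"
    by (rule sum.cong) (simp_all add: sym[of v "z s" for s] complex_norm_square del: of_real_power)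
  finally show ?thesis
    by simp
qed

lemma norm_combination:
  "Re (R (\<lambda>i. \<Sum>s<N. c s * z s i) (\<lambda>i. \<Sum>s<N. c s * z s i)) = (\<Sum>s<N. (cmod (c s))\<^sup>2)"
proof -
  have "R (z t) (\<lambda>i. \<Sum>s<N. c s * z s i) = c t" if "t < N" for t
    using that by (simp add: linear_fun_sum[OF lin] orthonormal if_distrib[of "\<lambda>x. _ * x"] cong: if_cong)
  then show ?thesis
    by (simp add: parseval)
qed

lemma null_residual:
  "Re (R (\<lambda>i. v i - (\<Sum>s<N. R (z s) v * z s i)) (\<lambda>i. v i - (\<Sum>s<N. R (z s) v * z s i))) = 0"
proof -
  have "R w (\<lambda>i. v i - (\<Sum>s<N. R (z s) v * z s i)) = 0" for w
  proof -
    have "R w v = (\<Sum>s<N. R (z s) v * R w (z s))"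
      by (rule complete)
    then show ?thesis
      by (simp only: linear_fun_diff[OF lin] linear_fun_sum[OF lin] diff_self)
  qed
  then show ?thesis
    by simp
qed

text \<open>A functional that kills the null vectors factors through the Hilbert space of
  \<open>R\<close>, so the residual of the orthonormal expansion does not contribute.\<close>

lemma expand_bounded:
  assumes f: "linear_fun T f" and bd: "\<And>v. Re (R v v) = 0 \<Longrightarrow> f v = 0"
  shows "f v = (\<Sum>s<N. R (z s) v * f (z s))"
  using bd[OF null_residual[of v]] by (simp add: linear_fun_diff[OF f] linear_fun_sum[OF f])

end

end

lemma psd_form_sum:
  assumes R: "\<And>i. i \<in> F \<Longrightarrow> psd_form S (R i)" and S: "finite S"
  shows "psd_form S (\<lambda>v w. \<Sum>i\<in>F. R i v w)"
proof
  show "linear_fun S (\<lambda>w. \<Sum>i\<in>F. R i u w)" for u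
    using linear_fun_linear_combination[where F = F and S = S and f = "\<lambda>i. R i u" and c = "\<lambda>_. 1"]
      psd_form.lin[OF R] by simp
  show "(\<Sum>i\<in>F. R i v u) = cnj (\<Sum>i\<in>F. R i u v)" for u v
    unfolding cnj_sum
  proof (rule sum.cong)
    show "R i v u = cnj (R i u v)" if "i \<in> F" for i
      using psd_form.sym[OF R[OF that]] .
  qed simp
  show "0 \<le> Re (\<Sum>i\<in>F. R i v v)" for v
    unfolding Re_sum
  proof (rule sum_nonneg)
    show "0 \<le> Re (R i v v)" if "i \<in> F" for i
      using psd_form.nonneg[OF R[OF that]] .
  qed
qed (rule S)

lemma psd_form_add:
  assumes "psd_form S Q" "psd_form S R"
  shows "psd_form S (\<lambda>v w. Q v w + R v w)"
proof
  show "finite S"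
    by (rule psd_form.finite_index[OF assms(1)])
  show "linear_fun S (\<lambda>w. Q u w + R u w)" for u
    by (intro linear_fun_plus psd_form.lin assms)
  show "Q v u + R v u = cnj (Q u v + R u v)" for u v
    using psd_form.sym[OF assms(1), of v u] psd_form.sym[OF assms(2), of v u]
    by (simp only: complex_cnj_add)
  show "0 \<le> Re (Q v v + R v v)" for v
    using psd_form.nonneg[OF assms(1), of v] psd_form.nonneg[OF assms(2), of v] by simp
qed

subsection \<open>A dominating form by the Hahn-Banach theorem\<close>

text \<open>The classical one-dimensional extension, done coordinate by coordinate so that the
  functional is just a vector of coefficients.\<close>

lemma finite_hahn_banach:
  fixes p :: "('i \<Rightarrow> real) \<Rightarrow> real"
  assumes "finite S"
    and subadd: "\<And>x y. p (\<lambda>i. x i + y i) \<le> p x + p y"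
    and homog: "\<And>c x. 0 < c \<Longrightarrow> p (\<lambda>i. c * x i) \<le> c * p x"
  shows "\<exists>c. \<forall>x. (\<forall>i. i \<notin> S \<longrightarrow> x i = 0) \<longrightarrow> (\<Sum>i\<in>S. c i * x i) \<le> p x"
  using assms(1)
proof (induction S)
  case empty
  have "0 \<le> p (\<lambda>i. 0)"
    using subadd[of "\<lambda>i. 0" "\<lambda>i. 0"] by simp
  moreover have "x = (\<lambda>i. 0)" if "\<forall>i. i \<notin> {} \<longrightarrow> x i = 0" for x :: "'i \<Rightarrow> real"
    using that by (intro ext) simp
  ultimately show ?case
    by (metis order.refl sum.empty)
next
  case (insert k S)
  then obtain c where c: "\<And>x. (\<forall>i. i \<notin> S \<longrightarrow> x i = 0) \<Longrightarrow> (\<Sum>i\<in>S. c i * x i) \<le> p x"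
    by blast
  define e where "e = (\<lambda>i. if i = k then 1 else 0 :: real)"
  define l where "l x = (\<Sum>i\<in>S. c i * x i)" for x
  define V where "V = {x :: 'i \<Rightarrow> real. \<forall>i. i \<notin> S \<longrightarrow> x i = 0}"
  have le: "l y - p (\<lambda>i. y i - e i) \<le> p (\<lambda>i. x i + e i) - l x" if "x \<in> V" "y \<in> V" for x y
  proof -
    have "l x + l y = l (\<lambda>i. x i + y i)"
      by (simp add: l_def sum.distrib algebra_simps)
    also have "\<dots> \<le> p (\<lambda>i. x i + y i)"
      unfolding l_def by (rule c) (use that in \<open>auto simp: V_def\<close>)
    also have "\<dots> \<le> p (\<lambda>i. x i + e i) + p (\<lambda>i. y i - e i)"
      using subadd[of "\<lambda>i. x i + e i" "\<lambda>i. y i - e i"] by simp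
    finally show ?thesis
      by simp
  qed
  \<comment> \<open>Any number between this supremum and the infimum of
    \<open>p (x + e) - l x\<close> would do; \<open>le\<close> says that there is one.\<close>
  define d where "d = (SUP y\<in>V. l y - p (\<lambda>i. y i - e i))"
  have V0: "(\<lambda>i. 0) \<in> V"
    by (simp add: V_def)
  then have ge: "l y - p (\<lambda>i. y i - e i) \<le> d" if "y \<in> V" for y
    unfolding d_def using that le[OF V0] by (intro cSUP_upper bdd_aboveI2) auto
  have le': "d \<le> p (\<lambda>i. x i + e i) - l x" if "x \<in> V" for x
    unfolding d_def using V0 le[OF that] by (intro cSUP_least) auto
  have "(\<Sum>i\<in>insert k S. (c(k := d)) i * z i) \<le> p z" if z: "\<forall>i. i \<notin> insert k S \<longrightarrow> z i = 0" for z
  proof -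
    define w where "w = z(k := 0)"
    have w: "w \<in> V" "z = (\<lambda>i. w i + z k * e i)"
      using z by (auto simp: w_def V_def e_def)
    have sum: "(\<Sum>i\<in>insert k S. (c(k := d)) i * z i) = d * z k + l w"
    proof -
      have "(\<Sum>i\<in>S. (c(k := d)) i * z i) = l w"
        unfolding l_def w_def by (rule sum.cong) (use insert in auto)
      with insert show ?thesis
        by simp
    qed
    have scale: "(\<lambda>i. a * w i) \<in> V" "l (\<lambda>i. a * w i) = a * l w" for a
      using w by (auto simp: V_def l_def sum_distrib_left algebra_simps)
    consider "z k = 0" | "z k > 0" | "z k < 0"
      by linarith
    then show ?thesis
    proof cases
      case 1
      then have "w = z"
        by (auto simp: w_def)
      with 1 w c[of w] show ?thesis
        by (simp only: sum) (simp add: V_def l_def)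
    next
      case 2
      have "d + l w / z k \<le> p (\<lambda>i. w i / z k + e i)"
        using le'[OF scale(1)[of "1 / z k"]] scale(2)[of "1 / z k"] by simp
      also have "(\<lambda>i. w i / z k + e i) = (\<lambda>i. (1 / z k) * z i)"
        using 2 by (subst (2) w(2)) (auto simp: field_simps)
      also have "p (\<lambda>i. (1 / z k) * z i) \<le> (1 / z k) * p z"
        using homog[of "1 / z k" z] 2 by simp
      finally have "d + l w / z k \<le> (1 / z k) * p z" .
      from mult_left_mono[OF this, of "z k"] 2 show ?thesis
        by (simp only: sum) (simp add: distrib_left mult.commute)
    next
      case 3
      have "l w / (- z k) - d \<le> p (\<lambda>i. w i / (- z k) - e i)"
        using ge[OF scale(1)[of "1 / (- z k)"]] scale(2)[of "1 / (- z k)"] by simp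
      also have "(\<lambda>i. w i / (- z k) - e i) = (\<lambda>i. (1 / (- z k)) * z i)"
        using 3 by (subst (2) w(2)) (auto simp: field_simps)
      also have "p (\<lambda>i. (1 / (- z k)) * z i) \<le> (1 / (- z k)) * p z"
        using homog[of "1 / (- z k)" z] 3 by simp
      finally have "l w / (- z k) - d \<le> (1 / (- z k)) * p z" .
      from mult_left_mono[OF this, of "- z k"] 3 show ?thesis
        by (simp only: sum) (simp add: right_diff_distrib mult.commute)
    qed
  qed
  then show ?case
    by (intro exI[of _ "c(k := d)"]) blast
qed

definition dot :: "nat \<Rightarrow> (nat \<Rightarrow> complex) \<Rightarrow> (nat \<Rightarrow> complex) \<Rightarrow> complex" where
  "dot n v w = (\<Sum>i<n. cnj (v i) * w i)"

definition sq_norm :: "nat \<Rightarrow> (nat \<Rightarrow> complex) \<Rightarrow> real" where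
  "sq_norm n v = (\<Sum>i<n. (cmod (v i))\<^sup>2)"

definition kernel_form :: "nat \<Rightarrow>
    (nat \<Rightarrow> nat \<Rightarrow> complex) \<Rightarrow> (nat \<Rightarrow> complex) \<Rightarrow> (nat \<Rightarrow> complex) \<Rightarrow> complex" where
  "kernel_form n \<sigma> v w = (\<Sum>i<n. \<Sum>j<n. cnj (v i) * \<sigma> i j * w j)"

text \<open>The form is obtained by the Hahn-Banach theorem from the sublinear functional
  \<open>p X = inf (\<beta> l - \<Sum>\<^sub>k t \<xi>\<^sub>k b\<^sub>k)\<close>, the infimum being over \<open>X + \<Sum>\<^sub>k \<xi>\<^sub>k \<xi>\<^sub>k\<^sup>* \<le> l\<close>. The coordinates
  \<open>(i, j, False)\<close> and \<open>(i, j, True)\<close> are the real and imaginary parts of the entries of \<open>X\<close>.\<close>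

lemma dominating_form:
  fixes t :: "(nat \<Rightarrow> complex) \<Rightarrow> 'b \<Rightarrow> real" and \<beta> :: real
  assumes homog: "\<And>c \<xi> b. t (\<lambda>i. complex_of_real c * \<xi> i) b = c\<^sup>2 * t \<xi> b"
    and bound: "\<And>l xs. 0 \<le> l \<Longrightarrow> (\<And>\<xi> b. (\<xi>, b) \<in> set xs \<Longrightarrow> b \<in> \<B>) \<Longrightarrow>
      (\<And>v. (\<Sum>(\<xi>, b)\<leftarrow>xs. (cmod (dot n v \<xi>))\<^sup>2) \<le> l * sq_norm n v) \<Longrightarrow>
      (\<Sum>(\<xi>, b)\<leftarrow>xs. t \<xi> b) \<le> \<beta> * l"
  shows "\<exists>\<sigma>. (\<forall>i j. \<sigma> j i = cnj (\<sigma> i j)) \<and> (\<Sum>i<n. Re (\<sigma> i i)) \<le> \<beta> \<and>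
    (\<forall>\<xi>. \<forall>b\<in>\<B>. t \<xi> b \<le> Re (kernel_form n \<sigma> \<xi> \<xi>))"
proof -
  \<comment> \<open>\<open>h v x\<close> is \<open>Re <v, X v>\<close> for the matrix
    \<open>X\<close> coded by \<open>x\<close>.\<close>
  define h :: "(nat \<Rightarrow> complex) \<Rightarrow> (nat \<times> nat \<times> bool \<Rightarrow> real) \<Rightarrow> real" where
    "h v x = (\<Sum>i<n. \<Sum>j<n. x (i, j, False) * Re (cnj (v i) * v j)
        - x (i, j, True) * Im (cnj (v i) * v j))" for v x
  have h_add: "h v (\<lambda>i. x i + y i) = h v x + h v y" for v x y
    by (simp add: h_def sum.distrib[symmetric] ring_distribs algebra_simps)
  have h_scale: "h v (\<lambda>i. c * x i) = c * h v x" for v x c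
    by (simp add: h_def sum_distrib_left right_diff_distrib mult.assoc)
  have h_bound: "\<exists>\<mu>\<ge>0. \<forall>v. h v x \<le> \<mu> * sq_norm n v" for x
  proof -
    have *: "x (i, j, False) * Re (cnj (v i) * v j) - x (i, j, True) * Im (cnj (v i) * v j)
        \<le> (\<bar>x (i, j, False)\<bar> + \<bar>x (i, j, True)\<bar>) * sq_norm n v" if "i < n" "j < n" for i j v
    proof -
      have le: "cmod (cnj (v i) * v j) \<le> sq_norm n v"
      proof -
        have m: "(cmod (v k))\<^sup>2 \<le> sq_norm n v" if "k < n" for k
          unfolding sq_norm_def by (rule member_le_sum) (use that in auto)
        have "2 * (cmod (v i) * cmod (v j)) \<le> (cmod (v i))\<^sup>2 + (cmod (v j))\<^sup>2"
          using sum_squares_bound[of "cmod (v i)" "cmod (v j)"] by (simp add: mult.assoc)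
        then show ?thesis
          using m[OF that(1)] m[OF that(2)] by (simp add: norm_mult)
      qed
      have "x (i, j, False) * Re (cnj (v i) * v j) \<le> \<bar>x (i, j, False)\<bar> * sq_norm n v"
        using mult_mono[OF order_refl abs_Re_le_cmod[THEN order_trans, OF le], of "\<bar>x (i, j, False)\<bar>"]
          abs_ge_self[of "x (i, j, False) * Re (cnj (v i) * v j)"] by (simp add: abs_mult)
      moreover have "- (x (i, j, True) * Im (cnj (v i) * v j)) \<le> \<bar>x (i, j, True)\<bar> * sq_norm n v"
        using mult_mono[OF order_refl abs_Im_le_cmod[THEN order_trans, OF le], of "\<bar>x (i, j, True)\<bar>"]
          abs_ge_minus_self[of "x (i, j, True) * Im (cnj (v i) * v j)"] by (simp add: abs_mult)
      ultimately show ?thesis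
        by (simp add: distrib_right)
    qed
    define \<mu> where "\<mu> = (\<Sum>i<n. \<Sum>j<n. \<bar>x (i, j, False)\<bar> + \<bar>x (i, j, True)\<bar>)"
    have "h v x \<le> \<mu> * sq_norm n v" for v
      unfolding h_def \<mu>_def sum_distrib_right by (intro sum_mono *) auto
    moreover have "0 \<le> \<mu>"
      unfolding \<mu>_def by (intro sum_nonneg) auto
    ultimately show ?thesis
      by blast
  qed
  \<comment> \<open>The operator inequality of the constraint, tested on all vectors
    \<open>v\<close>.\<close>
  define adm where "adm x l xs \<longleftrightarrow> 0 \<le> l \<and> (\<forall>(\<xi>, b)\<in>set xs. b \<in> \<B>) \<and>
    (\<forall>v. h v x + (\<Sum>(\<xi>, b)\<leftarrow>xs. (cmod (dot n v \<xi>))\<^sup>2) \<le> l * sq_norm n v)"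
    for x l and xs :: "((nat \<Rightarrow> complex) \<times> 'b) list"
  define val where "val l xs = \<beta> * l - (\<Sum>(\<xi>, b)\<leftarrow>xs. t \<xi> b)"
    for l and xs :: "((nat \<Rightarrow> complex) \<times> 'b) list"
  define P where "P x = {val l xs | l xs. adm x l xs}" for x
  define p where "p x = Inf (P x)" for x
  \<comment> \<open>Since \<open>- X \<le> \<mu>\<close>, removing \<open>X\<close> from the
    constraint costs at most \<open>\<mu>\<close>; then \<open>bound\<close> at
    \<open>l + \<mu>\<close> keeps the infimum finite.\<close>
  have val_bound: "\<exists>m. \<forall>l xs. adm x l xs \<longrightarrow> m \<le> val l xs" for x
  proof -
    obtain \<mu> where \<mu>: "\<mu> \<ge> 0" "\<And>v. h v (\<lambda>i. (-1) * x i) \<le> \<mu> * sq_norm n v"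
      using h_bound by meson
    have "- (\<beta> * \<mu>) \<le> val l xs" if adm: "adm x l xs" for l xs
    proof -
      have "(\<Sum>(\<xi>, b)\<leftarrow>xs. t \<xi> b) \<le> \<beta> * (l + \<mu>)"
      proof (rule bound)
        show "0 \<le> l + \<mu>"
          using adm \<mu> by (simp add: adm_def)
        show "b \<in> \<B>" if "(\<xi>, b) \<in> set xs" for \<xi> b
          using adm that by (auto simp: adm_def)
        show "(\<Sum>(\<xi>, b)\<leftarrow>xs. (cmod (dot n v \<xi>))\<^sup>2) \<le> (l + \<mu>) * sq_norm n v" for v
        proof -
          have "h v x + (\<Sum>(\<xi>, b)\<leftarrow>xs. (cmod (dot n v \<xi>))\<^sup>2) \<le> l * sq_norm n v"
            using adm by (simp add: adm_def)
          then show ?thesis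
            using \<mu>(2)[of v] by (simp only: h_scale distrib_right)
        qed
      qed
      then show ?thesis
        by (simp add: val_def algebra_simps)
    qed
    then show ?thesis
      by blast
  qed
  have bdd: "bdd_below (P x)" for x
    using val_bound[of x] by (auto simp: P_def bdd_below_def)
  have ne: "P x \<noteq> {}" for x
  proof -
    obtain \<mu> where "\<mu> \<ge> 0" "\<And>v. h v x \<le> \<mu> * sq_norm n v"
      using h_bound by meson
    then have "adm x \<mu> []"
      by (simp add: adm_def)
    then show ?thesis
      by (auto simp: P_def)
  qed
  have p_le: "p x \<le> val l xs" if "adm x l xs" for x l xs
    unfolding p_def by (rule cInf_lower[OF _ bdd]) (use that in \<open>auto simp: P_def\<close>)
  have p_ge: "m \<le> p x" if "\<And>l xs. adm x l xs \<Longrightarrow> m \<le> val l xs" for m x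
    unfolding p_def by (rule cInf_greatest[OF ne]) (use that in \<open>auto simp: P_def\<close>)
  have subadd: "p (\<lambda>i. x i + y i) \<le> p x + p y" for x y
  proof -
    have *: "p (\<lambda>i. x i + y i) \<le> val l xs + val l' ys" if "adm x l xs" "adm y l' ys" for l xs l' ys
    proof -
      have "adm (\<lambda>i. x i + y i) (l + l') (xs @ ys)"
        unfolding adm_def
      proof (intro conjI allI)
        fix v
        have "h v x + (\<Sum>(\<xi>, b)\<leftarrow>xs. (cmod (dot n v \<xi>))\<^sup>2) \<le> l * sq_norm n v"
          "h v y + (\<Sum>(\<xi>, b)\<leftarrow>ys. (cmod (dot n v \<xi>))\<^sup>2) \<le> l' * sq_norm n v"
          using that by (simp_all add: adm_def)
        then show "h v (\<lambda>i. x i + y i) + (\<Sum>(\<xi>, b)\<leftarrow>xs @ ys. (cmod (dot n v \<xi>))\<^sup>2)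
            \<le> (l + l') * sq_norm n v"
          by (simp add: h_add distrib_right)
      qed (use that in \<open>auto simp: adm_def\<close>)
      from p_le[OF this] show ?thesis
        by (simp add: val_def algebra_simps)
    qed
    have "p (\<lambda>i. x i + y i) - p x \<le> p y"
    proof (rule p_ge)
      fix l' ys assume y: "adm y l' ys"
      have "p (\<lambda>i. x i + y i) - val l' ys \<le> p x"
        by (rule p_ge) (use *[OF _ y] in \<open>simp add: diff_le_eq\<close>)
      then show "p (\<lambda>i. x i + y i) - p x \<le> val l' ys"
        by simp
    qed
    then show ?thesis
      by simp
  qed
  have homog': "p (\<lambda>i. c * x i) \<le> c * p x" if "0 < c" for c x
  proof -
    have *: "p (\<lambda>i. c * x i) \<le> c * val l xs" if a: "adm x l xs" for l xs
    proof -
      \<comment> \<open>The vectors enter the constraint through \<open>\<xi> \<xi>\<^sup>*\<close>,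
        so scaling by \<open>c\<close> means scaling them by \<open>sqrt c\<close>.\<close>
      define ys where "ys = map (\<lambda>(\<xi>, b). (\<lambda>i. complex_of_real (sqrt c) * \<xi> i, b)) xs"
      have sc: "(cmod (dot n v (\<lambda>i. complex_of_real (sqrt c) * \<xi> i)))\<^sup>2 = c * (cmod (dot n v \<xi>))\<^sup>2"
        for v \<xi>
      proof -
        have "dot n v (\<lambda>i. complex_of_real (sqrt c) * \<xi> i) = complex_of_real (sqrt c) * dot n v \<xi>"
          by (simp add: dot_def sum_distrib_left algebra_simps)
        then show ?thesis
          using \<open>0 < c\<close> by (simp add: norm_mult power_mult_distrib)
      qed
      have s1: "(\<Sum>(\<xi>, b)\<leftarrow>ys. (cmod (dot n v \<xi>))\<^sup>2) = c * (\<Sum>(\<xi>, b)\<leftarrow>xs. (cmod (dot n v \<xi>))\<^sup>2)" for v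
        unfolding ys_def sum_list_const_mult[symmetric] by (induction xs) (auto simp: sc)
      have s2: "(\<Sum>(\<xi>, b)\<leftarrow>ys. t \<xi> b) = c * (\<Sum>(\<xi>, b)\<leftarrow>xs. t \<xi> b)"
        unfolding ys_def sum_list_const_mult[symmetric]
        using \<open>0 < c\<close> by (induction xs) (auto simp: homog)
      have "adm (\<lambda>i. c * x i) (c * l) ys"
        unfolding adm_def
      proof (intro conjI allI)
        show "0 \<le> c * l"
          using a \<open>0 < c\<close> by (simp add: adm_def)
        show "\<forall>(\<xi>, b)\<in>set ys. b \<in> \<B>"
          using a by (auto simp: adm_def ys_def)
        fix v
        have "h v x + (\<Sum>(\<xi>, b)\<leftarrow>xs. (cmod (dot n v \<xi>))\<^sup>2) \<le> l * sq_norm n v"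
          using a by (simp add: adm_def)
        from mult_left_mono[OF this, of c]
        show "h v (\<lambda>i. c * x i) + (\<Sum>(\<xi>, b)\<leftarrow>ys. (cmod (dot n v \<xi>))\<^sup>2) \<le> (c * l) * sq_norm n v"
          using \<open>0 < c\<close> by (simp add: h_scale s1 algebra_simps)
      qed
      from p_le[OF this] show ?thesis
        by (simp add: val_def s2 algebra_simps)
    qed
    have "p (\<lambda>i. c * x i) / c \<le> p x"
      by (rule p_ge) (use * \<open>0 < c\<close> in \<open>simp add: divide_le_eq mult.commute\<close>)
    then show ?thesis
      using \<open>0 < c\<close> by (simp add: divide_le_eq mult.commute)
  qed
  define S where "S = {..<n} \<times> {..<n} \<times> (UNIV :: bool set)"
  have S_sum: "(\<Sum>q\<in>S. f q) = (\<Sum>i<n. \<Sum>j<n. f (i, j, False) + f (i, j, True))" for f :: "_ \<Rightarrow> real"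
    by (simp add: S_def sum.cartesian_product' UNIV_bool)
  have "finite S"
    by (simp add: S_def)
  from finite_hahn_banach[of S p, OF this subadd homog'] obtain c where
    c: "\<And>x. (\<forall>i. i \<notin> S \<longrightarrow> x i = 0) \<Longrightarrow> (\<Sum>i\<in>S. c i * x i) \<le> p x"
    by blast
  \<comment> \<open>The functional found is the real part of the sum of all
    \<open>w i j * X i j\<close>. On Hermitian \<open>X\<close> only the Hermitian part of the
    transpose of \<open>w\<close> matters, and this is the kernel \<open>\<sigma>\<close>.\<close>
  define w where "w i j = Complex (c (i, j, False)) (- c (i, j, True))" for i j
  define \<sigma> where "\<sigma> i j = (w j i + cnj (w i j)) / 2" for i j
  have c_le: "(\<Sum>i<n. \<Sum>j<n. Re (w i j * X i j)) \<le>
      p (\<lambda>(i, j, b). if i < n \<and> j < n then if b then Im (X i j) else Re (X i j) else 0)"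
    for X
  proof -
    let ?x = "\<lambda>(i, j, b). if i < n \<and> j < n then if b then Im (X i j) else Re (X i j) else 0"
    have "\<forall>q. q \<notin> S \<longrightarrow> ?x q = 0"
      by (auto simp: S_def)
    from c[OF this] show ?thesis
      unfolding S_sum by (simp add: w_def)
  qed
  show ?thesis
  proof (intro exI[of _ \<sigma>] conjI allI ballI)
    show "\<sigma> j i = cnj (\<sigma> i j)" for i j
      by (simp add: \<sigma>_def add.commute)
    define I where "I i j = (if i = j then 1 else 0 :: complex)" for i j :: nat
    let ?x = "\<lambda>(i, j, b). if i < n \<and> j < n then if b then Im (I i j) else Re (I i j) else 0"
    \<comment> \<open>Testing the functional at the identity matrix, with \<open>l = 1\<close> and
      no vectors, bounds the trace.\<close>
    have "adm ?x 1 []"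
    proof -
      have "h v ?x = sq_norm n v" for v
      proof -
        have "h v ?x = (\<Sum>i<n. \<Sum>j<n. if i = j then (cmod (v i))\<^sup>2 else 0)"
          unfolding h_def
          by (intro sum.cong refl) (auto
              simp: I_def cmod_power2 power2_eq_square[of "Re _"] power2_eq_square[of "Im _"])
        then show ?thesis
          by (simp add: sq_norm_def)
      qed
      then show ?thesis
        by (simp add: adm_def)
    qed
    from order_trans[OF c_le[of I] p_le[OF this]] 
    have "(\<Sum>i<n. \<Sum>j<n. Re (w i j * I i j)) \<le> \<beta>"
      by (simp add: val_def)
    moreover have "(\<Sum>i<n. \<Sum>j<n. Re (w i j * I i j)) = (\<Sum>i<n. \<Sum>j<n. if i = j then Re (\<sigma> i j) else 0)"
      by (intro sum.cong refl) (simp add: I_def \<sigma>_def)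
    ultimately show "(\<Sum>i<n. Re (\<sigma> i i)) \<le> \<beta>"
      by simp
  next
    fix \<xi> b assume b: "b \<in> \<B>"
    define X where "X i j = - (\<xi> i * cnj (\<xi> j))" for i j :: nat
    let ?x = "\<lambda>(i, j, b). if i < n \<and> j < n then if b then Im (X i j) else Re (X i j) else 0"
    \<comment> \<open>Testing it at \<open>- \<xi> \<xi>\<^sup>*\<close>, with this single pair and
      \<open>l = 0\<close>, gives the domination.\<close>
    have "adm ?x 0 [(\<xi>, b)]"
    proof -
      have "h v ?x + (cmod (dot n v \<xi>))\<^sup>2 = 0" for v
      proof -
        have "complex_of_real ((cmod (dot n v \<xi>))\<^sup>2) = (\<Sum>i<n. cnj (v i) * \<xi> i) * (\<Sum>j<n. v j * cnj (\<xi> j))"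
          unfolding complex_norm_square dot_def by simp
        also have "\<dots> = (\<Sum>i<n. \<Sum>j<n. (cnj (v i) * v j) * (\<xi> i * cnj (\<xi> j)))"
          by (simp add: sum_product algebra_simps)
        finally have "Re (complex_of_real ((cmod (dot n v \<xi>))\<^sup>2)) =
            (\<Sum>i<n. \<Sum>j<n. Re ((cnj (v i) * v j) * (\<xi> i * cnj (\<xi> j))))"
          by (simp only: Re_sum)
        then have "(cmod (dot n v \<xi>))\<^sup>2 = (\<Sum>i<n. \<Sum>j<n. Re ((cnj (v i) * v j) * (\<xi> i * cnj (\<xi> j))))"
          by (simp only: Re_complex_of_real)
        moreover have "h v ?x = - (\<Sum>i<n. \<Sum>j<n. Re ((cnj (v i) * v j) * (\<xi> i * cnj (\<xi> j))))"
          unfolding h_def sum_negf[symmetric]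
          by (intro sum.cong refl) (simp add: X_def algebra_simps)
        ultimately show ?thesis
          by simp
      qed
      then show ?thesis
        using b by (simp add: adm_def)
    qed
    from order_trans[OF c_le[of X] p_le[OF this]]
    have "t \<xi> b \<le> (\<Sum>i<n. \<Sum>j<n. - Re (w i j * X i j))"
      by (simp only: val_def sum_negf) simp
    also have "\<dots> = Re (kernel_form n \<sigma> \<xi> \<xi>)"
    proof -
      have "(\<Sum>i<n. \<Sum>j<n. Re (cnj (\<xi> i) * w j i * \<xi> j)) = (\<Sum>i<n. \<Sum>j<n. - Re (w i j * X i j))"
        by (subst sum.swap) (intro sum.cong refl, simp add: X_def algebra_simps)
      moreover have "(\<Sum>i<n. \<Sum>j<n. Re (cnj (\<xi> i) * cnj (w i j) * \<xi> j)) =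
          (\<Sum>i<n. \<Sum>j<n. - Re (w i j * X i j))"
        by (intro sum.cong refl) (simp add: X_def algebra_simps)
      moreover have "Re (kernel_form n \<sigma> \<xi> \<xi>) =
          ((\<Sum>i<n. \<Sum>j<n. Re (cnj (\<xi> i) * w j i * \<xi> j)) +
              (\<Sum>i<n. \<Sum>j<n. Re (cnj (\<xi> i) * cnj (w i j) * \<xi> j))) / 2"
      proof -
        have *: "Re (cnj (\<xi> i) * \<sigma> i j * \<xi> j) =
            (Re (cnj (\<xi> i) * w j i * \<xi> j) + Re (cnj (\<xi> i) * cnj (w i j) * \<xi> j)) / 2" for i j
          by (simp add: \<sigma>_def field_simps)
        show ?thesis
          unfolding kernel_form_def Re_sum * by (simp only: sum.distrib sum_divide_distrib[symmetric])
      qed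
      ultimately show ?thesis
        by simp
    qed
    finally show "t \<xi> b \<le> Re (kernel_form n \<sigma> \<xi> \<xi>)" .
  qed
qed

subsection \<open>Matrices and resolvents\<close>

type_synonym matrix = "nat \<times> nat \<Rightarrow> complex"

text \<open>Entries outside the square are set to 0, so that equations between matrices of size
  \<open>m\<close> are plain equalities of functions.\<close>

definition mmul :: "nat \<Rightarrow> matrix \<Rightarrow> matrix \<Rightarrow> matrix" where
  "mmul m a b = (\<lambda>(i, j). if i < m \<and> j < m then \<Sum>k<m. a (i, k) * b (k, j) else 0)"

definition madj :: "matrix \<Rightarrow> matrix" where
  "madj a = (\<lambda>(i, j). cnj (a (j, i)))"

definition mone :: "nat \<Rightarrow> matrix" where
  "mone m = (\<lambda>(i, j). if i = j \<and> i < m then 1 else 0)"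

abbreviation square :: "nat \<Rightarrow> (nat \<times> nat) set" where
  "square m \<equiv> {..<m} \<times> {..<m}"

definition supported :: "nat \<Rightarrow> matrix \<Rightarrow> bool" where
  "supported m a \<longleftrightarrow> (\<forall>p. p \<notin> square m \<longrightarrow> a p = 0)"

definition unitaries :: "nat \<Rightarrow> matrix set" where
  "unitaries m = {U. supported m U \<and> mmul m (madj U) U = mone m \<and> mmul m U (madj U) = mone m}"

lemma mmul_apply: "i < m \<Longrightarrow> j < m \<Longrightarrow> mmul m a b (i, j) = (\<Sum>k<m. a (i, k) * b (k, j))"
  by (simp add: mmul_def)

lemma supported_mmul [simp]: "supported m (mmul m a b)"
  and supported_mone [simp]: "supported m (mone m)"
  by (auto simp: supported_def mmul_def mone_def)

lemma supported_madj [simp]: "supported m (madj a) \<longleftrightarrow> supported m a"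
  by (auto simp: supported_def madj_def)

lemma supported_zero: "supported m a \<Longrightarrow> p \<notin> square m \<Longrightarrow> a p = 0"
  unfolding supported_def by blast

lemma sum_mult_ket: "finite S \<Longrightarrow> i \<in> S \<Longrightarrow> (\<Sum>j\<in>S. f j * ket i j) = f i"
  and sum_ket_mult: "finite S \<Longrightarrow> i \<in> S \<Longrightarrow> (\<Sum>j\<in>S. ket i j * f j) = f i"
  by (simp_all add: ket_def if_distrib[of "\<lambda>x. _ * x"] if_distrib[of "\<lambda>x. x * _"] cong: if_cong)

lemma cnj_ket [simp]: "cnj (ket i j) = ket i j"
  by (simp add: ket_def)

lemma matrix_eqI:
  assumes "supported m a" "supported m b" "\<And>i j. i < m \<Longrightarrow> j < m \<Longrightarrow> a (i, j) = b (i, j)"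
  shows "a = b"
proof
  show "a p = b p" for p
  proof (cases "p \<in> square m")
    case True
    then show ?thesis
      using assms(3)[of "fst p" "snd p"] by auto
  next
    case False
    then show ?thesis
      using assms(1,2) unfolding supported_def by metis
  qed
qed

lemma mmul_assoc: "mmul m (mmul m a b) c = mmul m a (mmul m b c)"
proof (rule matrix_eqI)
  fix i j assume "i < m" "j < m"
  then have "mmul m (mmul m a b) c (i, j) = (\<Sum>k<m. \<Sum>l<m. a (i, l) * b (l, k) * c (k, j))"
    by (simp add: mmul_apply sum_distrib_right)
  also have "\<dots> = (\<Sum>l<m. \<Sum>k<m. a (i, l) * b (l, k) * c (k, j))"
    by (rule sum.swap)
  also have "\<dots> = mmul m a (mmul m b c) (i, j)"
    using \<open>i < m\<close> \<open>j < m\<close> by (simp add: mmul_apply sum_distrib_left mult.assoc)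
  finally show "mmul m (mmul m a b) c (i, j) = mmul m a (mmul m b c) (i, j)" .
qed simp_all

lemma madj_mmul: "madj (mmul m a b) = mmul m (madj b) (madj a)"
  by (auto simp: madj_def mmul_def mult.commute)

lemma madj_madj [simp]: "madj (madj a) = a"
  by (auto simp: madj_def)

lemma madj_mone [simp]: "madj (mone m) = mone m"
  by (auto simp: madj_def mone_def)

lemma mmul_mone_left: "supported m a \<Longrightarrow> mmul m (mone m) a = a"
  by (rule matrix_eqI[of m])
    (simp_all add: mmul_apply mone_def if_distrib[of "\<lambda>x. x * _"] cong: if_cong)

lemma mmul_mone_right: "supported m a \<Longrightarrow> mmul m a (mone m) = a"
  by (rule matrix_eqI[of m])
    (simp_all add: mmul_apply mone_def if_distrib[of "\<lambda>x. _ * x"] cong: if_cong)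

lemma mmul_mone_middle: "mmul m a (mmul m (mone m) b) = mmul m a b"
proof (rule matrix_eqI[of m])
  fix i j assume "i < m" "j < m"
  have "mmul m (mone m) b (k, j) = b (k, j)" if "k < m" for k
    using that \<open>j < m\<close> by (simp add: mmul_apply mone_def if_distrib[of "\<lambda>x. x * _"] cong: if_cong)
  then show "mmul m a (mmul m (mone m) b) (i, j) = mmul m a b (i, j)"
    using \<open>i < m\<close> \<open>j < m\<close> by (simp add: mmul_apply[of i m j])
qed simp_all

lemma mmul_add_right: "mmul m a (\<lambda>p. v p + w p) = (\<lambda>p. mmul m a v p + mmul m a w p)"
  and mmul_add_left: "mmul m (\<lambda>p. v p + w p) a = (\<lambda>p. mmul m v a p + mmul m w a p)"
  by (auto simp: mmul_def sum.distrib algebra_simps)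

lemma mmul_scale_right: "mmul m a (\<lambda>p. c * v p) = (\<lambda>p. c * mmul m a v p)"
  and mmul_scale_left: "mmul m (\<lambda>p. c * v p) a = (\<lambda>p. c * mmul m v a p)"
  by (auto simp: mmul_def sum_distrib_left algebra_simps)

lemma mmul_cong_right: "(\<And>p. p \<in> square m \<Longrightarrow> v p = w p) \<Longrightarrow> mmul m a v = mmul m a w"
  by (auto simp: mmul_def intro!: ext sum.cong)

lemma Re_cnj_mult_self: "Re (cnj z * z) = (cmod z)\<^sup>2"
  by (simp add: cmod_power2 power2_eq_square[of "Re _"] power2_eq_square[of "Im _"])

lemma linear_fun_mmul_right:
  assumes "linear_fun (square m) f"
  shows "linear_fun (square m) (\<lambda>b. f (mmul m a b))"
  unfolding linear_fun_def
proof (intro conjI allI impI)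
  show "f (mmul m a v) = f (mmul m a w)" if "\<forall>p\<in>square m. v p = w p" for v w
    by (rule arg_cong[where f = f], rule mmul_cong_right) (use that in blast)
qed (simp_all only: mmul_add_right mmul_scale_right linear_fun_add[OF assms] linear_fun_scale[OF assms])

text \<open>The matrix version of cosine plus \<open>\<i>\<close> times sine: as \<open>C\<close>
  and \<open>D\<close> commute, the mixed terms in \<open>(C + c D) (C - c D)\<close> cancel and
  \<open>C^2 + D^2 = 1\<close> is left.\<close>

lemma unitary_pair:
  assumes "supported m C" "supported m D" "madj C = C" "madj D = D"
    and comm: "mmul m C D = mmul m D C"
    and one: "\<And>p. mmul m C C p + mmul m D D p = mone m p"
    and c: "c = \<i> \<or> c = - \<i>"
  shows "(\<lambda>p. C p + c * D p) \<in> unitaries m"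
proof -
  have adj: "madj (\<lambda>p. C p + c * D p) = (\<lambda>p. C p - c * D p)"
  proof
    fix p :: "nat \<times> nat"
    obtain i j where p: "p = (i, j)"
      by (cases p)
    have "cnj (C (j, i)) = C (i, j)" "cnj (D (j, i)) = D (i, j)"
      using fun_cong[OF assms(3), of "(i, j)"] fun_cong[OF assms(4), of "(i, j)"]
      by (simp_all add: madj_def)
    then show "madj (\<lambda>p. C p + c * D p) p = C p - c * D p"
      using c by (auto simp: p madj_def)
  qed
  have cc: "c * c = -1"
    using c by auto
  have s: "supported m (\<lambda>p. C p + c * D p)" for c
    using assms(1,2) by (auto simp: supported_def)
  have s': "supported m (\<lambda>p. C p - c * D p)" for c
    using assms(1,2) by (auto simp: supported_def)
  have main: "mmul m (\<lambda>p. C p + d * D p) (\<lambda>p. C p - d * D p) = mone m" if d: "d * d = -1" for d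
  proof (rule matrix_eqI[of m])
    fix i j assume ij: "i < m" "j < m"
    have cD: "(\<Sum>k<m. C (i, k) * D (k, j)) = (\<Sum>k<m. D (i, k) * C (k, j))"
      using fun_cong[OF comm, of "(i, j)"] ij by (simp add: mmul_apply)
    have "mmul m (\<lambda>p. C p + d * D p) (\<lambda>p. C p - d * D p) (i, j) =
        (\<Sum>k<m. C (i, k) * C (k, j)) - d * (\<Sum>k<m. C (i, k) * D (k, j))
         + d * (\<Sum>k<m. D (i, k) * C (k, j)) - (d * d) * (\<Sum>k<m. D (i, k) * D (k, j))"
      using ij by (simp add: mmul_apply sum_distrib_left sum.distrib[symmetric]
        sum_subtractf[symmetric] algebra_simps)
    also have "\<dots> = mone m (i, j)"
      using one[of "(i, j)"] ij d cD by (simp add: mmul_apply)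
    finally show "mmul m (\<lambda>p. C p + d * D p) (\<lambda>p. C p - d * D p) (i, j) = mone m (i, j)" .
  qed (use s s' in simp_all)
  from main[of c] main[of "-c"] cc s show ?thesis
    by (simp add: unitaries_def adj)
qed

text \<open>For Hermitian \<open>h\<close> this is the form of \<open>1 + h^2\<close>, written as
  \<open><v, w> + <h v, h w>\<close> to make positivity visible.\<close>

lemma psd_form_dot_shift:
  fixes h :: matrix
  shows "psd_form {..<m} (\<lambda>v w. (\<Sum>i<m. cnj (v i) * w i) +
     (\<Sum>i<m. cnj (\<Sum>j<m. h (i, j) * v j) * (\<Sum>j<m. h (i, j) * w j)))"
proof
  show "linear_fun {..<m} (\<lambda>w. (\<Sum>i<m. cnj (v i) * w i) +
     (\<Sum>i<m. cnj (\<Sum>j<m. h (i, j) * v j) * (\<Sum>j<m. h (i, j) * w j)))" for v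
    by (intro linear_fun_plus linear_fun_coords linear_fun_linear_combination subset_refl)
  show "0 \<le> Re ((\<Sum>i<m. cnj (v i) * v i) +
     (\<Sum>i<m. cnj (\<Sum>j<m. h (i, j) * v j) * (\<Sum>j<m. h (i, j) * v j)))" for v
    unfolding plus_complex.sel Re_sum Re_cnj_mult_self
    by (intro add_nonneg_nonneg sum_nonneg) simp_all
  show "(\<Sum>i<m. cnj (v i) * w i) + (\<Sum>i<m. cnj (\<Sum>j<m. h (i, j) * v j) * (\<Sum>j<m. h (i, j) * w j)) =
    cnj ((\<Sum>i<m. cnj (w i) * v i) + (\<Sum>i<m. cnj (\<Sum>j<m. h (i, j) * w j) * (\<Sum>j<m. h (i, j) * v j)))" for v w
    by (simp add: mult.commute)
qed simp

text \<open>The inverse of \<open>1 + h\<^sup>2\<close> is \<open>\<Sum>\<^sub>s z\<^sub>s z\<^sub>s\<^sup>*\<close> for a basis \<open>z\<close> orthonormal for the form of \<open>1 + h\<^sup>2\<close>.\<close>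

lemma resolvent_exists:
  assumes h: "madj h = h" "supported m h"
  shows "\<exists>K. supported m K \<and> madj K = K \<and> (\<forall>p. K p + mmul m h (mmul m h K) p = mone m p) \<and>
    mmul m h K = mmul m K h \<and> (\<forall>p. cmod (K p) \<le> 1)"
proof -
  define R where "R = (\<lambda>(v :: nat \<Rightarrow> complex) w. (\<Sum>i<m. cnj (v i) * w i) +
     (\<Sum>i<m. cnj (\<Sum>j<m. h (i, j) * v j) * (\<Sum>j<m. h (i, j) * w j)))"
  interpret psd_form "{..<m}" R
    unfolding R_def by (rule psd_form_dot_shift[of m h])
  obtain N z where con: "complete_orthonormal N z"
    using complete_orthonormal_exists by blast
  have hc: "cnj (h (i, j)) = h (j, i)" for i j
    using fun_cong[OF h(1), of "(j, i)"] by (simp add: madj_def)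
  define K where "K = (\<lambda>(i, j). if i < m \<and> j < m then \<Sum>s<N. z s i * cnj (z s j) else 0)"
  have K: "supported m K" "madj K = K"
    by (auto simp: K_def supported_def madj_def mult.commute)
  \<comment> \<open>\<open>K\<close> inverts the form because it reproduces coordinates. Coordinate
    functionals can be expanded in \<open>z\<close>, as \<open>R\<close> dominates the standard norm
    and its null vectors vanish on \<open>{..<m}\<close>.\<close>
  have RK: "R v (\<lambda>i. K (i, j)) = cnj (v j)" if "j < m" for v j
  proof -
    have lf: "linear_fun {..<m} (\<lambda>v :: nat \<Rightarrow> complex. v j)"
      using that by (auto simp: linear_fun_def)
    have null: "v j = 0" if "Re (R v v) = 0" for v
    proof -
      have "(cmod (v j))\<^sup>2 \<le> (\<Sum>i<m. (cmod (v i))\<^sup>2)"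
        by (rule member_le_sum) (use \<open>j < m\<close> in auto)
      also have "\<dots> \<le> Re (R v v)"
      proof -
        have "0 \<le> (\<Sum>i<m. (cmod (\<Sum>j<m. h (i, j) * v j))\<^sup>2)"
          by (intro sum_nonneg) simp
        then show ?thesis
          unfolding R_def plus_complex.sel Re_sum Re_cnj_mult_self by linarith
      qed
      finally show ?thesis
        using that by simp
    qed
    have "v j = (\<Sum>s<N. R (z s) v * z s j)"
      by (rule expand_bounded[OF con, where f = "\<lambda>v. v j"]) (fact lf, fact null)
    then have "cnj (v j) = (\<Sum>s<N. cnj (R (z s) v * z s j))"
      by (simp only: cnj_sum)
    also have "\<dots> = (\<Sum>s<N. cnj (z s j) * R v (z s))"
      by (rule sum.cong) (simp_all add: sym[of v "z s" for s])
    also have "\<dots> = R v (\<lambda>i. \<Sum>s<N. cnj (z s j) * z s i)"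
      by (rule linear_fun_sum[OF lin, symmetric])
    also have "\<dots> = R v (\<lambda>i. K (i, j))"
      by (rule linear_fun_cong[OF lin]) (use that in \<open>simp add: K_def mult.commute\<close>)
    finally show ?thesis
      by simp
  qed
  have res: "K p + mmul m h (mmul m h K) p = mone m p" for p
  proof (cases "p \<in> square m")
    case False
    then show ?thesis
      by (simp only: supported_zero[OF K(1) False] supported_zero[OF supported_mmul False]
        supported_zero[OF supported_mone False] add_0)
  next
    case True
    then obtain i j where p: "p = (i, j)" "i < m" "j < m"
      by auto
    have "R (ket i) (\<lambda>i. K (i, j)) = K (i, j) + (\<Sum>l<m. h (i, l) * (\<Sum>k<m. h (l, k) * K (k, j)))"
      using p by (simp add: R_def sum_mult_ket sum_ket_mult hc)
    also have "\<dots> = K p + mmul m h (mmul m h K) p"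
      using p by (simp add: mmul_apply)
    finally show ?thesis
      using p by (cases "i = j") (simp_all add: RK ket_def mone_def)
  qed
  have resolvent_l: "mmul m K x =
      (\<lambda>p. mmul m K (mmul m K x) p + mmul m K (mmul m h (mmul m h (mmul m K x))) p)" for x
  proof -
    have "K = mmul m K (\<lambda>p. K p + mmul m h (mmul m h K) p)"
      by (simp add: res mmul_mone_right K)
    also have "\<dots> = (\<lambda>p. mmul m K K p + mmul m K (mmul m h (mmul m h K)) p)"
      by (rule mmul_add_right)
    finally have "mmul m K x = mmul m (\<lambda>p. mmul m K K p + mmul m K (mmul m h (mmul m h K)) p) x"
      by simp
    also have "\<dots> = (\<lambda>p. mmul m (mmul m K K) x p + mmul m (mmul m K (mmul m h (mmul m h K))) x p)"
      by (rule mmul_add_left)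
    finally show ?thesis
      by (simp add: mmul_assoc)
  qed
  have res': "mone m = (\<lambda>p. K p + mmul m K (mmul m h h) p)"
  proof -
    have "mone m = madj (\<lambda>p. K p + mmul m h (mmul m h K) p)"
      by (simp add: res)
    also have "\<dots> = (\<lambda>p. madj K p + madj (mmul m h (mmul m h K)) p)"
      by (auto simp: madj_def)
    finally show ?thesis
      by (simp add: madj_mmul K h mmul_assoc)
  qed
  \<comment> \<open>Insert \<open>1 = K + K h h\<close> to the left of \<open>h K\<close>; after
    factoring out \<open>K h\<close>, the other factor is \<open>K + h h K = 1\<close>.\<close>
  have comm: "mmul m h K = mmul m K h"
  proof -
    have "mmul m h K = mmul m (mone m) (mmul m h K)"
      by (simp add: mmul_mone_left)
    also have "\<dots> = (\<lambda>p. mmul m K (mmul m h K) p + mmul m K (mmul m h (mmul m h (mmul m h K))) p)"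
      by (simp only: res' mmul_add_left mmul_assoc)
    also have "\<dots> = mmul m K (mmul m h (\<lambda>p. K p + mmul m h (mmul m h K) p))"
      by (simp only: mmul_add_right)
    also have "\<dots> = mmul m K h"
      by (simp add: res mmul_mone_right h)
    finally show ?thesis .
  qed
  \<comment> \<open>This bound is uniform in \<open>h\<close>, which the limit in
    \<open>variation\<close> rests on. In \<open>K = K K + (K h) (h K)\<close> the diagonal entries
    on the right are sums of squares, hence \<open>|K i i|^2 \<le> K i i\<close>.\<close>
  have bound: "cmod (K p) \<le> 1" for p
  proof (cases "p \<in> square m")
    case False
    show ?thesis
      by (simp only: supported_zero[OF K(1) False]) simp
  next
    case True
    then obtain i j where p: "p = (i, j)" "i < m" "j < m"
      by auto
    define L where "L = mmul m h K"
    have Kc: "K (l, i) = cnj (K (i, l))" for i l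
      using fun_cong[OF K(2), of "(l, i)"] by (simp add: madj_def)
    have Lc: "mmul m K h (i, l) = cnj (L (l, i))" for l i
    proof -
      have "madj L = mmul m K h"
        by (simp add: L_def madj_mmul K h)
      then show ?thesis
        by (simp add: madj_def fun_eq_iff)
    qed
    have *: "Re (K (i, i)) = (\<Sum>l<m. (cmod (K (i, l)))\<^sup>2) + (\<Sum>l<m. (cmod (L (l, i)))\<^sup>2)" if "i < m" for i
    proof -
      have "K = mmul m K (mone m)"
        by (simp add: mmul_mone_right K)
      also have "\<dots> = (\<lambda>p. mmul m K K p + mmul m (mmul m K h) L p)"
        using resolvent_l[of "mone m"] by (simp add: mmul_mone_right K mmul_assoc L_def)
      finally have "K (i, i) = mmul m K K (i, i) + mmul m (mmul m K h) L (i, i)"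
        by metis
      also have "\<dots> = (\<Sum>l<m. complex_of_real ((cmod (K (i, l)))\<^sup>2)) +
          (\<Sum>l<m. complex_of_real ((cmod (L (l, i)))\<^sup>2))"
        using that unfolding complex_norm_square
        by (simp add: mmul_apply[OF that that] Lc Kc[of _ i] mult.commute)
      finally show ?thesis
        by (simp flip: of_real_sum of_real_add)
    qed
    have row: "(cmod (K (i, l)))\<^sup>2 \<le> Re (K (i, i))" if "i < m" "l < m" for i l
    proof -
      have "(cmod (K (i, l)))\<^sup>2 \<le> (\<Sum>l<m. (cmod (K (i, l)))\<^sup>2)"
        by (rule member_le_sum) (use that in auto)
      also have "\<dots> \<le> Re (K (i, i))"
        unfolding *[OF that(1)] by (simp add: sum_nonneg)
      finally show ?thesis .
    qed
    have "cmod (K (i, i)) * cmod (K (i, i)) \<le> cmod (K (i, i)) * 1"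
      using row[OF p(2) p(2)] complex_Re_le_cmod[of "K (i, i)"] by (simp add: power2_eq_square)
    then have "cmod (K (i, i)) \<le> 1"
      by (cases "K (i, i) = 0") simp_all
    then have "(cmod (K (i, j)))\<^sup>2 \<le> 1"
      using row[OF p(2,3)] complex_Re_le_cmod[of "K (i, i)"] by linarith
    then show ?thesis
      by (simp add: p abs_square_le_1)
  qed
  show ?thesis
    using K res comm bound by blast
qed

subsection \<open>The little Grothendieck inequality\<close>

definition total_sq :: "nat \<Rightarrow> (nat \<Rightarrow> matrix \<Rightarrow> complex) \<Rightarrow> matrix \<Rightarrow> real" where
  "total_sq N f b = (\<Sum>s<N. (cmod (f s b))\<^sup>2)"

definition trace_form :: "nat \<Rightarrow> ((nat \<Rightarrow> complex) \<Rightarrow> (nat \<Rightarrow> complex) \<Rightarrow> complex) \<Rightarrow> real" where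
  "trace_form m Q = (\<Sum>i<m. Re (Q (ket i) (ket i)))"

text \<open>Let \<open>\<phi>\<close> be the functional on matrices that sends
  \<open>w v\<^sup>*\<close> to \<open>Q v w\<close>. This is \<open>\<phi>\<close> at
  \<open>y x\<^sup>*\<close>, while \<open>rowform\<close> is \<open>\<phi>\<close> at
  \<open>x\<^sup>* y\<close>; for a positive form, \<open>trace_form\<close> is
  \<open>\<phi>\<close> at 1.\<close>

definition colform :: "nat \<Rightarrow>
    ((nat \<Rightarrow> complex) \<Rightarrow> (nat \<Rightarrow> complex) \<Rightarrow> complex) \<Rightarrow> matrix \<Rightarrow> matrix \<Rightarrow> complex" where
  "colform m Q x y = (\<Sum>i<m. Q (\<lambda>l. x (l, i)) (\<lambda>l. y (l, i)))"

definition rowform :: "nat \<Rightarrow>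
    ((nat \<Rightarrow> complex) \<Rightarrow> (nat \<Rightarrow> complex) \<Rightarrow> complex) \<Rightarrow> matrix \<Rightarrow> matrix \<Rightarrow> complex" where
  "rowform m Q x y = (\<Sum>i<m. Q (\<lambda>l. cnj (y (i, l))) (\<lambda>l. cnj (x (i, l))))"

lemma psd_form_colform:
  assumes "psd_form {..<m} Q"
  shows "psd_form (square m) (colform m Q)"
proof -
  interpret psd_form "{..<m}" Q by fact
  show ?thesis
    unfolding colform_def
  proof (rule psd_form_sum)
    fix i assume i: "i \<in> {..<m}"
    show "psd_form (square m) (\<lambda>x y. Q (\<lambda>l. x (l, i)) (\<lambda>l. y (l, i)))"
    proof
      show "linear_fun (square m) (\<lambda>y. Q (\<lambda>l. u (l, i)) (\<lambda>l. y (l, i)))" for u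
        unfolding linear_fun_def
      proof (intro conjI allI impI)
        show "Q (\<lambda>l. u (l, i)) (\<lambda>l. v (l, i)) = Q (\<lambda>l. u (l, i)) (\<lambda>l. w (l, i))"
          if "\<forall>p\<in>square m. v p = w p" for v w
          by (rule linear_fun_cong[OF lin]) (use that i in auto)
      qed (simp_all add: linear_fun_add[OF lin] linear_fun_scale[OF lin])
      show "Q (\<lambda>l. v (l, i)) (\<lambda>l. u (l, i)) = cnj (Q (\<lambda>l. u (l, i)) (\<lambda>l. v (l, i)))" for u v
        by (rule sym)
      show "0 \<le> Re (Q (\<lambda>l. v (l, i)) (\<lambda>l. v (l, i)))" for v
        by (rule nonneg)
    qed simp
  qed simp
qed

lemma psd_form_rowform:
  assumes "psd_form {..<m} Q"
  shows "psd_form (square m) (rowform m Q)"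
proof -
  interpret psd_form "{..<m}" Q by fact
  show ?thesis
    unfolding rowform_def
  proof (rule psd_form_sum)
    fix i assume i: "i \<in> {..<m}"
    show "psd_form (square m) (\<lambda>x y. Q (\<lambda>l. cnj (y (i, l))) (\<lambda>l. cnj (x (i, l))))"
    proof
      show "linear_fun (square m) (\<lambda>y. Q (\<lambda>l. cnj (y (i, l))) (\<lambda>l. cnj (u (i, l))))" for u
        unfolding linear_fun_def
      proof (intro conjI allI impI)
        show "Q (\<lambda>l. cnj (v (i, l))) (\<lambda>l. cnj (u (i, l))) = Q (\<lambda>l. cnj (w (i, l))) (\<lambda>l. cnj (u (i, l)))"
          if "\<forall>p\<in>square m. v p = w p" for v w
          by (rule cong_left) (use that i in auto)
      qed (simp_all add: add_left scale_left)
      show "Q (\<lambda>l. cnj (u (i, l))) (\<lambda>l. cnj (v (i, l))) =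
          cnj (Q (\<lambda>l. cnj (v (i, l))) (\<lambda>l. cnj (u (i, l))))" for u v
        by (rule sym)
      show "0 \<le> Re (Q (\<lambda>l. cnj (v (i, l))) (\<lambda>l. cnj (v (i, l))))" for v
        by (rule nonneg)
    qed simp
  qed simp
qed

lemma unitary_entry_le:
  assumes "U \<in> unitaries m"
  shows "cmod (U p) \<le> 1"
proof (cases "p \<in> square m")
  case False
  from assms have "supported m U"
    by (simp add: unitaries_def)
  from supported_zero[OF this False] show ?thesis
    by simp
next
  case True
  then obtain i j where p: "p = (i, j)" "i < m" "j < m"
    by auto
  have "mmul m (madj U) U (j, j) = 1"
    using assms p by (simp add: unitaries_def mone_def)
  then have "Re (\<Sum>k<m. cnj (U (k, j)) * U (k, j)) = 1"
    using p by (simp add: mmul_apply madj_def)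
  then have "(\<Sum>k<m. (cmod (U (k, j)))\<^sup>2) = 1"
    unfolding Re_sum Re_cnj_mult_self .
  moreover have "(cmod (U (i, j)))\<^sup>2 \<le> (\<Sum>k<m. (cmod (U (k, j)))\<^sup>2)"
    by (rule member_le_sum) (use p in auto)
  ultimately show ?thesis
    by (simp add: p abs_square_le_1)
qed

text \<open>Matrices are functions on an infinite index set, so compactness comes from Tychonoff's
  theorem: entrywise equations define a closed subset of a product of unit discs.\<close>

lemma compact_unitaries: "compact (unitaries m)"
proof -
  have "compact (PiE UNIV (\<lambda>_ :: nat \<times> nat. cball (0 :: complex) 1))"
  proof -
    have "compactin (product_topology
        (\<lambda>_ :: nat \<times> nat. euclidean) UNIV) (PiE UNIV (\<lambda>_. cball (0 :: complex) 1))"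
      unfolding compactin_PiE by simp
    then show ?thesis
      by (simp add: euclidean_product_topology)
  qed
  moreover have "closed (unitaries m)"
  proof -
    have cont: "continuous_on UNIV (\<lambda>U :: matrix. U p)" for p
      by simp
    have m: "continuous_on UNIV (\<lambda>U. mmul m (a U) (b U) p)"
      if "\<And>q. continuous_on UNIV (\<lambda>U :: matrix. a U q)" "\<And>q. continuous_on UNIV (\<lambda>U. b U q)"
      for p a b
    proof (cases p)
      case (Pair i j)
      then show ?thesis
        by (cases "i < m \<and> j < m") (auto simp: mmul_def intro!: continuous_intros that)
    qed
    have a: "continuous_on UNIV (\<lambda>U. madj U p)" for p
      by (cases p) (auto simp: madj_def intro!: continuous_intros)
    have "unitaries m = (\<Inter>p. {U. p \<notin> square m \<longrightarrow> U p = 0}) \<inter>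
        (\<Inter>p. {U. mmul m (madj U) U p = mone m p}) \<inter> (\<Inter>p. {U. mmul m U (madj U) p = mone m p})"
      unfolding unitaries_def supported_def fun_eq_iff by blast
    also have "closed \<dots>"
    proof (intro closed_Int closed_INT ballI)
      show "closed {U :: matrix. p \<notin> square m \<longrightarrow> U p = 0}" for p
        by (cases "p \<in> square m") (simp_all add: closed_Collect_eq)
      show "closed {U. mmul m (madj U) U p = mone m p}" for p
        by (intro closed_Collect_eq m a cont continuous_on_const)
      show "closed {U. mmul m U (madj U) p = mone m p}" for p
        by (intro closed_Collect_eq m a cont continuous_on_const)
    qed
    finally show ?thesis .
  qed
  moreover have "unitaries m \<subseteq> PiE UNIV (\<lambda>_ :: nat \<times> nat. cball (0 :: complex) 1)"
    using unitary_entry_le by auto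
  ultimately show ?thesis
    by (metis compact_Int_closed inf.absorb_iff2)
qed

lemma mone_unitary: "mone m \<in> unitaries m"
  by (simp add: unitaries_def mmul_mone_left)

lemma mmul_unitary:
  assumes "U \<in> unitaries m" "V \<in> unitaries m"
  shows "mmul m U V \<in> unitaries m"
proof -
  have U: "mmul m (madj U) U = mone m" "mmul m U (madj U) = mone m" "supported m U"
    and V: "mmul m (madj V) V = mone m" "mmul m V (madj V) = mone m" "supported m V"
    using assms by (auto simp: unitaries_def)
  have "mmul m (mmul m (madj V) (madj U)) (mmul m U V) = mmul m (madj V) (mmul m (mmul m (madj U) U) V)"
    by (simp add: mmul_assoc)
  moreover have "mmul m (mmul m U V) (mmul m (madj V) (madj U)) =
      mmul m U (mmul m (mmul m V (madj V)) (madj U))"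
    by (simp add: mmul_assoc)
  ultimately show ?thesis
    using U V by (simp add: unitaries_def madj_mmul mmul_mone_left)
qed

lemma total_sq_maximum:
  assumes f: "\<And>s. s < N \<Longrightarrow> linear_fun (square m) (f s)"
  shows "\<exists>U\<in>unitaries m. \<forall>V\<in>unitaries m. total_sq N f V \<le> total_sq N f U"
proof (rule continuous_attains_sup)
  show "compact (unitaries m)"
    by (rule compact_unitaries)
  show "unitaries m \<noteq> {}"
    using mone_unitary by blast
  have "continuous_on (unitaries m) (f s)" if "s < N" for s
  proof -
    have eq: "f s = (\<lambda>v. \<Sum>p\<in>square m. v p * f s (ket p))"
      by (rule ext, rule linear_fun_expand[OF f[OF that]]) simp
    show ?thesis
      by (subst eq) (intro continuous_intros
          continuous_on_subset[OF continuous_on_product_coordinates]; simp)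
  qed
  then show "continuous_on (unitaries m) (total_sq N f)"
    unfolding total_sq_def by (intro continuous_intros) auto
qed

text \<open>The parallelogram law for \<open>x\<close> and \<open>\<i> * y\<close>.\<close>

lemma total_sq_lincomb:
  "(\<Sum>s<N. (cmod (x s + \<i> * y s))\<^sup>2) + (\<Sum>s<N. (cmod (x s - \<i> * y s))\<^sup>2) =
     2 * ((\<Sum>s<N. (cmod (x s))\<^sup>2) + (\<Sum>s<N. (cmod (y s))\<^sup>2))"
proof -
  have "(cmod (a + \<i> * b))\<^sup>2 + (cmod (a - \<i> * b))\<^sup>2 = 2 * ((cmod a)\<^sup>2 + (cmod b)\<^sup>2)" for a b
    by (simp add: cmod_power2 power2_eq_square[of "Re _"] power2_eq_square[of "Im _"]
      power2_eq_square[of "_ - _"] power2_eq_square[of "_ + _"] algebra_simps)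
  then show ?thesis
    by (simp add: sum.distrib[symmetric] sum_distrib_left)
qed

section \<open>Variations at a maximizing unitary\<close>

context
  fixes m N :: nat and f :: "nat \<Rightarrow> matrix \<Rightarrow> complex" and U :: matrix
  assumes f: "\<And>s. s < N \<Longrightarrow> linear_fun (square m) (f s)"
    and U: "U \<in> unitaries m"
    and max: "\<And>V. V \<in> unitaries m \<Longrightarrow> total_sq N f V \<le> total_sq N f U"
begin

text \<open>Half the derivative of \<open>total_sq N f\<close> at \<open>U\<close> in the direction
  \<open>U x\<close>.\<close>

definition slope :: "matrix \<Rightarrow> real" where
  "slope x = Re (\<Sum>s<N. cnj (f s U) * f s (mmul m U x))"

lemma f_mmul: "s < N \<Longrightarrow> linear_fun (square m) (\<lambda>x. f s (mmul m U x))"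
  by (rule linear_fun_mmul_right[OF f])

text \<open>The Cayley transforms \<open>(1 \<plusminus> \<i> h)\<^sup>2 (1 + h\<^sup>2)\<^sup>-\<^sup>1 = C \<plusminus> \<i> D\<close> of \<open>\<plusminus>h\<close> are unitary, where \<open>C = 2 K - 1\<close>,
  \<open>D = 2 h K\<close> and \<open>K = (1 + h\<^sup>2)\<^sup>-\<^sup>1\<close>. Adding the maximality of \<open>U\<close> against \<open>U (C + \<i> D)\<close> and \<open>U (C - \<i> D)\<close>
  cancels the terms of first order.\<close>

lemma variation_resolvent:
  assumes h: "madj h = h" "supported m h"
    and K: "supported m K" "madj K = K" "\<And>p. K p + mmul m h (mmul m h K) p = mone m p"
      "mmul m h K = mmul m K h"
  shows "total_sq N f (mmul m U (mmul m h K)) \<le> slope (mmul m h (mmul m h K))"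
proof -
  define X where "X = mmul m h (mmul m h K)"
  define Y where "Y = mmul m h K"
  define C where "C = (\<lambda>p. 2 * K p + (-1) * mone m p)"
  define D where "D = (\<lambda>p. 2 * Y p)"
  have X: "X = (\<lambda>p. mone m p + (-1) * K p)"
    using K(3) by (auto simp: X_def algebra_simps)
  \<comment> \<open>\<open>Y^2 = K - K^2\<close> is what makes
    \<open>C^2 + D^2 = (2 K - 1)^2 + 4 Y^2\<close> equal to 1.\<close>
  have YY: "mmul m Y Y = (\<lambda>p. K p + (-1) * mmul m K K p)"
  proof -
    have "mmul m Y Y = mmul m h (mmul m K (mmul m h K))"
      by (simp add: Y_def mmul_assoc)
    also have "mmul m K (mmul m h K) = mmul m h (mmul m K K)"
      by (metis K(4) mmul_assoc)
    also have "mmul m h (mmul m h (mmul m K K)) = mmul m X K"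
      by (simp add: X_def mmul_assoc)
    finally show ?thesis
      by (simp only: X mmul_add_left mmul_scale_left mmul_mone_left[OF K(1)])
  qed
  have unit: "(\<lambda>p. C p + c * D p) \<in> unitaries m" if "c = \<i> \<or> c = - \<i>" for c
  proof (rule unitary_pair)
    show "supported m C" "supported m D"
      using K(1) supported_mone[of m] supported_mmul[of m h K]
      unfolding supported_def C_def D_def Y_def by (metis mult_zero_right add_0)+
    show "madj C = C"
    proof -
      have "madj C = (\<lambda>p. 2 * madj K p + (-1) * madj (mone m) p)"
        by (auto simp: C_def madj_def)
      then show ?thesis
        by (simp add: K(2) C_def)
    qed
    show "madj D = D"
    proof -
      have "madj D = (\<lambda>p. 2 * madj Y p)"
        by (auto simp: D_def madj_def)
      moreover have "madj Y = Y"
        by (simp add: Y_def madj_mmul K h)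
      ultimately show ?thesis
        by (simp add: D_def)
    qed
    have "mmul m K Y = mmul m Y K"
      by (simp add: Y_def mmul_assoc[symmetric] K(4)[symmetric])
    then show "mmul m C D = mmul m D C"
      by (simp only: C_def D_def mmul_add_left mmul_add_right mmul_scale_left mmul_scale_right
        mmul_mone_left mmul_mone_right Y_def supported_mmul) (simp add: algebra_simps)
    show "mmul m C C p + mmul m D D p = mone m p" for p
      by (simp only: C_def D_def mmul_add_left mmul_add_right mmul_scale_left mmul_scale_right
        mmul_mone_left mmul_mone_right K(1) YY supported_mone) (simp add: algebra_simps)
    show "c = \<i> \<or> c = - \<i>"
      by fact
  qed
  define u where "u s = f s U" for s
  define x where "x s = f s (mmul m U X)" for s
  define y where "y s = f s (mmul m U Y)" for s
  have Us: "supported m U"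
    using U by (simp add: unitaries_def)
  have C: "C = (\<lambda>p. mone m p + (-2) * X p)"
    unfolding C_def X by (auto simp: algebra_simps)
  have f_comb: "f s (mmul m U (\<lambda>p. C p + c * D p)) = (u s - 2 * x s) + c * (2 * y s)" if "s < N" for s c
    unfolding C D_def linear_fun_add[OF f_mmul[OF that]] linear_fun_scale[OF f_mmul[OF that]]
      mmul_mone_right[OF Us] by (simp add: u_def x_def y_def)
  have le: "(\<Sum>s<N. (cmod ((u s - 2 * x s) + c * (2 * y s)))\<^sup>2) \<le> (\<Sum>s<N. (cmod (u s))\<^sup>2)"
    if "c = \<i> \<or> c = - \<i>" for c
    using max[OF mmul_unitary[OF U unit[OF that]]] by (simp add: total_sq_def f_comb u_def)
  have "2 * ((\<Sum>s<N. (cmod (u s - 2 * x s))\<^sup>2) + (\<Sum>s<N. (cmod (2 * y s))\<^sup>2)) \<le> 2 * (\<Sum>s<N. (cmod (u s))\<^sup>2)"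
    using le[of \<i>] le[of "- \<i>"]
        total_sq_lincomb[where N = N and x = "\<lambda>s. u s - 2 * x s" and y = "\<lambda>s. 2 * y s"] by simp
  \<comment> \<open>Discarding the square of \<open>2 x\<close>, which is of fourth order in
    \<open>h\<close>, leaves \<open>4 |y|^2 \<le> 4 Re <u, x>\<close>.\<close>
  moreover have "(\<Sum>s<N. (cmod (u s - 2 * x s))\<^sup>2) \<ge>
      (\<Sum>s<N. (cmod (u s))\<^sup>2) - 4 * (\<Sum>s<N. Re (cnj (u s) * x s))"
  proof -
    have "(cmod (a - 2 * b))\<^sup>2 = (cmod a)\<^sup>2 - 4 * Re (cnj a * b) + 4 * (cmod b)\<^sup>2" for a b
      by (simp add: cmod_power2 power2_eq_square[of "Re _"] power2_eq_square[of "Im _"]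
        power2_eq_square[of "_ - _"] algebra_simps)
    then have "(cmod (a - 2 * b))\<^sup>2 \<ge> (cmod a)\<^sup>2 - 4 * Re (cnj a * b)" for a b
      by simp
    then show ?thesis
      unfolding sum_distrib_left sum_subtractf[symmetric] by (intro sum_mono)
  qed
  moreover have "(\<Sum>s<N. (cmod (2 * y s))\<^sup>2) = 4 * (\<Sum>s<N. (cmod (y s))\<^sup>2)"
    by (simp add: norm_mult power_mult_distrib sum_distrib_left)
  ultimately have "(\<Sum>s<N. (cmod (y s))\<^sup>2) \<le> (\<Sum>s<N. Re (cnj (u s) * x s))"
    by simp
  then show ?thesis
    by (simp only: total_sq_def slope_def Re_sum u_def x_def y_def X_def Y_def)
qed

lemma f_mmul_tendsto:
  assumes "s < N" "\<And>p. p \<in> square m \<Longrightarrow> (\<lambda>n. x n p) \<longlonglongrightarrow> y p"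
  shows "(\<lambda>n. f s (mmul m U (x n))) \<longlonglongrightarrow> f s (mmul m U y)"
proof -
  have fin: "finite (square m)"
    by simp
  show ?thesis
    unfolding linear_fun_expand[OF f_mmul[OF assms(1)] fin, of "x _"]
      linear_fun_expand[OF f_mmul[OF assms(1)] fin, of y]
    by (intro tendsto_sum tendsto_mult tendsto_const assms(2))
qed

lemma mmul_tendsto:
  assumes "\<And>p. (\<lambda>n. x n p) \<longlonglongrightarrow> y p"
  shows "(\<lambda>n. mmul m a (x n) p) \<longlonglongrightarrow> mmul m a y p"
  by (cases p) (auto simp: mmul_def intro!: tendsto_intros assms)

text \<open>Apply the previous lemma to \<open>h / k\<close> and let \<open>k\<close> tend to infinity.\<close>

lemma variation:
  assumes h: "madj h = h" "supported m h"
  shows "total_sq N f (mmul m U h) \<le> slope (mmul m h h)"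
proof -
  define t where "t n = complex_of_real (inverse (real (Suc n)))" for n
  define g where "g n = (\<lambda>p. t n * h p)" for n
  have g: "madj (g n) = g n" "supported m (g n)" for n
  proof -
    have "madj (g n) = (\<lambda>p. t n * madj h p)"
      by (auto simp: g_def madj_def t_def)
    then show "madj (g n) = g n"
      by (simp add: h g_def)
    show "supported m (g n)"
      using h(2) by (auto simp: supported_def g_def)
  qed
  obtain K where K: "\<And>n. supported m (K n)" "\<And>n. madj (K n) = K n"
    "\<And>n p. K n p + mmul m (g n) (mmul m (g n) (K n)) p = mone m p"
    "\<And>n. mmul m (g n) (K n) = mmul m (K n) (g n)" "\<And>n p. cmod (K n p) \<le> 1"
    using resolvent_exists[OF g] by metis
  have gK: "mmul m (g n) (K n) = (\<lambda>p. t n * mmul m h (K n) p)" for n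
    unfolding g_def mmul_scale_left ..
  have ggK: "mmul m (g n) (mmul m (g n) (K n)) = (\<lambda>p. (t n)\<^sup>2 * mmul m h (mmul m h (K n)) p)" for n
    unfolding g_def mmul_scale_left mmul_scale_right by (simp add: power2_eq_square mult.assoc)
  \<comment> \<open>Apart from \<open>K n\<close>, both sides are homogeneous of degree two in
    \<open>t n\<close>, so its square cancels and the scaling survives only inside
    \<open>K n\<close>.\<close>
  have ineq: "total_sq N f (mmul m U (mmul m h (K n))) \<le> slope (mmul m h (mmul m h (K n)))" for n
  proof -
    define r where "r = (inverse (real (Suc n)))\<^sup>2"
    have r: "r > 0" "(cmod (t n))\<^sup>2 = r" "(t n)\<^sup>2 = complex_of_real r"
      unfolding r_def t_def norm_of_real by simp_all
    have "r * total_sq N f (mmul m U (mmul m h (K n))) = total_sq N f (mmul m U (mmul m (g n) (K n)))"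
      unfolding gK total_sq_def sum_distrib_left
      by (rule sum.cong) (simp_all add: linear_fun_scale[OF f_mmul] norm_mult power_mult_distrib r)
    also have "\<dots> \<le> slope (mmul m (g n) (mmul m (g n) (K n)))"
      by (rule variation_resolvent[OF g K(1-4)])
    also have "\<dots> = r * slope (mmul m h (mmul m h (K n)))"
    proof -
      have "(\<Sum>s<N. cnj (f s U) * f s (mmul m U (\<lambda>p. complex_of_real r * mmul m h (mmul m h (K n)) p))) =
          complex_of_real r * (\<Sum>s<N. cnj (f s U) * f s (mmul m U (mmul m h (mmul m h (K n)))))"
        unfolding sum_distrib_left by (rule sum.cong) (simp_all add: linear_fun_scale[OF f_mmul])
      then show ?thesis
        unfolding ggK slope_def r by simp
    qed
    finally show ?thesis
      using r(1) by simp
  qed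
  have t0: "t \<longlonglongrightarrow> 0"
    unfolding t_def using tendsto_of_real[OF LIMSEQ_inverse_real_of_nat, where 'a = complex]
    by (simp only: of_real_0)
  define B where "B i j = (\<Sum>k<m. cmod (h (i, k)) * (\<Sum>l<m. cmod (h (k, l))))" for i j :: nat
  \<comment> \<open>\<open>K n\<close> differs from 1 by \<open>(t n)^2\<close> times
    \<open>h h (K n)\<close>, which stays bounded because the entries of \<open>K n\<close>
    do.\<close>
  have Klim: "(\<lambda>n. K n p) \<longlonglongrightarrow> mone m p" for p :: "nat \<times> nat"
  proof -
    obtain i j where p: "p = (i, j)"
      by (cases p)
    have bd: "cmod (mmul m h (mmul m h (K n)) p) \<le> B i j" for n
    proof (cases "p \<in> square m")
      case False
      show ?thesis
        unfolding supported_zero[OF supported_mmul False] B_def by (simp add: sum_nonneg)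
    next
      case True
      have 1: "cmod (mmul m h (K n) (k, j)) \<le> (\<Sum>l<m. cmod (h (k, l)))" if "k < m" for k
      proof -
        have "cmod (\<Sum>l<m. h (k, l) * K n (l, j)) \<le> (\<Sum>l<m. cmod (h (k, l)))"
          by (rule order_trans[OF norm_sum sum_mono]) (simp add: norm_mult mult_left_le K(5))
        then show ?thesis
          using that True p by (simp add: mmul_apply)
      qed
      have "cmod (\<Sum>k<m. h (i, k) * mmul m h (K n) (k, j)) \<le> B i j"
        unfolding B_def
        by (rule order_trans[OF norm_sum sum_mono]) (simp add: norm_mult mult_left_mono 1)
      then show ?thesis
        using True p by (simp add: mmul_apply[of i m j h])
    qed
    have "(\<lambda>n. (t n)\<^sup>2 * mmul m h (mmul m h (K n)) p) \<longlonglongrightarrow> 0"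
    proof (rule Lim_null_comparison)
      show "eventually (\<lambda>n. cmod ((t n)\<^sup>2 * mmul m h (mmul m h (K n)) p) \<le>
          (cmod (t n))\<^sup>2 * B i j) sequentially"
        by (simp add: norm_mult norm_power mult_left_mono bd)
      have "(\<lambda>n. (cmod (t n))\<^sup>2 * B i j) \<longlonglongrightarrow> (cmod 0)\<^sup>2 * B i j"
        by (intro tendsto_intros t0)
      then show "(\<lambda>n. (cmod (t n))\<^sup>2 * B i j) \<longlonglongrightarrow> 0"
        by simp
    qed
    then have "(\<lambda>n. mone m p - (t n)\<^sup>2 * mmul m h (mmul m h (K n)) p) \<longlonglongrightarrow> mone m p - 0"
      by (intro tendsto_intros)
    moreover have "K n p = mone m p - (t n)\<^sup>2 * mmul m h (mmul m h (K n)) p" for n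
      using K(3)[of n p] unfolding ggK by (simp add: algebra_simps)
    ultimately show ?thesis
      by simp
  qed
  have hK: "(\<lambda>n. mmul m h (K n) p) \<longlonglongrightarrow> h p" for p
    using mmul_tendsto[where x =
        K and y = "mone m" and a = h and p = p, OF Klim] by (simp add: mmul_mone_right h)
  have hhK: "(\<lambda>n. mmul m h (mmul m h (K n)) p) \<longlonglongrightarrow> mmul m h h p" for p
    by (rule mmul_tendsto[OF hK])
  have lim1: "(\<lambda>n. total_sq N f (mmul m U (mmul m h (K n)))) \<longlonglongrightarrow> total_sq N f (mmul m U h)"
    unfolding total_sq_def by (intro tendsto_intros f_mmul_tendsto hK) simp
  have lim2: "(\<lambda>n. slope (mmul m h (mmul m h (K n)))) \<longlonglongrightarrow> slope (mmul m h h)"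
    unfolding slope_def by (intro tendsto_intros f_mmul_tendsto hhK) simp
  show ?thesis
    by (rule LIMSEQ_le[OF lim1 lim2]) (use ineq in blast)
qed

section \<open>The positive forms given by the second variation\<close>

definition outer :: "(nat \<Rightarrow> complex) \<Rightarrow> (nat \<Rightarrow> complex) \<Rightarrow> matrix" where
  "outer w v = (\<lambda>(i, j). if i < m \<and> j < m then w i * cnj (v j) else 0)"

lemma slope_cong: "(\<And>p. p \<in> square m \<Longrightarrow> x p = y p) \<Longrightarrow> slope x = slope y"
  unfolding slope_def by (simp add: mmul_cong_right[of m x y])

lemma slope_add: "slope (\<lambda>p. x p + y p) = slope x + slope y"
  unfolding slope_def by (simp add: linear_fun_add[OF f_mmul] sum.distrib[symmetric] algebra_simps)

lemma slope_scale: "slope (\<lambda>p. complex_of_real c * x p) = c * slope x"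
proof -
  have "(\<Sum>s<N. cnj (f s U) * f s (mmul m U (\<lambda>p. complex_of_real c * x p))) =
      complex_of_real c * (\<Sum>s<N. cnj (f s U) * f s (mmul m U x))"
    unfolding sum_distrib_left by (rule sum.cong) (simp_all add: linear_fun_scale[OF f_mmul])
  then show ?thesis
    unfolding slope_def by simp
qed

lemma slope_sum: "slope (\<lambda>p. \<Sum>i\<in>I. x i p) = (\<Sum>i\<in>I. slope (x i))"
proof (induction I rule: infinite_finite_induct)
  case (insert i I)
  then show ?case
    using slope_add[of "x i" "\<lambda>p. \<Sum>i\<in>I. x i p"] by simp
qed (use slope_scale[of 0] in simp_all)

lemma slope_mone: "slope (mone m) = total_sq N f U"
proof -
  have "mmul m U (mone m) = U"
    by (rule mmul_mone_right) (use U in \<open>simp add: unitaries_def\<close>)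
  then show ?thesis
    by (simp only: slope_def total_sq_def Re_sum Re_cnj_mult_self)
qed

text \<open>For \<open>x = h + \<i> k\<close> with Hermitian \<open>h\<close> and \<open>k\<close>
  one has \<open>x x\<^sup>* + x\<^sup>* x = 2 (h^2 + k^2)\<close>, and this factor 2 pays for
  \<open>|a + \<i> b|^2 \<le> 2 |a|^2 + 2 |b|^2\<close>.\<close>

lemma total_sq_mmul_le:
  assumes x: "supported m x"
  shows "total_sq N f (mmul m U x) \<le> slope (mmul m x (madj x)) + slope (mmul m (madj x) x)"
proof -
  define h where "h = (\<lambda>p. (1 / 2) * (x p + madj x p))"
  define k where "k = (\<lambda>p. (- \<i> / 2) * (x p + (-1) * madj x p))"
  have x': "supported m (madj x)"
    using x by simp
  have h: "madj h = h" "supported m h"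
    using x x' by (auto simp: h_def madj_def supported_def)
  have k: "madj k = k" "supported m k"
    using x x' by (auto simp: k_def madj_def supported_def algebra_simps)
  have xhk: "x = (\<lambda>p. h p + \<i> * k p)"
    by (auto simp: h_def k_def algebra_simps)
  have sq: "(cmod (a + \<i> * b))\<^sup>2 \<le> 2 * (cmod a)\<^sup>2 + 2 * (cmod b)\<^sup>2" for a b
  proof -
    have "(cmod (a + \<i> * b))\<^sup>2 + (cmod (a - \<i> * b))\<^sup>2 = 2 * ((cmod a)\<^sup>2 + (cmod b)\<^sup>2)"
      using total_sq_lincomb[where N = "Suc 0" and x = "\<lambda>_. a" and y = "\<lambda>_. b"] by simp
    then show ?thesis
      using zero_le_power2[of "cmod (a - \<i> * b)"] by (simp only: distrib_left)
  qed
  have "total_sq N f (mmul m U x) = (\<Sum>s<N. (cmod (f s (mmul m U h) + \<i> * f s (mmul m U k)))\<^sup>2)"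
    unfolding total_sq_def
    by (rule sum.cong, simp, subst xhk) (simp add: linear_fun_add[OF f_mmul] linear_fun_scale[OF f_mmul])
  also have "\<dots> \<le> 2 * total_sq N f (mmul m U h) + 2 * total_sq N f (mmul m U k)"
    unfolding total_sq_def sum_distrib_left sum.distrib[symmetric] by (intro sum_mono sq)
  also have "\<dots> \<le> 2 * slope (mmul m h h) + 2 * slope (mmul m k k)"
    using variation[OF h] variation[OF k] by simp
  also have "\<dots> = slope (\<lambda>p. complex_of_real 2 * (mmul m h h p + mmul m k k p))"
    by (simp only: slope_scale slope_add distrib_left)
  also have "(\<lambda>p. complex_of_real 2 * (mmul m h h p + mmul m k k p)) =
      (\<lambda>p. mmul m x (madj x) p + mmul m (madj x) x p)"
    unfolding h_def k_def mmul_scale_left mmul_scale_right mmul_add_left mmul_add_right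
    by (rule ext) (simp add: field_simps)
  finally show ?thesis
    by (simp only: slope_add)
qed

text \<open>The functional \<open>x \<mapsto> <f U, f (U x)>\<close> on rank one matrices,
  symmetrized to be Hermitian by construction; its diagonal is the slope.\<close>

definition left_form :: "(nat \<Rightarrow> complex) \<Rightarrow> (nat \<Rightarrow> complex) \<Rightarrow> complex" where
  "left_form v w = ((\<Sum>s<N. cnj (f s U) * f s (mmul m U (outer w v))) +
     cnj (\<Sum>s<N. cnj (f s U) * f s (mmul m U (outer v w)))) / 2"

lemma left_form_diag: "Re (left_form v v) = slope (outer v v)"
  by (simp add: left_form_def slope_def)

text \<open>\<open>h = v v\<^sup>*\<close> satisfies \<open>h^2 = r h\<close> with
  \<open>r = |v|^2\<close>, so \<open>variation\<close> squeezes a sum of squares below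
  \<open>r * slope h\<close>. For \<open>r = 0\<close> the matrix vanishes.\<close>

lemma slope_outer_nonneg: "0 \<le> slope (outer v v)"
proof -
  define r where "r = (\<Sum>i<m. (cmod (v i))\<^sup>2)"
  define h where "h = outer v v"
  have h: "madj h = h" "supported m h"
    by (auto simp: h_def outer_def madj_def supported_def)
  have "mmul m h h = (\<lambda>p. complex_of_real r * h p)"
  proof (rule matrix_eqI[of m])
    show "supported m (\<lambda>p. complex_of_real r * h p)"
      using h(2) by (simp add: supported_def)
    fix i j assume ij: "i < m" "j < m"
    have "mmul m h h (i, j) = (\<Sum>k<m. (v i * cnj (v j)) * (v k * cnj (v k)))"
      using ij by (simp add: mmul_apply h_def outer_def algebra_simps)
    also have "\<dots> = (v i * cnj (v j)) * complex_of_real r"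
      unfolding r_def of_real_sum complex_norm_square sum_distrib_left ..
    finally show "mmul m h h (i, j) = complex_of_real r * h (i, j)"
      using ij by (simp add: h_def outer_def)
  qed simp
  then have "total_sq N f (mmul m U h) \<le> r * slope h"
    using variation[OF h] by (simp only: slope_scale)
  moreover have "0 \<le> total_sq N f (mmul m U h)"
    unfolding total_sq_def by (intro sum_nonneg) simp
  ultimately have "0 \<le> r * slope h"
    by linarith
  moreover have "0 \<le> r"
    unfolding r_def by (intro sum_nonneg) simp
  moreover have "slope h = 0" if "r = 0"
  proof -
    have "v i = 0" if "i < m" for i
      using \<open>r = 0\<close> that unfolding r_def by (subst (asm) sum_nonneg_eq_0_iff) auto
    then have "slope h = slope (\<lambda>p. complex_of_real 0 * h p)"
      by (intro slope_cong) (auto simp: h_def outer_def)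
    also have "\<dots> = 0 * slope h"
      by (rule slope_scale)
    finally show ?thesis
      by simp
  qed
  ultimately show ?thesis
    unfolding h_def by (cases "r = 0") (auto simp: zero_le_mult_iff)
qed

lemma psd_form_left_form: "psd_form {..<m} left_form"
proof
  show "linear_fun {..<m} (left_form u)" for u
    unfolding linear_fun_def
  proof (intro conjI allI impI)
    fix v w :: "nat \<Rightarrow> complex" and c :: complex
    have 1: "outer (\<lambda>i. v i + w i) u = (\<lambda>p. outer v u p + outer w u p)"
      "outer u (\<lambda>i. v i + w i) = (\<lambda>p. outer u v p + outer u w p)"
      by (auto simp: outer_def algebra_simps)
    show "left_form u (\<lambda>i. v i + w i) = left_form u v + left_form u w"
      unfolding left_form_def 1 by (simp
          add: linear_fun_add[OF f_mmul] sum.distrib algebra_simps add_divide_distrib)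
    have 2: "outer (\<lambda>i. c * v i) u = (\<lambda>p. c * outer v u p)"
      "outer u (\<lambda>i. c * v i) = (\<lambda>p. cnj c * outer u v p)"
      by (auto simp: outer_def algebra_simps)
    have "(\<Sum>s<N. cnj (f s U) * f s (mmul m U (\<lambda>p. d * x p))) =
        d * (\<Sum>s<N. cnj (f s U) * f s (mmul m U x))" for d x
      unfolding sum_distrib_left by (rule sum.cong) (simp_all add: linear_fun_scale[OF f_mmul])
    then show "left_form u (\<lambda>i. c * v i) = c * left_form u v"
      unfolding left_form_def 2 by (simp only: complex_cnj_mult complex_cnj_cnj) (simp add: field_simps)
    show "left_form u v = left_form u w" if "\<forall>i\<in>{..<m}. v i = w i"
    proof -
      have "outer v u = outer w u" "outer u v = outer u w"
        using that by (auto simp: outer_def)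
      then show ?thesis
        by (simp add: left_form_def)
    qed
  qed
  show "left_form v u = cnj (left_form u v)" for u v
    unfolding left_form_def by (simp add: add.commute)
  show "0 \<le> Re (left_form v v)" for v
    unfolding left_form_diag by (rule slope_outer_nonneg)
qed simp

definition apply_adj :: "(nat \<Rightarrow> complex) \<Rightarrow> nat \<Rightarrow> complex" where
  "apply_adj v = (\<lambda>l. \<Sum>k<m. cnj (U (k, l)) * v k)"

text \<open>If \<open>left_form\<close> belongs to the functional \<open>\<phi>\<close> on matrices,
  this form belongs to \<open>x \<mapsto> \<phi> (U\<^sup>* x U)\<close>.\<close>

definition right_form :: "(nat \<Rightarrow> complex) \<Rightarrow> (nat \<Rightarrow> complex) \<Rightarrow> complex" where
  "right_form v w = left_form (apply_adj v) (apply_adj w)"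

lemma psd_form_right_form: "psd_form {..<m} right_form"
proof -
  interpret psd_form "{..<m}" left_form
    by (rule psd_form_left_form)
  show ?thesis
  proof
    show "linear_fun {..<m} (right_form u)" for u
      unfolding linear_fun_def
    proof (intro conjI allI impI)
      fix v w :: "nat \<Rightarrow> complex" and c :: complex
      have 1: "apply_adj (\<lambda>i. v i + w i) = (\<lambda>i. apply_adj v i + apply_adj w i)"
        by (auto simp: apply_adj_def algebra_simps sum.distrib)
      show "right_form u (\<lambda>i. v i + w i) = right_form u v + right_form u w"
        unfolding right_form_def 1 by (rule linear_fun_add[OF lin])
      have 2: "apply_adj (\<lambda>i. c * v i) = (\<lambda>i. c * apply_adj v i)"
        by (auto simp: apply_adj_def algebra_simps sum_distrib_left)
      show "right_form u (\<lambda>i. c * v i) = c * right_form u v"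
        unfolding right_form_def 2 by (rule linear_fun_scale[OF lin])
      show "right_form u v = right_form u w" if "\<forall>i\<in>{..<m}. v i = w i"
      proof -
        have "apply_adj v = apply_adj w"
          using that by (auto simp: apply_adj_def)
        then show ?thesis
          by (simp add: right_form_def)
      qed
    qed
    show "right_form v u = cnj (right_form u v)" for u v
      unfolding right_form_def by (rule sym)
    show "0 \<le> Re (right_form v v)" for v
      unfolding right_form_def by (rule nonneg)
  qed simp
qed

lemma slope_adj_mult: "slope (mmul m (madj y) y) = Re (rowform m left_form y y)"
proof -
  have "slope (mmul m (madj y) y) = slope (\<lambda>p. \<Sum>i<m. outer (\<lambda>l. cnj (y (i, l))) (\<lambda>l. cnj (y (i, l))) p)"
    by (rule slope_cong) (auto simp: mmul_apply madj_def outer_def)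
  then show ?thesis
    by (simp add: slope_sum rowform_def left_form_diag)
qed

lemma slope_mult_adj:
  defines "x y \<equiv> mmul m (madj U) y"
  shows "slope (mmul m (x y) (madj (x y))) = Re (colform m right_form y y)"
proof -
  have "slope (mmul m (x y) (madj (x y))) =
      slope (\<lambda>p. \<Sum>i<m. outer (apply_adj (\<lambda>l. y (l, i))) (apply_adj (\<lambda>l. y (l, i))) p)"
  proof (rule slope_cong)
    fix p assume "p \<in> square m"
    then obtain l l' where p: "p = (l, l')" "l < m" "l' < m"
      by auto
    have "x y (l, i) = apply_adj (\<lambda>l. y (l, i)) l" if "l < m" "i < m" for l i
      using that by (simp add: x_def mmul_apply madj_def apply_adj_def)
    then show "mmul m (x y) (madj (x y))
        p = (\<Sum>i<m. outer (apply_adj (\<lambda>l. y (l, i))) (apply_adj (\<lambda>l. y (l, i))) p)"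
      using p by (simp add: mmul_apply madj_def[of "x y"] outer_def)
  qed
  then show ?thesis
    by (simp add: slope_sum colform_def right_form_def left_form_diag)
qed

text \<open>Put \<open>y = U x\<close>. Then \<open>x\<^sup>* x = y\<^sup>* y\<close>, whereas
  \<open>x x\<^sup>* = U\<^sup>* y y\<^sup>* U\<close>; the conjugation by \<open>U\<close> is the
  reason for two different forms.\<close>

lemma total_sq_le_forms: "total_sq N f y \<le> Re (rowform m left_form y y) + Re (colform m right_form y y)"
proof -
  have UU: "mmul m (madj U) U = mone m" "mmul m U (madj U) = mone m"
    using U by (auto simp: unitaries_def)
  define x where "x = mmul m (madj U) y"
  have "mmul m U x = mmul m (mone m) y"
    by (simp add: x_def UU flip: mmul_assoc)
  then have Ux: "mmul m U x p = y p" if "p \<in> square m" for p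
    using that by (cases p) (auto simp: mmul_apply mone_def if_distrib[of "\<lambda>x. x * _"] cong: if_cong)
  have "total_sq N f y = total_sq N f (mmul m U x)"
    unfolding total_sq_def
  proof (rule sum.cong)
    show "(cmod (f s y))\<^sup>2 = (cmod (f s (mmul m U x)))\<^sup>2" if "s \<in> {..<N}" for s
      using linear_fun_cong[OF f, of s "mmul m U x" y] that Ux by simp
  qed simp
  also have "\<dots> \<le> slope (mmul m x (madj x)) + slope (mmul m (madj x) x)"
    by (rule total_sq_mmul_le) (simp add: x_def)
  also have "mmul m (madj x) x = mmul m (madj y) y"
  proof -
    have "mmul m (madj x) x = mmul m (madj y) (mmul m (mmul m U (madj U)) y)"
      by (simp add: x_def madj_mmul mmul_assoc)
    then show ?thesis
      by (simp add: UU mmul_mone_middle)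
  qed
  finally show ?thesis
    by (simp add: slope_adj_mult slope_mult_adj x_def)
qed

lemma trace_left_form: "trace_form m left_form = total_sq N f U"
proof -
  have "slope (mmul m (madj (mone m)) (mone m)) = (\<Sum>i<m. Re (left_form (ket i) (ket i)))"
    unfolding slope_adj_mult rowform_def Re_sum
  proof (rule sum.cong)
    fix i assume "i \<in> {..<m}"
    then have "(\<lambda>l. cnj (mone m (i, l))) = ket i"
      by (auto simp: mone_def ket_def)
    then show "Re (left_form (\<lambda>l.
        cnj (mone m (i, l))) (\<lambda>l. cnj (mone m (i, l)))) = Re (left_form (ket i) (ket i))"
      by simp
  qed simp
  then show ?thesis
    by (simp add: trace_form_def slope_mone mmul_mone_left)
qed

lemma trace_right_form: "trace_form m right_form = total_sq N f U"
proof -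
  have U': "mmul m (madj U) (mone m) = madj U" "mmul m (madj U) U = mone m"
    using U by (auto simp: unitaries_def mmul_mone_right)
  have "slope (mone m) = Re (colform m right_form (mone m) (mone m))"
    using slope_mult_adj[of "mone m"] by (simp add: U')
  also have "\<dots> = trace_form m right_form"
    unfolding trace_form_def colform_def Re_sum
  proof (rule sum.cong)
    fix i assume "i \<in> {..<m}"
    then have "(\<lambda>l. mone m (l, i)) = ket i"
      by (auto simp: mone_def ket_def)
    then show "Re (right_form (\<lambda>l. mone m (l, i)) (\<lambda>l. mone m (l, i))) = Re (right_form (ket i) (ket i))"
      by simp
  qed simp
  finally show ?thesis
    by (simp add: slope_mone)
qed

end

text \<open>A bound on unitaries suffices because both forms are built at a maximizing unitary and
  have the maximum as their trace.\<close>

lemma little_grothendieck: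
  assumes f: "\<And>s. s < N \<Longrightarrow> linear_fun (square m) (f s)"
    and C: "\<And>U. U \<in> unitaries m \<Longrightarrow> total_sq N f U \<le> C"
  shows "\<exists>Q Q'. psd_form {..<m} Q \<and> psd_form {..<m} Q' \<and> trace_form m Q \<le> C \<and> trace_form m Q' \<le> C \<and>
    (\<forall>y. total_sq N f y \<le> Re (rowform m Q y y) + Re (colform m Q' y y))"
proof -
  obtain U where U: "U \<in> unitaries m" "\<And>V. V \<in> unitaries m \<Longrightarrow> total_sq N f V \<le> total_sq N f U"
    using total_sq_maximum[where f = f and N = N, OF f] by blast
  show ?thesis
    using psd_form_left_form[OF f U] psd_form_right_form[OF f U] trace_left_form[OF f U]
      trace_right_form[OF f U] total_sq_le_forms[OF f U] C[OF U(1)]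
    by (metis order_refl)
qed

subsection \<open>Splitting the bilinear form of a game\<close>

lemma sum_mult_le_sqrt:
  fixes f g :: "'a \<Rightarrow> real"
  assumes "\<And>i. i \<in> A \<Longrightarrow> 0 \<le> f i" "\<And>i. i \<in> A \<Longrightarrow> 0 \<le> g i"
  shows "(\<Sum>i\<in>A. sqrt (f i) * sqrt (g i)) \<le> sqrt (\<Sum>i\<in>A. f i) * sqrt (\<Sum>i\<in>A. g i)"
proof -
  have "(\<Sum>i\<in>A. sqrt (f i) * sqrt (g i)) = (\<Sum>i\<in>A. \<bar>sqrt (f i)\<bar> * \<bar>sqrt (g i)\<bar>)"
    by (rule sum.cong) (use assms in simp_all)
  also have "\<dots> \<le> L2_set (\<lambda>i. sqrt (f i)) A * L2_set (\<lambda>i. sqrt (g i)) A"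
    by (rule L2_set_mult_ineq)
  also have "\<dots> = sqrt (\<Sum>i\<in>A. f i) * sqrt (\<Sum>i\<in>A. g i)"
    unfolding L2_set_def using assms
        by (intro arg_cong2[where f = "(*)"] arg_cong[where f = sqrt] sum.cong) auto
  finally show ?thesis .
qed

lemma cmod_sum_mult_le:
  "cmod (\<Sum>i\<in>A. f i * g i) \<le> sqrt (\<Sum>i\<in>A. (cmod (f i))\<^sup>2) * sqrt (\<Sum>i\<in>A. (cmod (g i))\<^sup>2)"
proof -
  have "cmod (\<Sum>i\<in>A. f i * g i) \<le> (\<Sum>i\<in>A. sqrt ((cmod (f i))\<^sup>2) * sqrt ((cmod (g i))\<^sup>2))"
    by (rule order_trans[OF norm_sum]) (simp add: norm_mult)
  also have "\<dots> \<le> sqrt (\<Sum>i\<in>A. (cmod (f i))\<^sup>2) * sqrt (\<Sum>i\<in>A. (cmod (g i))\<^sup>2)"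
    by (rule sum_mult_le_sqrt) simp_all
  finally show ?thesis .
qed

context psd_form
begin

lemma cauchy_schwarz_sqrt: "cmod (R v w) \<le> sqrt (Re (R v v)) * sqrt (Re (R w w))"
  using real_sqrt_le_mono[OF cauchy_schwarz[of v w]] by (simp add: real_sqrt_mult)

lemma bounded_functional_le:
  assumes con: "complete_orthonormal N z" and f: "linear_fun T f"
    and bd: "\<And>v. Re (R v v) = 0 \<Longrightarrow> f v = 0"
  shows "cmod (f v) \<le> sqrt (Re (R v v)) * sqrt (\<Sum>s<N. (cmod (f (z s)))\<^sup>2)"
proof -
  have "f v = (\<Sum>s<N. R (z s) v * f (z s))"
    by (rule expand_bounded[OF con f bd])
  then show ?thesis
    using cmod_sum_mult_le[where A = "{..<N}" and f = "\<lambda>s. R (z s) v" and g = "\<lambda>s. f (z s)"]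
    by (simp only: parseval[OF con])
qed

text \<open>The sum is the squared dual norm of \<open>f\<close>; the bound is tested on the Riesz
  vector of \<open>f\<close>, whose coefficients are \<open>cnj (f (z s))\<close>.\<close>

lemma sum_functional_le:
  assumes con: "complete_orthonormal N z" and f: "linear_fun T f"
    and bd: "\<And>v. cmod (f v) \<le> D * sqrt (Re (R v v))" and D: "0 \<le> D"
  shows "(\<Sum>s<N. (cmod (f (z s)))\<^sup>2) \<le> D\<^sup>2"
proof -
  define r where "r = (\<Sum>s<N. (cmod (f (z s)))\<^sup>2)"
  define v where "v = (\<lambda>i. \<Sum>s<N. cnj (f (z s)) * z s i)"
  have "f v = (\<Sum>s<N. complex_of_real ((cmod (f (z s)))\<^sup>2))"
    unfolding v_def linear_fun_sum[OF f] complex_norm_square by (simp add: mult.commute)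
  then have fv: "f v = complex_of_real r"
    by (simp add: r_def)
  have r0: "0 \<le> r"
    unfolding r_def by (intro sum_nonneg) simp
  have "Re (R v v) = r"
    unfolding v_def r_def norm_combination[OF con] by simp
  with bd[of v] fv r0 have le: "r \<le> D * sqrt r"
    by simp
  have "sqrt r \<le> D"
  proof (cases "r = 0")
    case False
    then have "sqrt r * sqrt r \<le> D * sqrt r" "0 < sqrt r"
      using le r0 by simp_all
    then show ?thesis
      by (metis mult_le_cancel_right_pos)
  qed (use D in simp)
  then have "(sqrt r)\<^sup>2 \<le> D\<^sup>2"
    using r0 by (intro power_mono) simp_all
  then show ?thesis
    using r0 by (simp add: r_def)
qed

end

text \<open>A form \<open>T\<close> with \<open>- R \<le> T \<le> R\<close>: apply the Cauchy-Schwarz inequality to \<open>R + T\<close> and \<open>R - T\<close>.\<close>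

lemma dominated_form_le:
  assumes plus: "psd_form S (\<lambda>v w. R v w + T v w)" and minus: "psd_form S (\<lambda>v w. R v w - T v w)"
  shows "cmod (T v w) \<le> sqrt (Re (R v v)) * sqrt (Re (R w w))"
proof -
  define p where "p b x = (if b then Re (R x x + T x x) else Re (R x x - T x x))" for b x
  have p: "0 \<le> p b x" "p True x + p False x = 2 * Re (R x x)" for b x
    using psd_form.nonneg[OF plus, of x] psd_form.nonneg[OF minus, of x] by (auto simp: p_def)
  have "2 * T v w = (R v w + T v w) - (R v w - T v w)"
    by simp
  then have "2 * cmod (T v w) \<le> cmod (R v w + T v w) + cmod (R v w - T v w)"
    by (metis norm_mult norm_numeral norm_triangle_ineq4)
  also have "\<dots> \<le> (\<Sum>b\<in>UNIV. sqrt (p b v) * sqrt (p b w))"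
    using psd_form.cauchy_schwarz_sqrt[OF plus, of v w] psd_form.cauchy_schwarz_sqrt[OF minus, of v w]
    by (simp add: UNIV_bool p_def)
  also have "\<dots> \<le> sqrt (\<Sum>b\<in>UNIV. p b v) * sqrt (\<Sum>b\<in>UNIV. p b w)"
    by (rule sum_mult_le_sqrt) (simp_all add: p)
  also have "\<dots> = sqrt (2 * Re (R v v)) * sqrt (2 * Re (R w w))"
    using p(2)[of v] p(2)[of w] by (simp add: UNIV_bool add.commute)
  also have "\<dots> = 2 * (sqrt (Re (R v v)) * sqrt (Re (R w w)))"
    by (simp add: real_sqrt_mult)
  finally show ?thesis
    by simp
qed

text \<open>\<open>\<Sum>\<^sub>s Q1 (y s) b * y s\<close> is the projection of \<open>(b, 0)\<close> to the diagonal of \<open>L\<^sup>2(Q1) \<oplus> L\<^sup>2(Q2)\<close>.\<close>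

lemma projection_le:
  assumes Q1: "psd_form S Q1" and Q2: "psd_form S Q2"
    and con: "psd_form.complete_orthonormal (\<lambda>v w. Q1 v w + Q2 v w) N y"
  shows "(\<Sum>s<N. (cmod (Q1 (y s) b))\<^sup>2) \<le> Re (Q1 b b)"
proof -
  interpret q1: psd_form S Q1 by fact
  interpret q2: psd_form S Q2 by fact
  interpret q: psd_form S "\<lambda>v w. Q1 v w + Q2 v w"
    by (rule psd_form_add[OF Q1 Q2])
  \<comment> \<open>These are the coefficients of the functional \<open>Q1 b\<close> in the basis
    \<open>y\<close>, and its norm is at most that of \<open>b\<close> because
    \<open>Q1 \<le> Q1 + Q2\<close>.\<close>
  have "(\<Sum>s<N. (cmod (Q1 b (y s)))\<^sup>2) \<le> (sqrt (Re (Q1 b b)))\<^sup>2"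
  proof (rule q.sum_functional_le[OF con q1.lin])
    show "cmod (Q1 b v) \<le> sqrt (Re (Q1 b b)) * sqrt (Re (Q1 v v + Q2 v v))" for v
      by (rule order_trans[OF q1.cauchy_schwarz_sqrt mult_left_mono])
        (simp_all add: q1.nonneg q2.nonneg)
  qed (simp add: q1.nonneg)
  moreover have "cmod (Q1 (y s) b) = cmod (Q1 b (y s))" for s
    by (subst q1.sym) simp
  ultimately show ?thesis
    by (simp add: q1.nonneg)
qed

section \<open>Bilinear forms on pairs of matrices\<close>

definition bilin :: "nat \<Rightarrow> nat \<Rightarrow> (nat \<times> nat \<Rightarrow> nat \<times> nat \<Rightarrow> complex) \<Rightarrow> matrix \<Rightarrow> matrix \<Rightarrow> complex" where
  "bilin n m c a b = (\<Sum>p\<in>square n. \<Sum>q\<in>square m. c p q * a p * b q)"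

lemma linear_fun_bilin_right: "linear_fun (square m) (bilin n m c a)"
proof -
  have "bilin n m c a = (\<lambda>b. \<Sum>p\<in>square n. a p * (\<Sum>q\<in>square m. c p q * b q))"
    by (simp add: bilin_def sum_distrib_left mult.assoc mult.left_commute fun_eq_iff)
  then show ?thesis
    by (simp only:) (intro linear_fun_linear_combination linear_fun_coords subset_refl)
qed

lemma linear_fun_bilin_left: "linear_fun (square n) (\<lambda>a. bilin n m c a b)"
proof -
  have "bilin n m c a b = (\<Sum>p\<in>square n. (\<Sum>q\<in>square m. c p q * b q) * a p)" for a
    unfolding bilin_def sum_distrib_right by (intro sum.cong refl) (simp add: mult.assoc mult.commute)
  then show ?thesis
    by (simp only:) (intro linear_fun_coords subset_refl)
qed

lemma bilinear_eq_bilin: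
  assumes l: "\<And>b. linear_fun (square n) (\<lambda>a. F a b)" and r: "\<And>a. linear_fun (square m) (F a)"
  shows "F a b = bilin n m (\<lambda>p q. F (ket p) (ket q)) a b"
proof -
  have "F a b = (\<Sum>p\<in>square n. a p * F (ket p) b)"
    by (rule linear_fun_expand[OF l]) simp
  also have "\<dots> = (\<Sum>p\<in>square n. a p * (\<Sum>q\<in>square m. b q * F (ket p) (ket q)))"
  proof (rule sum.cong)
    fix p
    have "F (ket p) b = (\<Sum>q\<in>square m. b q * F (ket p) (ket q))"
      by (rule linear_fun_expand[OF r]) simp
    then show "a p * F (ket p) b = a p * (\<Sum>q\<in>square m. b q * F (ket p) (ket q))"
      by (rule arg_cong)
  qed simp
  also have "\<dots> = bilin n m (\<lambda>p q. F (ket p) (ket q)) a b"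
    unfolding bilin_def sum_distrib_left
        by (intro sum.cong refl) (simp add: mult.assoc mult.commute mult.left_commute)
  finally show ?thesis .
qed

text \<open>Coefficient version of \<open>cnj (u (a, b)) = u (madj a, madj b)\<close>, which
  expresses that the game operator is selfadjoint.\<close>

definition hermitian_coeff :: "(nat \<times> nat \<Rightarrow> nat \<times> nat \<Rightarrow> complex) \<Rightarrow> bool" where
  "hermitian_coeff c \<longleftrightarrow> (\<forall>i j k l. cnj (c (i, j) (k, l)) = c (j, i) (l, k))"

lemma cnj_bilin:
  assumes "hermitian_coeff c"
  shows "cnj (bilin n m c a b) = bilin n m c (madj a) (madj b)"
proof -
  have sw: "sum F (square k) = sum (\<lambda>(i, j). F (j, i)) (square k)" for F :: "nat \<times> nat \<Rightarrow> complex" and k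
    unfolding sum.cartesian_product' by (simp add: sum.swap[of "\<lambda>i j. F (i, j)"])
  have "cnj (bilin n m c a b) = (\<Sum>p\<in>square n. \<Sum>q\<in>square m. cnj (c p q * a p * b q))"
    unfolding bilin_def by simp
  also have "\<dots> = (\<Sum>(i, j)\<in>square n. \<Sum>(k, l)\<in>square m. cnj (c (j, i) (l, k) * a (j, i) * b (l, k)))"
    by (subst sw) (intro sum.cong refl, simp add: split_beta, subst sw, simp add: split_beta)
  also have "\<dots> = bilin n m c (madj a) (madj b)"
    unfolding bilin_def using assms
    by (intro sum.cong refl) (auto simp: madj_def hermitian_coeff_def intro!: sum.cong)
  finally show ?thesis .
qed

definition rank1 :: "(nat \<Rightarrow> complex) \<Rightarrow> (nat \<Rightarrow> complex) \<Rightarrow> matrix" where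
  "rank1 w v = (\<lambda>(i, j). w i * cnj (v j))"

abbreviation matrix_form :: "nat \<Rightarrow> matrix \<Rightarrow> (nat \<Rightarrow> complex) \<Rightarrow> (nat \<Rightarrow> complex) \<Rightarrow> complex" where
  "matrix_form m b \<equiv> kernel_form m (\<lambda>k l. b (k, l))"

text \<open>The numerical radius is at most 1; for a Hermitian matrix this is the operator norm.\<close>

definition hermitian_contractions :: "nat \<Rightarrow> matrix set" where
  "hermitian_contractions m = {b. madj b = b \<and> (\<forall>v. \<bar>Re (matrix_form m b v v)\<bar> \<le> sq_norm m v)}"

text \<open>The real and imaginary parts of the quadratic form are the forms of the two Hermitian
  parts of \<open>b\<close>, so this condition passes to them directly.\<close>

definition numerical_contraction :: "nat \<Rightarrow> matrix \<Rightarrow> bool" where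
  "numerical_contraction m b \<longleftrightarrow> (\<forall>v. cmod (matrix_form m b v v) \<le> sq_norm m v)"

lemma matrix_form_madj: "matrix_form m (madj b) v v = cnj (matrix_form m b v v)"
  unfolding kernel_form_def cnj_sum
  by (subst sum.swap) (simp add: madj_def mult.assoc mult.commute mult.left_commute)

lemma matrix_form_add: "matrix_form m (\<lambda>p. x p + y p) v v = matrix_form m x v v + matrix_form m y v v"
  and matrix_form_scale: "matrix_form m (\<lambda>p. c * x p) v v = c * matrix_form m x v v"
  unfolding kernel_form_def by (simp_all add: sum.distrib sum_distrib_left algebra_simps)

lemma numerical_contraction_unitary:
  assumes "U \<in> unitaries m"
  shows "numerical_contraction m U"
  unfolding numerical_contraction_def
proof
  fix v
  define w where "w k = (\<Sum>l<m. U (k, l) * v l)" for k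
  have ww: "(\<Sum>k<m. (cmod (w k))\<^sup>2) = sq_norm m v"
  proof -
    have "complex_of_real (\<Sum>k<m. (cmod (w k))\<^sup>2) =
        (\<Sum>k<m. \<Sum>l<m. \<Sum>l'<m. (cnj (U (k, l)) * U (k, l')) * (cnj (v l) * v l'))"
      unfolding of_real_sum complex_norm_square w_def
      by (intro sum.cong refl) (simp
          add: sum_product algebra_simps, subst sum.swap, simp add: algebra_simps)
    also have "\<dots> = (\<Sum>l<m. \<Sum>l'<m. \<Sum>k<m. (cnj (U (k, l)) * U (k, l')) * (cnj (v l) * v l'))"
      by (subst sum.swap) (rule sum.cong[OF refl sum.swap])
    also have "\<dots> = (\<Sum>l<m. \<Sum>l'<m. mmul m (madj U) U (l, l') * (cnj (v l) * v l'))"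
      by (intro sum.cong refl) (simp add: mmul_apply madj_def sum_distrib_right)
    also have "\<dots> = (\<Sum>l<m. \<Sum>l'<m. if l' = l then cnj (v l) * v l else 0)"
      using assms by (intro sum.cong refl) (simp add: unitaries_def mone_def)
    also have "\<dots> = complex_of_real (sq_norm m v)"
      unfolding sq_norm_def of_real_sum complex_norm_square by (simp add: mult.commute)
    finally show ?thesis
      by (simp only: of_real_eq_iff)
  qed
  have "matrix_form m U v v = (\<Sum>k<m. cnj (v k) * w k)"
    by (simp add: kernel_form_def w_def sum_distrib_left mult.assoc)
  then have "cmod (matrix_form m U v v) \<le> sqrt (\<Sum>k<m. (cmod (cnj (v k)))\<^sup>2) * sqrt (\<Sum>k<m. (cmod (w k))\<^sup>2)"
    by (simp only: cmod_sum_mult_le)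
  also have "\<dots> = sqrt (sq_norm m v) * sqrt (sq_norm m v)"
    unfolding ww by (simp add: sq_norm_def)
  also have "\<dots> = sq_norm m v"
    by (simp add: sq_norm_def sum_nonneg)
  finally show "cmod (matrix_form m U v v) \<le> sq_norm m v" .
qed

text \<open>Matrix units are contractions, so an estimate for contractions decides whether the
  bilinear form vanishes for every second argument.\<close>

lemma numerical_contraction_ket:
  assumes "q \<in> square m"
  shows "numerical_contraction m (ket q)"
  unfolding numerical_contraction_def
proof
  fix v
  obtain k l where q: "q = (k, l)" "k < m" "l < m"
    using assms by auto
  have "matrix_form m (ket q) v v =
      (\<Sum>i<m. \<Sum>j<m. if i = k then if j = l then cnj (v k) * v l else 0 else 0)"
    unfolding kernel_form_def by (intro sum.cong refl) (auto simp: ket_def q)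
  also have "\<dots> = (\<Sum>i<m. if i = k then \<Sum>j<m. if j = l then cnj (v k) * v l else 0 else 0)"
    by (intro sum.cong refl) auto
  also have "\<dots> = cnj (v k) * v l"
    using q by simp
  finally have "cmod (matrix_form m (ket q) v v) = cmod (v k) * cmod (v l)"
    by (simp add: norm_mult)
  moreover have "2 * (cmod (v k) * cmod (v l)) \<le> (cmod (v k))\<^sup>2 + (cmod (v l))\<^sup>2"
    using sum_squares_bound[of "cmod (v k)" "cmod (v l)"] by (simp add: mult.assoc)
  moreover have "(cmod (v k))\<^sup>2 \<le> sq_norm m v" "(cmod (v l))\<^sup>2 \<le> sq_norm m v"
    unfolding sq_norm_def by (rule member_le_sum; use q in auto)+
  ultimately show "cmod (matrix_form m (ket q) v v) \<le> sq_norm m v"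
    by linarith
qed

text \<open>The factor 2 counts the Hermitian parts \<open>h\<close> and \<open>k\<close> of
  \<open>b = h + \<i> k\<close>.\<close>

lemma bilin_le_numerical_contraction:
  assumes bd: "\<And>b. b \<in> hermitian_contractions m \<Longrightarrow> cmod (bilin n m c a b) \<le> D"
    and b: "numerical_contraction m b"
  shows "cmod (bilin n m c a b) \<le> 2 * D"
proof -
  define h where "h = (\<lambda>p. (1 / 2) * (b p + madj b p))"
  define k where "k = (\<lambda>p. (- \<i> / 2) * (b p + (-1) * madj b p))"
  have le: "\<bar>Re (matrix_form m b v v)\<bar> \<le> sq_norm m v" "\<bar>Im (matrix_form m b v v)\<bar> \<le> sq_norm m v" for v
    using b abs_Re_le_cmod[of "matrix_form m b v v"] abs_Im_le_cmod[of "matrix_form m b v v"]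
    unfolding numerical_contraction_def by (meson order_trans)+
  have "madj h = h"
    by (auto simp: h_def madj_def)
  moreover have "matrix_form m h v v = complex_of_real (Re (matrix_form m b v v))" for v
    using matrix_form_scale[of m "1 / 2" "\<lambda>p. b p + madj b p" v] matrix_form_add[of m b "madj b" v]
    by (simp add: h_def matrix_form_madj complex_eq_iff)
  ultimately have h: "h \<in> hermitian_contractions m"
    using le by (simp add: hermitian_contractions_def)
  have "madj k = k"
    by (auto simp: k_def madj_def algebra_simps)
  moreover have "matrix_form m k v v = complex_of_real (Im (matrix_form m b v v))" for v
    using matrix_form_scale[of m "- \<i> / 2" "\<lambda>p. b p + (-1) * madj b p" v]
      matrix_form_add[of m b "\<lambda>p. (-1) * madj b p" v] matrix_form_scale[of m "-1" "madj b" v]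
    by (simp add: k_def matrix_form_madj complex_eq_iff)
  ultimately have k: "k \<in> hermitian_contractions m"
    using le by (simp add: hermitian_contractions_def)
  have "b = (\<lambda>p. h p + \<i> * k p)"
    by (auto simp: h_def k_def algebra_simps)
  then have "bilin n m c a b = bilin n m c a h + \<i> * bilin n m c a k"
    by (metis linear_fun_add linear_fun_scale linear_fun_bilin_right)
  then have "cmod (bilin n m c a b) \<le> cmod (bilin n m c a h) + cmod (bilin n m c a k)"
    by (metis norm_triangle_ineq norm_mult norm_ii mult_1)
  then show ?thesis
    using bd[OF h] bd[OF k] by simp
qed

lemma bilin_rank1_hermitian:
  assumes "hermitian_coeff c" "madj b = b"
  shows "bilin n m c (rank1 v w) b = cnj (bilin n m c (rank1 w v) b)"
proof -
  have "madj (rank1 w v) = rank1 v w"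
    by (auto simp: madj_def rank1_def)
  then show ?thesis
    by (simp add: cnj_bilin assms)
qed

text \<open>The hypothesis \<open>bound\<close> is the one-way bias: Alice measures with outcomes proportional to
  \<open>\<xi> \<xi>\<^sup>*\<close>, and Bob answers the outcome \<open>\<xi>\<close> with the observable \<open>b\<close>.\<close>

lemma alice_form:
  assumes herm: "hermitian_coeff c"
    and bound: "\<And>l xs. 0 \<le> l \<Longrightarrow> (\<And>\<xi> b. (\<xi>, b) \<in> set xs \<Longrightarrow> b \<in> hermitian_contractions m) \<Longrightarrow>
      (\<And>v. (\<Sum>(\<xi>, b)\<leftarrow>xs. (cmod (dot n v \<xi>))\<^sup>2) \<le> l * sq_norm n v) \<Longrightarrow>
      (\<Sum>(\<xi>, b)\<leftarrow>xs. Re (bilin n m c (rank1 \<xi> \<xi>) b)) \<le> \<beta> * l"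
  obtains R where "psd_form {..<n} R" "trace_form n R \<le> \<beta>"
    "\<And>v w b. b \<in> hermitian_contractions m \<Longrightarrow>
      cmod (bilin n m c (rank1 w v) b) \<le> sqrt (Re (R v v)) * sqrt (Re (R w w))"
proof -
  have "\<exists>\<sigma>. (\<forall>i j. \<sigma> j i = cnj (\<sigma> i j)) \<and> (\<Sum>i<n. Re (\<sigma> i i)) \<le> \<beta> \<and>
    (\<forall>\<xi>. \<forall>b\<in>hermitian_contractions m. Re (bilin n m c (rank1 \<xi> \<xi>) b) \<le> Re (kernel_form n \<sigma> \<xi> \<xi>))"
  proof (rule dominating_form[OF _ bound])
    fix x \<xi> b
    have "rank1 (\<lambda>i. complex_of_real x * \<xi> i)
        (\<lambda>i. complex_of_real x * \<xi> i) = (\<lambda>p. complex_of_real (x\<^sup>2) * rank1 \<xi> \<xi> p)"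
      by (auto simp: rank1_def power2_eq_square)
    then show "Re (bilin n m c (rank1 (\<lambda>i. complex_of_real x * \<xi> i) (\<lambda>i. complex_of_real x * \<xi> i)) b) =
        x\<^sup>2 * Re (bilin n m c (rank1 \<xi> \<xi>) b)"
      by (simp add: linear_fun_scale[OF linear_fun_bilin_left] del: of_real_power)
  qed
  then obtain \<sigma> where \<sigma>: "\<And>i j. \<sigma> j i = cnj (\<sigma> i j)" "(\<Sum>i<n. Re (\<sigma> i i)) \<le> \<beta>"
    and dom: "\<And>\<xi> b. b \<in> hermitian_contractions m \<Longrightarrow>
        Re (bilin n m c (rank1 \<xi> \<xi>) b) \<le> Re (kernel_form n \<sigma> \<xi> \<xi>)"
    by blast
  define R where "R = kernel_form n \<sigma>"
  \<comment> \<open>Bob's observable 0 turns the domination into positivity of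
    \<open>R\<close>.\<close>
  have zero: "(\<lambda>_. 0) \<in> hermitian_contractions m"
    by (auto simp: hermitian_contractions_def madj_def kernel_form_def sq_norm_def intro!: sum_nonneg)
  have R_eq: "R = (\<lambda>u w. \<Sum>i<n. cnj (u i) * (\<Sum>j<n. \<sigma> i j * w j))"
    by (intro ext) (simp add: R_def kernel_form_def sum_distrib_left mult.assoc)
  have R_lin: "linear_fun {..<n} (R u)" for u
    unfolding R_eq by (intro linear_fun_linear_combination linear_fun_coords subset_refl)
  have R_sym: "R v u = cnj (R u v)" for u v
    unfolding R_def kernel_form_def cnj_sum
    by (subst sum.swap) (simp add: \<sigma>(1)[symmetric] mult.assoc mult.commute mult.left_commute)
  have psd: "psd_form {..<n} R"
  proof
    show "0 \<le> Re (R v v)" for v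
      using dom[OF zero, of v] linear_fun_zero[OF linear_fun_bilin_right] by (simp add: R_def)
    show "linear_fun {..<n} (R u)" for u
      by (rule R_lin)
    show "R v u = cnj (R u v)" for u v
      by (rule R_sym)
  qed simp
  have tr: "trace_form n R \<le> \<beta>"
  proof -
    have "R (ket i) (ket i) = \<sigma> i i" if "i < n" for i
      using that by (simp add: R_eq sum_ket_mult sum_mult_ket)
    then show ?thesis
      using \<sigma>(2) by (simp add: trace_form_def)
  qed
  have T_lin: "linear_fun {..<n} (\<lambda>w. d * bilin n m c (rank1 w v) b)" for v b d
    unfolding linear_fun_def
  proof (intro conjI allI impI)
    have "rank1 (\<lambda>i. x i + y i) v = (\<lambda>p. rank1 x v p + rank1 y v p)" for x y
      by (auto simp: rank1_def algebra_simps)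
    then show "d * bilin n m c (rank1 (\<lambda>i. x i + y i) v) b =
        d * bilin n m c (rank1 x v) b + d * bilin n m c (rank1 y v) b" for x y
      by (simp add: linear_fun_add[OF linear_fun_bilin_left] algebra_simps)
    have "rank1 (\<lambda>i. k * x i) v = (\<lambda>p. k * rank1 x v p)" for x k
      by (auto simp: rank1_def algebra_simps)
    then show "d * bilin n m c (rank1 (\<lambda>i. k * x i) v) b = k * (d * bilin n m c (rank1 x v) b)" for x k
      by (simp add: linear_fun_scale[OF linear_fun_bilin_left] algebra_simps)
    show "d * bilin n m c (rank1 x v) b = d * bilin n m c (rank1 y v) b" if "\<forall>i\<in>{..<n}. x i = y i" for x y
      by (rule arg_cong[where f = "\<lambda>z. d * z"], rule linear_fun_cong[OF linear_fun_bilin_left])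
        (use that in \<open>auto simp: rank1_def\<close>)
  qed
  \<comment> \<open>With \<open>b\<close> also \<open>- b\<close> is allowed, so the domination is
    two-sided.\<close>
  have T_psd: "psd_form {..<n} (\<lambda>v w. R v w + d * bilin n m c (rank1 w v) b)"
    if b: "b \<in> hermitian_contractions m" and d: "d = 1 \<or> d = -1" for b d
  proof
    show "linear_fun {..<n} (\<lambda>w. R u w + d * bilin n m c (rank1 w u) b)" for u
      by (rule linear_fun_plus[OF R_lin T_lin])
    show "R v u + d * bilin n m c (rank1 u v) b = cnj (R u v + d * bilin n m c (rank1 v u) b)" for u v
    proof -
      have "madj b = b"
        using b by (simp add: hermitian_contractions_def)
      then have "bilin n m c (rank1 u v) b = cnj (bilin n m c (rank1 v u) b)"
        by (rule bilin_rank1_hermitian[OF herm])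
      moreover have "cnj d = d"
        using d by auto
      ultimately show ?thesis
        by (simp only: R_sym[of v u] complex_cnj_add complex_cnj_mult)
    qed
    show "0 \<le> Re (R v v + d * bilin n m c (rank1 v v) b)" for v
    proof -
      have "(\<lambda>p. - b p) \<in> hermitian_contractions m"
        using b matrix_form_scale[of m "-1" b]
            by (auto simp: hermitian_contractions_def madj_def fun_eq_iff)
      moreover have "bilin n m c (rank1 v v) (\<lambda>p. - b p) = - bilin n m c (rank1 v v) b"
        using linear_fun_scale[OF linear_fun_bilin_right, of n m c "rank1 v v" "-1" b] by simp
      ultimately have "- Re (bilin n m c (rank1 v v) b) \<le> Re (R v v)"
        using dom[of "\<lambda>p. - b p" v] by (simp add: R_def)
      moreover have "Re (bilin n m c (rank1 v v) b) \<le> Re (R v v)"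
        using dom[OF b, of v] by (simp add: R_def)
      ultimately show ?thesis
        using d by auto
    qed
  qed simp
  have "cmod (bilin n m c (rank1 w v) b) \<le> sqrt (Re (R v v)) * sqrt (Re (R w w))"
    if "b \<in> hermitian_contractions m" for v w b
    using dominated_form_le[where R = R and T = "\<lambda>v w. bilin n m c (rank1 w v) b" and S = "{..<n}"]
      T_psd[OF that, of 1] T_psd[OF that, of "-1"] by simp
  with psd tr show thesis
    by (rule that)
qed

text \<open>Write \<open>a\<close> as the sum of (column j) times \<open>(ket j)\<^sup>*\<close>, or
  of \<open>ket i\<close> times (row i). Cauchy-Schwarz over the summands separates the trace of
  \<open>R\<close>, at most \<open>\<beta>\<close>, from the form of the columns or rows.\<close>

lemma bilin_le_colform:
  assumes R: "psd_form {..<n} R" and tr: "trace_form n R \<le> \<beta>"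
    and bd: "\<And>v w. cmod (bilin n m c (rank1 w v) b) \<le> sqrt (Re (R v v)) * sqrt (Re (R w w))"
  shows "cmod (bilin n m c a b) \<le> sqrt \<beta> * sqrt (Re (colform n R a a))"
    and "cmod (bilin n m c a b) \<le> sqrt \<beta> * sqrt (Re (rowform n R a a))"
proof -
  interpret psd_form "{..<n}" R by fact
  have tr0: "sqrt (\<Sum>j<n. Re (R (ket j) (ket j))) \<le> sqrt \<beta>"
    using tr by (simp add: trace_form_def)
  have "bilin n m c a b = bilin n m c (\<lambda>p. \<Sum>j<n. rank1 (\<lambda>i. a (i, j)) (ket j) p) b"
    by (rule linear_fun_cong[OF
        linear_fun_bilin_left]) (auto simp: rank1_def ket_def sum_mult_ket if_distrib cong: if_cong)
  also have "\<dots> = (\<Sum>j<n. bilin n m c (rank1 (\<lambda>i. a (i, j)) (ket j)) b)"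
    by (rule linear_fun_sum'[OF linear_fun_bilin_left])
  finally have "cmod (bilin n m c a b) \<le>
      (\<Sum>j<n. sqrt (Re (R (ket j) (ket j))) * sqrt (Re (R (\<lambda>i. a (i, j)) (\<lambda>i. a (i, j)))))"
    by (simp only:) (rule order_trans[OF norm_sum sum_mono[OF bd]])
  also have "\<dots> \<le> sqrt (\<Sum>j<n. Re (R (ket j) (ket j))) * sqrt (\<Sum>j<n. Re (R (\<lambda>i. a (i, j)) (\<lambda>i. a (i, j))))"
    by (rule sum_mult_le_sqrt) (simp_all add: nonneg)
  also have "\<dots> \<le> sqrt \<beta> * sqrt (\<Sum>j<n. Re (R (\<lambda>i. a (i, j)) (\<lambda>i. a (i, j))))"
    by (rule mult_right_mono[OF tr0]) (simp add: sum_nonneg nonneg)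
  finally show "cmod (bilin n m c a b) \<le> sqrt \<beta> * sqrt (Re (colform n R a a))"
    by (simp add: colform_def)
  have "bilin n m c a b = bilin n m c (\<lambda>p. \<Sum>i<n. rank1 (ket i) (\<lambda>j. cnj (a (i, j))) p) b"
    by (rule linear_fun_cong[OF
        linear_fun_bilin_left]) (auto
            simp: rank1_def ket_def sum_ket_mult if_distrib[of "\<lambda>x. x * _"] cong: if_cong)
  also have "\<dots> = (\<Sum>i<n. bilin n m c (rank1 (ket i) (\<lambda>j. cnj (a (i, j)))) b)"
    by (rule linear_fun_sum'[OF linear_fun_bilin_left])
  finally have "cmod (bilin n m c a b) \<le>
      (\<Sum>i<n. sqrt (Re (R (\<lambda>j. cnj (a (i, j))) (\<lambda>j. cnj (a (i, j))))) * sqrt (Re (R (ket i) (ket i))))"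
    by (simp only:) (rule order_trans[OF norm_sum sum_mono[OF bd]])
  also have "\<dots> \<le> sqrt (\<Sum>i<n.
      Re (R (\<lambda>j. cnj (a (i, j))) (\<lambda>j. cnj (a (i, j))))) * sqrt (\<Sum>i<n. Re (R (ket i) (ket i)))"
    by (rule sum_mult_le_sqrt) (simp_all add: nonneg)
  also have "\<dots> \<le> sqrt (\<Sum>i<n. Re (R (\<lambda>j. cnj (a (i, j))) (\<lambda>j. cnj (a (i, j))))) * sqrt \<beta>"
    by (rule mult_left_mono[OF tr0]) (simp add: sum_nonneg nonneg)
  finally show "cmod (bilin n m c a b) \<le> sqrt \<beta> * sqrt (Re (rowform n R a a))"
    by (simp add: rowform_def mult.commute)
qed

text \<open>The bilinear form is bounded by both \<open>colform n R\<close> and \<open>rowform n R\<close> on Alice's side, so the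
  little Grothendieck inequality bounds it by these times \<open>rowform m Q + colform m Q'\<close>. Projecting
  Bob's argument to the diagonal of the orthogonal sum of the last two Hilbert spaces splits it.\<close>

lemma grothendieck_splitting:
  assumes herm: "hermitian_coeff c"
    and bound: "\<And>l xs. 0 \<le> l \<Longrightarrow> (\<And>\<xi> b. (\<xi>, b) \<in> set xs \<Longrightarrow> b \<in> hermitian_contractions m) \<Longrightarrow>
      (\<And>v. (\<Sum>(\<xi>, b)\<leftarrow>xs. (cmod (dot n v \<xi>))\<^sup>2) \<le> l * sq_norm n v) \<Longrightarrow>
      (\<Sum>(\<xi>, b)\<leftarrow>xs. Re (bilin n m c (rank1 \<xi> \<xi>) b)) \<le> \<beta> * l"
  obtains R Q Q' c1 c2 where
    "psd_form {..<n} R" "psd_form {..<m} Q" "psd_form {..<m} Q'"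
    "trace_form n R \<le> \<beta>" "trace_form m Q \<le> 8 * \<beta>" "trace_form m Q' \<le> 8 * \<beta>"
    "\<And>p q. p \<in> square n \<Longrightarrow> q \<in> square m \<Longrightarrow> c p q = c1 p q + c2 p q"
    "\<And>a b. cmod (bilin n m c1 a b) \<le> sqrt (Re (colform n R a a)) * sqrt (Re (rowform m Q b b))"
    "\<And>a b. cmod (bilin n m c2 a b) \<le> sqrt (Re (rowform n R a a)) * sqrt (Re (colform m Q' b b))"
proof -
  obtain R where R: "psd_form {..<n} R" and tr: "trace_form n R \<le> \<beta>" and
    R_bd: "\<And>v w b. b \<in> hermitian_contractions m \<Longrightarrow>
      cmod (bilin n m c (rank1 w v) b) \<le> sqrt (Re (R v v)) * sqrt (Re (R w w))"
    using alice_form[OF herm bound] by blast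
  have \<beta>: "0 \<le> \<beta>"
    by (rule order_trans[OF _ tr]) (simp add: trace_form_def sum_nonneg psd_form.nonneg[OF R])
  define P1 where "P1 = colform n R"
  define P2 where "P2 = rowform n R"
  interpret p1: psd_form "square n" P1
    unfolding P1_def by (rule psd_form_colform[OF R])
  interpret p2: psd_form "square n" P2
    unfolding P2_def by (rule psd_form_rowform[OF R])
  \<comment> \<open>The 2 comes from passing from Hermitian to arbitrary contractions on Bob's
    side.\<close>
  define D where "D = 2 * sqrt \<beta>"
  have D: "0 \<le> D" "D\<^sup>2 = 4 * \<beta>"
    using \<beta> by (simp_all add: D_def power_mult_distrib)
  have le: "cmod (bilin n m c a b) \<le> D * sqrt (Re (P1 a a))"
      "cmod (bilin n m c a b) \<le> D * sqrt (Re (P2 a a))"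
    if "numerical_contraction m b" for a b
    using bilin_le_numerical_contraction[OF bilin_le_colform(1)[OF R tr R_bd] that, of a]
      bilin_le_numerical_contraction[OF bilin_le_colform(2)[OF R tr R_bd] that, of a]
    by (simp_all add: P1_def P2_def D_def)
  have null: "bilin n m c a b = 0" if "Re (P1 a a) = 0 \<or> Re (P2 a a) = 0" for a b
  proof -
    have "bilin n m c a (ket q) = 0" if "q \<in> square m" for q
      using le[OF numerical_contraction_ket[OF that], of a] \<open>Re (P1 a a) = 0 \<or> Re (P2 a a) = 0\<close> by auto
    moreover have "bilin n m c a b = (\<Sum>q\<in>square m. b q * bilin n m c a (ket q))"
      by (rule linear_fun_expand[OF linear_fun_bilin_right]) simp
    ultimately show ?thesis
      by simp
  qed
  obtain N1 z1 where con1: "p1.complete_orthonormal N1 z1"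
    using p1.complete_orthonormal_exists by blast
  obtain N2 z2 where con2: "p2.complete_orthonormal N2 z2"
    using p2.complete_orthonormal_exists by blast
  \<comment> \<open>Concatenating the coordinates for \<open>P1\<close> and \<open>P2\<close> makes
    one application of \<open>little_grothendieck\<close> yield forms \<open>Q\<close>,
    \<open>Q'\<close> that are good for both.\<close>
  define f where "f s b = (if s < N1 then bilin n m c (z1 s) b else bilin n m c (z2 (s - N1)) b)" for s b
  have f: "linear_fun (square m) (f s)" for s
    unfolding f_def by (cases "s < N1") (simp_all add: linear_fun_bilin_right)
  have total: "total_sq (N1 + N2) f b =
      (\<Sum>s<N1. (cmod (bilin n m c (z1 s) b))\<^sup>2) + (\<Sum>s<N2. (cmod (bilin n m c (z2 s) b))\<^sup>2)" for b
  proof -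
    have "(\<Sum>s<N1 + N2. h s) = (\<Sum>s<N1. h s) + (\<Sum>s<N2. h (N1 + s))" for h :: "nat \<Rightarrow> real"
      by (induction N2) simp_all
    then show ?thesis
      by (simp add: total_sq_def f_def)
  qed
  \<comment> \<open>Each family contributes a squared dual norm of
    \<open>a \<mapsto> bilin n m c a U\<close>, at most
    \<open>D\<^sup>2 = 4 * \<beta>\<close>.\<close>
  have "total_sq (N1 + N2) f U \<le> 8 * \<beta>" if "U \<in> unitaries m" for U
  proof -
    note nc = numerical_contraction_unitary[OF that]
    have "(\<Sum>s<N1. (cmod (bilin n m c (z1 s) U))\<^sup>2) \<le> D\<^sup>2"
      by (rule p1.sum_functional_le[OF con1 linear_fun_bilin_left le(1)[OF nc] D(1)])
    moreover have "(\<Sum>s<N2. (cmod (bilin n m c (z2 s) U))\<^sup>2) \<le> D\<^sup>2"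
      by (rule p2.sum_functional_le[OF con2 linear_fun_bilin_left le(2)[OF nc] D(1)])
    ultimately show ?thesis
      by (simp add: total D(2))
  qed
  from little_grothendieck[where N = "N1 + N2" and f = f, OF f this] obtain Q Q' where
    Q: "psd_form {..<m} Q" "psd_form {..<m} Q'" "trace_form m Q \<le> 8 * \<beta>" "trace_form m Q' \<le> 8 * \<beta>"
    and lg: "\<And>y. total_sq (N1 + N2) f y \<le> Re (rowform m Q y y) + Re (colform m Q' y y)"
    by blast
  define Q1 where "Q1 = rowform m Q"
  define Q2 where "Q2 = colform m Q'"
  have Q1: "psd_form (square m) Q1" and Q2: "psd_form (square m) Q2"
    unfolding Q1_def Q2_def by (rule psd_form_rowform[OF Q(1)], rule psd_form_colform[OF Q(2)])
  interpret q: psd_form "square m" "\<lambda>v w. Q1 v w + Q2 v w"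
    by (rule psd_form_add[OF Q1 Q2])
  \<comment> \<open>The inequality for \<open>f\<close> bounds the dual norms of
    \<open>a \<mapsto> bilin n m c a b\<close> with respect to \<open>P1\<close> and
    \<open>P2\<close>, hence the bilinear form, now for every \<open>b\<close> instead of
    contractions only.\<close>
  have le1: "cmod (bilin n m c a b) \<le> sqrt (Re (P1 a a)) * sqrt (Re (Q1 b b + Q2 b b))" for a b
  proof (rule order_trans[OF p1.bounded_functional_le[OF con1 linear_fun_bilin_left] mult_left_mono])
    have "(\<Sum>s<N1. (cmod (bilin n m c (z1 s) b))\<^sup>2) \<le> total_sq (N1 + N2) f b"
      unfolding total by (simp add: sum_nonneg)
    then show "sqrt (\<Sum>s<N1. (cmod (bilin n m c (z1 s) b))\<^sup>2) \<le> sqrt (Re (Q1 b b + Q2 b b))"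
      using lg[of b] by (simp add: Q1_def Q2_def)
  qed (use null p1.nonneg in auto)
  have le2: "cmod (bilin n m c a b) \<le> sqrt (Re (P2 a a)) * sqrt (Re (Q1 b b + Q2 b b))" for a b
  proof (rule order_trans[OF p2.bounded_functional_le[OF con2 linear_fun_bilin_left] mult_left_mono])
    have "(\<Sum>s<N2. (cmod (bilin n m c (z2 s) b))\<^sup>2) \<le> total_sq (N1 + N2) f b"
      unfolding total by (simp add: sum_nonneg)
    then show "sqrt (\<Sum>s<N2. (cmod (bilin n m c (z2 s) b))\<^sup>2) \<le> sqrt (Re (Q1 b b + Q2 b b))"
      using lg[of b] by (simp add: Q1_def Q2_def)
  qed (use null p2.nonneg in auto)
  obtain N y where con: "q.complete_orthonormal N y"
    using q.complete_orthonormal_exists by blast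
  \<comment> \<open>\<open>F Q1 b\<close> and \<open>F Q2 b\<close> are the projections of
    \<open>(b, 0)\<close> and \<open>(0, b)\<close> to the diagonal; they add up to the projection
    of \<open>(b, b)\<close>, which is \<open>b\<close> up to a null vector.\<close>
  define F where "F Q b = (\<lambda>i. \<Sum>s<N. Q (y s) b * y s i)" for Q :: "matrix \<Rightarrow> matrix \<Rightarrow> complex" and b
  define c' where "c' Q p q = bilin n m c (ket p) (F Q (ket q))" for Q p q
  have c': "bilin n m (c' Q) a b = bilin n m c a (F Q b)" if "psd_form (square m) Q" for Q a b
  proof -
    interpret psd_form "square m" Q by fact
    have Fb: "bilin n m c a (F Q b) = (\<Sum>s<N. bilin n m c a (y s) * Q (y s) b)" for a b
      unfolding F_def linear_fun_sum[OF linear_fun_bilin_right] by (simp add: mult.commute)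
    have "bilin n m c a (F Q b) = bilin n m (c' Q) a b"
      unfolding c'_def
    proof (rule bilinear_eq_bilin)
      show "linear_fun (square n) (\<lambda>a. bilin n m c a (F Q b))" for b
        by (rule linear_fun_bilin_left)
      show "linear_fun (square m) (\<lambda>b. bilin n m c a (F Q b))" for a
        unfolding Fb by (intro linear_fun_linear_combination lin)
    qed
    then show ?thesis
      by simp
  qed
  have F_le1: "Re (Q1 (F Q1 b) (F Q1 b) + Q2 (F Q1 b) (F Q1 b)) \<le> Re (Q1 b b)" for b
    unfolding F_def q.norm_combination[OF con] by (rule projection_le[OF Q1 Q2 con])
  have F_le2: "Re (Q1 (F Q2 b) (F Q2 b) + Q2 (F Q2 b) (F Q2 b)) \<le> Re (Q2 b b)" for b
    unfolding F_def q.norm_combination[OF con]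
    by (rule projection_le[OF Q2 Q1]) (use con in \<open>simp add: add.commute\<close>)
  have "c p q = c' Q1 p q + c' Q2 p q" if pq: "p \<in> square n" "q \<in> square m" for p q
  proof -
    have "bilin n m c (ket p) (ket q) =
        (\<Sum>s<N. (Q1 (y s) (ket q) + Q2 (y s) (ket q)) * bilin n m c (ket p) (y s))"
    proof (rule q.expand_bounded[OF con linear_fun_bilin_right])
      show "bilin n m c (ket p) b = 0" if "Re (Q1 b b + Q2 b b) = 0" for b
        using le1[of "ket p" b] by (simp only: that) simp
    qed
    also have "\<dots> = c' Q1 p q + c' Q2 p q"
      unfolding c'_def F_def linear_fun_sum[OF
          linear_fun_bilin_right] sum.distrib[symmetric] distrib_right ..
    finally have "bilin n m c (ket p) (ket q) = c' Q1 p q + c' Q2 p q" .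
    moreover have "bilin n m c (ket p) (ket q) = c p q"
    proof -
      have "bilin n m c (ket p) (ket q) = (\<Sum>p'\<in>square n. c p' q * ket p p')"
        unfolding bilin_def by (intro sum.cong refl sum_mult_ket) (use pq in auto)
      also have "\<dots> = c p q"
        by (rule sum_mult_ket) (use pq in auto)
      finally show ?thesis .
    qed
    ultimately show ?thesis
      by simp
  qed
  \<comment> \<open>Here the choice is made: the part through \<open>Q1\<close> uses the bound by
    \<open>P1\<close>, the part through \<open>Q2\<close> the one by \<open>P2\<close>.\<close>
  moreover have "cmod (bilin n m (c' Q1) a b) \<le>
      sqrt (Re (colform n R a a)) * sqrt (Re (rowform m Q b b))" for a b
    unfolding c'[OF Q1] P1_def[symmetric] Q1_def[symmetric]
    by (rule order_trans[OF le1 mult_left_mono]) (use F_le1[of b] p1.nonneg in simp_all)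
  moreover have "cmod (bilin n m (c' Q2) a b) \<le>
      sqrt (Re (rowform n R a a)) * sqrt (Re (colform m Q' b b))" for a b
    unfolding c'[OF Q2] P2_def[symmetric] Q2_def[symmetric]
    by (rule order_trans[OF le2 mult_left_mono]) (use F_le2[of b] p2.nonneg in simp_all)
  ultimately show thesis
    using that[of R Q Q' "c' Q1" "c' Q2"] R Q tr by blast
qed

subsection \<open>Operators on tensor products\<close>

definition nsq :: "'a set \<Rightarrow> 'a vector \<Rightarrow> real" where
  "nsq X v = (\<Sum>\<^sub>\<infinity>x\<in>X. (cmod (v x))\<^sup>2)"

definition contraction :: "'a set \<Rightarrow> 'a operator \<Rightarrow> bool" where
  "contraction X T \<longleftrightarrow> linear_op X T \<and> (\<forall>v\<in>ell2 X. nsq X (T v) \<le> nsq X v)"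

text \<open>Adjoints are carried along as companions instead of being constructed: the adjoint of a
  block of a selfadjoint operator is again a block.\<close>

definition adjoint_pair :: "'a set \<Rightarrow> 'a operator \<Rightarrow> 'a operator \<Rightarrow> bool" where
  "adjoint_pair X T T' \<longleftrightarrow> (\<forall>u\<in>ell2 X. \<forall>v\<in>ell2 X. ell2_inner X u (T v) = ell2_inner X (T' u) v)"

lemma nsq_nonneg: "0 \<le> nsq X v"
  unfolding nsq_def by (rule infsum_nonneg) simp

lemma ell2_norm_eq: "ell2_norm X v = sqrt (nsq X v)"
  by (simp add: ell2_norm_def nsq_def)

lemma ell2D: "v \<in> ell2 X \<Longrightarrow> (\<lambda>x. (cmod (v x))\<^sup>2) summable_on X"
  and ell2_outside: "v \<in> ell2 X \<Longrightarrow> x \<notin> X \<Longrightarrow> v x = 0"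
  by (auto simp: ell2_def)

lemma ell2_mult_summable:
  assumes "u \<in> ell2 X" "v \<in> ell2 X"
  shows "(\<lambda>x. u x * v x) summable_on X"
proof -
  have "(\<lambda>x. norm (u x * v x)) summable_on X"
  proof (rule summable_on_comparison_test)
    show "(\<lambda>x. (cmod (u x))\<^sup>2 + (cmod (v x))\<^sup>2) summable_on X"
      using assms[THEN ell2D] by (rule summable_on_add)
    show "norm (u x * v x) \<le> (cmod (u x))\<^sup>2 + (cmod (v x))\<^sup>2" for x
      using sum_squares_bound[of "cmod (u x)" "cmod (v x)"]
        mult_nonneg_nonneg[OF norm_ge_zero[of "u x"] norm_ge_zero[of "v x"]]
      unfolding norm_mult by linarith
  qed simp
  then show ?thesis
    by (rule abs_summable_summable)
qed

lemma ell2_cnj: "u \<in> ell2 X \<Longrightarrow> (\<lambda>x. cnj (u x)) \<in> ell2 X"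
  by (simp add: ell2_def)

lemma ell2_inner_summable: "u \<in> ell2 X \<Longrightarrow> v \<in> ell2 X \<Longrightarrow> (\<lambda>x. cnj (u x) * v x) summable_on X"
  by (rule ell2_mult_summable[OF ell2_cnj])

lemma ell2_zero [simp]: "(\<lambda>_. 0) \<in> ell2 X"
  by (simp add: ell2_def)

lemma ell2_add:
  assumes "u \<in> ell2 X" "v \<in> ell2 X"
  shows "(\<lambda>x. u x + v x) \<in> ell2 X"
proof -
  have "(\<lambda>x. (cmod (u x + v x))\<^sup>2) summable_on X"
  proof (rule summable_on_comparison_test)
    show "(\<lambda>x. 2 * (cmod (u x))\<^sup>2 + 2 * (cmod (v x))\<^sup>2) summable_on X"
      by (intro summable_on_add summable_on_cmult_right ell2D assms)
    show "(cmod (u x + v x))\<^sup>2 \<le> 2 * (cmod (u x))\<^sup>2 + 2 * (cmod (v x))\<^sup>2" for x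
    proof -
      have "(cmod (u x + v x))\<^sup>2 \<le> (cmod (u x) + cmod (v x))\<^sup>2"
        by (intro power_mono norm_triangle_ineq) simp
      also have "\<dots> \<le> 2 * (cmod (u x))\<^sup>2 + 2 * (cmod (v x))\<^sup>2"
        using sum_squares_bound[of "cmod (u x)" "cmod (v x)"] by (simp add: power2_sum)
      finally show ?thesis .
    qed
  qed simp
  then show ?thesis
    using assms by (simp add: ell2_def)
qed

lemma ell2_scale: "v \<in> ell2 X \<Longrightarrow> (\<lambda>x. c * v x) \<in> ell2 X"
  by (simp add: ell2_def norm_mult power_mult_distrib summable_on_cmult_right)

lemma ell2_sum:
  assumes "\<And>l. l \<in> F \<Longrightarrow> z l \<in> ell2 X"
  shows "(\<lambda>x. \<Sum>l\<in>F. c l * z l x) \<in> ell2 X"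
  using assms
proof (induction F rule: infinite_finite_induct)
  case (insert l F)
  have "(\<lambda>x. c l * z l x + (\<Sum>l\<in>F. c l * z l x)) \<in> ell2 X"
    using insert by (intro ell2_add ell2_scale) auto
  with insert show ?case
    by simp
qed simp_all

lemma ket_ell2: "x \<in> X \<Longrightarrow> ket x \<in> ell2 X"
proof -
  assume "x \<in> X"
  have "(\<lambda>y. (cmod (ket x y))\<^sup>2) summable_on X \<longleftrightarrow> (\<lambda>y. (cmod (ket x y))\<^sup>2) summable_on {x}"
    by (rule summable_on_cong_neutral) (auto simp: ket_def \<open>x \<in> X\<close>)
  then show ?thesis
    using \<open>x \<in> X\<close> by (auto simp: ell2_def ket_def)
qed

lemma ell2_inner_ket: "x \<in> X \<Longrightarrow> ell2_inner X (ket x) v = v x"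
proof -
  assume "x \<in> X"
  then have "ell2_inner X (ket x) v = infsum (\<lambda>y. cnj (ket x y) * v y) {x}"
    unfolding ell2_inner_def by (intro infsum_cong_neutral) (auto simp: ket_def)
  then show ?thesis
    by (simp add: ket_def)
qed

lemma ell2_inner_cnj: "ell2_inner X u v = cnj (ell2_inner X v u)"
  unfolding ell2_inner_def by (simp add: mult.commute flip: infsum_cnj)

lemma ell2_finite: "finite X \<Longrightarrow> v \<in> ell2 X \<longleftrightarrow> (\<forall>x. x \<notin> X \<longrightarrow> v x = 0)"
  by (simp add: ell2_def)

lemma linear_op_ell2: "linear_op X T \<Longrightarrow> v \<in> ell2 X \<Longrightarrow> T v \<in> ell2 X"
  and linear_op_add: "linear_op X T \<Longrightarrow> u \<in> ell2 X \<Longrightarrow> v \<in> ell2 X \<Longrightarrow> T (\<lambda>x. u x + v x) = (\<lambda>x. T u x + T v x)"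
  and linear_op_scale: "linear_op X T \<Longrightarrow> v \<in> ell2 X \<Longrightarrow> T (\<lambda>x. a * v x) = (\<lambda>x. a * T v x)"
  by (auto simp: linear_op_def)

lemma linear_op_zero: "linear_op X T \<Longrightarrow> T (\<lambda>_. 0) = (\<lambda>_. 0)"
  using linear_op_scale[of X T "\<lambda>_. 0" 0] by simp

lemma linear_op_sum:
  assumes T: "linear_op X T" and "\<And>l. l \<in> F \<Longrightarrow> z l \<in> ell2 X"
  shows "T (\<lambda>x. \<Sum>l\<in>F. c l * z l x) = (\<lambda>x. \<Sum>l\<in>F. c l * T (z l) x)"
  using assms(2)
proof (induction F rule: infinite_finite_induct)
  case (insert l F)
  have "T (\<lambda>x. c l * z l x + (\<Sum>l\<in>F. c l * z l x)) = (\<lambda>x. c l * T (z l) x + (\<Sum>l\<in>F. c l * T (z l) x))"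
    using insert linear_op_add[OF T ell2_scale[of "z l" X "c l"] ell2_sum[of F z X c]]
      linear_op_scale[OF T, of "z l" "c l"] by simp
  with insert show ?case
    by simp
qed (simp_all add: linear_op_zero[OF T])

lemma contraction_linear: "contraction X T \<Longrightarrow> linear_op X T"
  and contraction_le: "contraction X T \<Longrightarrow> v \<in> ell2 X \<Longrightarrow> nsq X (T v) \<le> nsq X v"
  by (auto simp: contraction_def)

lemma selfadjoint_contraction_contraction: "selfadjoint_contraction X T \<Longrightarrow> contraction X T"
  and selfadjoint_contraction_adjoint: "selfadjoint_contraction X T \<Longrightarrow> adjoint_pair X T T"
  by (auto simp: selfadjoint_contraction_def contraction_def adjoint_pair_def ell2_norm_eq)

lemma infsum_sqrt_mult_le:
  fixes f g :: "'a \<Rightarrow> real"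
  assumes f: "f summable_on X" "\<And>x. x \<in> X \<Longrightarrow> 0 \<le> f x" and g: "g summable_on X" "\<And>x. x \<in> X \<Longrightarrow> 0 \<le> g x"
  shows "(\<lambda>x. sqrt (f x) * sqrt (g x)) summable_on X"
    and "(\<Sum>\<^sub>\<infinity>x\<in>X. sqrt (f x) * sqrt (g x)) \<le> sqrt (infsum f X) * sqrt (infsum g X)"
proof -
  have le: "(\<Sum>x\<in>F. sqrt (f x) * sqrt (g x)) \<le> sqrt (infsum f X) * sqrt (infsum g X)"
    if F: "finite F" "F \<subseteq> X" for F
  proof -
    have "(\<Sum>x\<in>F. sqrt (f x) * sqrt (g x)) \<le> sqrt (\<Sum>x\<in>F. f x) * sqrt (\<Sum>x\<in>F. g x)"
      by (rule sum_mult_le_sqrt) (use F f g in auto)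
    also have "\<dots> \<le> sqrt (infsum f X) * sqrt (infsum g X)"
      by (intro mult_mono real_sqrt_le_mono
          finite_sum_le_infsum real_sqrt_ge_zero sum_nonneg infsum_nonneg)
        (use F f g in auto)
    finally show ?thesis .
  qed
  show s: "(\<lambda>x. sqrt (f x) * sqrt (g x)) summable_on X"
    by (rule nonneg_bdd_above_summable_on) (use f g le in \<open>auto intro!: bdd_aboveI2\<close>)
  show "(\<Sum>\<^sub>\<infinity>x\<in>X. sqrt (f x) * sqrt (g x)) \<le> sqrt (infsum f X) * sqrt (infsum g X)"
    by (rule infsum_le_finite_sums[OF s le])
qed

lemma has_sum_finite_product:
  fixes f :: "'a \<times> 'b \<Rightarrow> 'c :: topological_comm_monoid_add"
  assumes "finite F" "\<And>i. i \<in> F \<Longrightarrow> ((\<lambda>x. f (i, x)) has_sum s i) X"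
  shows "(f has_sum (\<Sum>i\<in>F. s i)) (F \<times> X)"
  using assms
proof (induction F)
  case (insert i F)
  have "(f has_sum s i) (Pair i ` X)"
    using insert(4)[of i] by (subst has_sum_reindex) (auto simp: o_def inj_on_def)
  then have "(f has_sum (s i + (\<Sum>i\<in>F. s i))) (Pair i ` X \<union> F \<times> X)"
    by (intro has_sum_Un_disjoint insert.IH) (use insert in auto)
  moreover have "Pair i ` X \<union> F \<times> X = insert i F \<times> X"
    by auto
  ultimately show ?case
    using insert by simp
qed simp

text \<open>Tonelli's theorem with the inner sums known only through a summable majorant.\<close>

lemma product_summable_bound:
  fixes g :: "'a \<Rightarrow> 'b \<Rightarrow> real"
  assumes g: "\<And>x. x \<in> X \<Longrightarrow> g x summable_on Y" "\<And>x y. x \<in> X \<Longrightarrow> y \<in> Y \<Longrightarrow> 0 \<le> g x y"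
    and le: "\<And>x. x \<in> X \<Longrightarrow> infsum (g x) Y \<le> h x" and h: "(h has_sum H) X"
  shows "(\<lambda>(x, y). g x y) summable_on X \<times> Y" "infsum (\<lambda>(x, y). g x y) (X \<times> Y) \<le> H"
proof -
  have s: "(\<lambda>x. infsum (g x) Y) summable_on X"
  proof (rule summable_on_comparison_test)
    show "h summable_on X"
      using h by (rule has_sum_imp_summable)
    show "infsum (g x) Y \<le> h x" if "x \<in> X" for x
      by (rule le[OF that])
    show "0 \<le> infsum (g x) Y" if "x \<in> X" for x
      by (rule infsum_nonneg) (rule g(2)[OF that])
  qed
  show sum: "(\<lambda>(x, y). g x y) summable_on X \<times> Y"
    by (rule summable_on_SigmaI[where g = "\<lambda>x. infsum (g x) Y"]) (use g s in auto)
  have "infsum (\<lambda>(x, y). g x y) (X \<times> Y) = (\<Sum>\<^sub>\<infinity>x\<in>X. infsum (g x) Y)"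
    using infsum_Sigma_banach[OF sum] by simp
  also have "\<dots> \<le> H"
    by (rule has_sum_mono[OF has_sum_infsum[OF s] h le])
  finally show "infsum (\<lambda>(x, y). g x y) (X \<times> Y) \<le> H" .
qed

text \<open>Flipping the factors transfers statements on operators on the right factor to the left
  factor.\<close>

definition swapv :: "('a \<times> 'b) vector \<Rightarrow> ('b \<times> 'a) vector" where
  "swapv w = (\<lambda>(y, x). w (x, y))"

lemma swapv_swapv [simp]: "swapv (swapv w) = w"
  by (auto simp: swapv_def)

lemma swapv_ell2: "w \<in> ell2 (X \<times> Y) \<Longrightarrow> swapv w \<in> ell2 (Y \<times> X)"
  using summable_on_swap[of "\<lambda>p. (cmod (w p))\<^sup>2" X Y]
  by (auto simp: ell2_def swapv_def split_def)

lemma infsum_swapv: "infsum (\<lambda>(y, x). f (x, y)) (Y \<times> X) = infsum f (X \<times> Y)"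
proof -
  have "infsum f (prod.swap ` (Y \<times> X)) = infsum (f \<circ> prod.swap) (Y \<times> X)"
    by (rule infsum_reindex) simp
  moreover have "f \<circ> prod.swap = (\<lambda>(y, x). f (x, y))"
    by auto
  ultimately show ?thesis
    by (simp add: product_swap)
qed

lemma nsq_swapv: "nsq (Y \<times> X) (swapv w) = nsq (X \<times> Y) w"
  using infsum_swapv[of "\<lambda>p. (cmod (w p))\<^sup>2" Y X] by (simp add: nsq_def swapv_def split_def)

lemma ell2_inner_swapv: "ell2_inner (Y \<times> X) (swapv u) (swapv w) = ell2_inner (X \<times> Y) u w"
  using infsum_swapv[of "\<lambda>p. cnj (u p) * w p" Y X] by (simp add: ell2_inner_def swapv_def split_def)

lemma slice_ell2:
  assumes "w \<in> ell2 (X \<times> Y)"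
  shows "(\<lambda>y. w (x, y)) \<in> ell2 Y"
proof (cases "x \<in> X")
  case True
  then have "(\<lambda>y. (cmod (w (x, y)))\<^sup>2) summable_on Y"
    using summable_on_SigmaD1[of "\<lambda>x y. (cmod (w (x, y)))\<^sup>2" X "\<lambda>_. Y" x] ell2D[OF assms]
    by (simp add: split_def)
  then show ?thesis
    using ell2_outside[OF assms] by (auto simp: ell2_def)
next
  case False
  then have "(\<lambda>y. w (x, y)) = (\<lambda>_. 0)"
    using ell2_outside[OF assms] by auto
  then show ?thesis
    by simp
qed

lemma nsq_slices:
  assumes "w \<in> ell2 (X \<times> Y)"
  shows "((\<lambda>x. nsq Y (\<lambda>y. w (x, y))) has_sum nsq (X \<times> Y) w) X"
proof -
  have s: "(\<lambda>(x, y). (cmod (w (x, y)))\<^sup>2) summable_on X \<times> Y"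
    using ell2D[OF assms] by (simp add: split_def)
  have "((\<lambda>x. nsq Y (\<lambda>y. w (x, y))) has_sum (infsum (\<lambda>(x, y). (cmod (w (x, y)))\<^sup>2) (X \<times> Y))) X"
  proof (rule has_sum_SigmaD[OF has_sum_infsum[OF s]])
    show "((\<lambda>y. case (x, y) of (x, y) \<Rightarrow> (cmod (w (x, y)))\<^sup>2) has_sum nsq Y (\<lambda>y. w (x, y))) Y" for x
      using ell2D[OF slice_ell2[OF assms, of x]]
          unfolding nsq_def by (simp only: prod.case has_sum_infsum)
  qed
  then show ?thesis
    by (simp add: nsq_def split_def)
qed

lemma ell2_inner_slices:
  assumes "u \<in> ell2 (X \<times> Y)" "w \<in> ell2 (X \<times> Y)"
  shows "ell2_inner (X \<times> Y) u w = (\<Sum>\<^sub>\<infinity>x\<in>X. ell2_inner Y (\<lambda>y. u (x, y)) (\<lambda>y. w (x, y)))"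
  unfolding ell2_inner_def using infsum_Sigma_banach[OF ell2_inner_summable[OF assms]] by simp

definition right_op :: "'b operator \<Rightarrow> ('a \<times> 'b) operator" where
  "right_op S w = (\<lambda>(x, y). S (\<lambda>y'. w (x, y')) y)"

definition left_op :: "'a operator \<Rightarrow> ('a \<times> 'b) operator" where
  "left_op T w = (\<lambda>(x, y). T (\<lambda>x'. w (x', y)) x)"

lemma tensor_op_eq: "tensor_op T S w = left_op T (right_op S w)"
  by (simp add: tensor_op_def left_op_def right_op_def)

lemma left_op_eq: "left_op T w = swapv (right_op T (swapv w))"
  by (auto simp: left_op_def right_op_def swapv_def)

lemma right_op_ell2:
  assumes S: "contraction Y S" and w: "w \<in> ell2 (X \<times> Y)"
  shows "right_op S w \<in> ell2 (X \<times> Y)"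
proof -
  have Sw: "S (\<lambda>y'. w (x, y')) \<in> ell2 Y" for x
    by (rule linear_op_ell2[OF contraction_linear[OF S] slice_ell2[OF w]])
  have "(\<lambda>(x, y). (cmod (S (\<lambda>y'. w (x, y')) y))\<^sup>2) summable_on X \<times> Y"
  proof (rule product_summable_bound(1)[OF _ _ _ nsq_slices[OF w]])
    show "infsum (\<lambda>y. (cmod (S (\<lambda>y'. w (x, y')) y))\<^sup>2) Y \<le> nsq Y (\<lambda>y. w (x, y))" for x
      using contraction_le[OF S slice_ell2[OF w, of x]] by (simp add: nsq_def)
  qed (use ell2D[OF Sw] in auto)
  moreover have "right_op S w p = 0" if "p \<notin> X \<times> Y" for p
  proof (cases "fst p \<in> X")
    case True
    then show ?thesis
      using that ell2_outside[OF Sw] by (cases p) (auto simp: right_op_def)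
  next
    case False
    then have "(\<lambda>y'. w (fst p, y')) = (\<lambda>_. 0)"
      using ell2_outside[OF w] by auto
    then show ?thesis
      using linear_op_zero[OF contraction_linear[OF S]] by (simp add: right_op_def split_def)
  qed
  ultimately show ?thesis
    by (auto simp: ell2_def right_op_def split_def)
qed

lemma left_op_ell2:
  assumes "contraction X T" "w \<in> ell2 (X \<times> Y)"
  shows "left_op T w \<in> ell2 (X \<times> Y)"
  unfolding left_op_eq by (intro swapv_ell2 right_op_ell2 assms)

lemma right_op_adjoint:
  assumes S: "contraction Y S" "contraction Y S'" "adjoint_pair Y S S'"
    and u: "u \<in> ell2 (X \<times> Y)" and w: "w \<in> ell2 (X \<times> Y)"
  shows "ell2_inner (X \<times> Y) u (right_op S w) = ell2_inner (X \<times> Y) (right_op S' u) w"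
  unfolding ell2_inner_slices[OF u
      right_op_ell2[OF S(1) w]] ell2_inner_slices[OF right_op_ell2[OF S(2) u] w]
  using S(3) slice_ell2[OF u] slice_ell2[OF w] by (simp add: right_op_def adjoint_pair_def)

lemma left_op_adjoint:
  assumes T: "contraction X T" "contraction X T'" "adjoint_pair X T T'"
    and u: "u \<in> ell2 (X \<times> Y)" and w: "w \<in> ell2 (X \<times> Y)"
  shows "ell2_inner (X \<times> Y) u (left_op T w) = ell2_inner (X \<times> Y) (left_op T' u) w"
  using right_op_adjoint[OF T swapv_ell2[OF u] swapv_ell2[OF w]]
    ell2_inner_swapv[of Y X u "swapv (right_op T (swapv w))"]
    ell2_inner_swapv[of Y X "swapv (right_op T' (swapv u))" w]
  by (simp add: left_op_eq)

lemma ell2_product: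
  assumes "t \<in> ell2 X" "s \<in> ell2 Y"
  shows "(\<lambda>(x, y). t x * s y) \<in> ell2 (X \<times> Y)"
proof -
  have "(\<lambda>(x, y). (cmod (t x))\<^sup>2 * (cmod (s y))\<^sup>2) summable_on X \<times> Y"
  proof (rule product_summable_bound(1))
    show "(\<lambda>y. (cmod (t x))\<^sup>2 * (cmod (s y))\<^sup>2) summable_on Y" for x
      by (rule summable_on_cmult_right[OF ell2D[OF assms(2)]])
    show "infsum (\<lambda>y. (cmod (t x))\<^sup>2 * (cmod (s y))\<^sup>2) Y \<le> (cmod (t x))\<^sup>2 * nsq Y s" for x
      by (simp add: nsq_def infsum_cmult_right')
    show "((\<lambda>x. (cmod (t x))\<^sup>2 * nsq Y s) has_sum (nsq X t * nsq Y s)) X"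
      unfolding nsq_def[of X t] by (rule has_sum_cmult_left[OF has_sum_infsum[OF ell2D[OF assms(1)]]])
  qed auto
  then show ?thesis
    using assms by (auto simp: ell2_def split_def norm_mult power_mult_distrib)
qed

text \<open>Each coordinate of \<open>T v\<close> is a sum against a fixed square summable vector,
  so operators become kernels to which Fubini's theorem applies.\<close>

lemma adjoint_apply:
  assumes T: "contraction X T" "adjoint_pair X T T'" and x: "x \<in> X" and v: "v \<in> ell2 X"
  shows "T v x = (\<Sum>\<^sub>\<infinity>x'\<in>X. cnj (T' (ket x) x') * v x')"
proof -
  have "T v x = ell2_inner X (ket x) (T v)"
    by (rule ell2_inner_ket[OF x, symmetric])
  also have "\<dots> = ell2_inner X (T' (ket x)) v"
    using T(2) ket_ell2[OF x] v by (simp add: adjoint_pair_def)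
  finally show ?thesis
    by (simp only: ell2_inner_def)
qed

text \<open>Both orders give the same double sum at \<open>(x, y)\<close>: the product of the two
  kernel rows is square summable on \<open>X \<times> Y\<close>, so its product with
  \<open>w\<close> is absolutely summable.\<close>

lemma left_right_commute:
  assumes T: "contraction X T" "contraction X T'" "adjoint_pair X T T'"
    and S: "contraction Y S" "contraction Y S'" "adjoint_pair Y S S'"
    and w: "w \<in> ell2 (X \<times> Y)"
  shows "left_op T (right_op S w) = right_op S (left_op T w)"
proof
  fix p
  show "left_op T (right_op S w) p = right_op S (left_op T w) p"
  proof (cases "p \<in> X \<times> Y")
    case False
    show ?thesis
      using ell2_outside[OF left_op_ell2[OF T(1) right_op_ell2[OF S(1) w]] False]
        ell2_outside[OF right_op_ell2[OF S(1) left_op_ell2[OF T(1) w]] False] by simp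
  next
    case True
    then obtain x y where p: "p = (x, y)" "x \<in> X" "y \<in> Y"
      by auto
    define t where "t = (\<lambda>x'. cnj (T' (ket x) x'))"
    define s where "s = (\<lambda>y'. cnj (S' (ket y) y'))"
    have t: "t \<in> ell2 X" and s: "s \<in> ell2 Y"
      unfolding t_def s_def
      using linear_op_ell2[OF contraction_linear[OF T(2)] ket_ell2[OF p(2)]]
        linear_op_ell2[OF contraction_linear[OF S(2)] ket_ell2[OF p(3)]]
      by (auto intro: ell2_cnj)
    have sl1: "(\<lambda>y'. v (x', y')) \<in> ell2 Y" and sl2: "(\<lambda>x'. v (x', y')) \<in> ell2 X"
      if "v \<in> ell2 (X \<times> Y)" for v x' y'
      using slice_ell2[OF that] slice_ell2[OF swapv_ell2[OF that]] by (simp_all add: swapv_def)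
    have "left_op T (right_op S w) p = (\<Sum>\<^sub>\<infinity>x'\<in>X. t x' * (\<Sum>\<^sub>\<infinity>y'\<in>Y. s y' * w (x', y')))"
      using adjoint_apply[OF T(1,3) p(2) sl2[OF right_op_ell2[OF S(1) w], of y]]
        adjoint_apply[OF S(1,3) p(3) sl1[OF w]]
      by (simp add: p left_op_def right_op_def t_def s_def)
    also have "\<dots> = (\<Sum>\<^sub>\<infinity>x'\<in>X. \<Sum>\<^sub>\<infinity>y'\<in>Y. (t x' * s y') * w (x', y'))"
      by (simp add: mult.assoc infsum_cmult_right')
    also have "\<dots> = (\<Sum>\<^sub>\<infinity>y'\<in>Y. \<Sum>\<^sub>\<infinity>x'\<in>X. (t x' * s y') * w (x', y'))"
      using infsum_swap_banach[of "\<lambda>x' y'. (t x' * s y') * w (x', y')" X Y]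
        ell2_mult_summable[OF ell2_product[OF t s] w] by (simp add: split_def)
    also have "\<dots> = (\<Sum>\<^sub>\<infinity>y'\<in>Y. s y' * (\<Sum>\<^sub>\<infinity>x'\<in>X. t x' * w (x', y')))"
      by (simp add: mult.assoc mult.left_commute infsum_cmult_right' flip: infsum_cmult_right')
    also have "\<dots> = right_op S (left_op T w) p"
      using adjoint_apply[OF S(1,3) p(3) sl1[OF left_op_ell2[OF T(1) w], of x]]
        adjoint_apply[OF T(1,3) p(2) sl2[OF w]]
      by (simp add: p left_op_def right_op_def t_def s_def)
    finally show ?thesis .
  qed
qed

text \<open>As \<open>tensor_op\<close> applies \<open>S\<close> first, moving \<open>T\<close>
  across needs only its adjoint, while moving \<open>S\<close> needs the commutation of the two
  factors as well.\<close>

lemma tensor_inner: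
  assumes T: "contraction X T" "contraction X T'" "adjoint_pair X T T'"
    and S: "contraction Y S" "contraction Y S'" "adjoint_pair Y S S'"
    and u: "u \<in> ell2 (X \<times> Y)" and w: "w \<in> ell2 (X \<times> Y)"
  shows "ell2_inner (X \<times> Y) u (tensor_op T S w) = ell2_inner (X \<times> Y) (left_op T' u) (right_op S w)"
    and "ell2_inner (X \<times> Y) u (tensor_op T S w) = ell2_inner (X \<times> Y) (right_op S' u) (left_op T w)"
  unfolding tensor_op_eq left_op_adjoint[OF T u right_op_ell2[OF S(1) w]]
  using left_op_adjoint[OF T u right_op_ell2[OF S(1) w]] left_right_commute[OF T S w]
    right_op_adjoint[OF S u left_op_ell2[OF T(1) w]] by simp_all

section \<open>Operators as finite matrices of blocks\<close>

definition embed :: "nat \<Rightarrow> 'a vector \<Rightarrow> (nat \<times> 'a) vector" where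
  "embed j v = (\<lambda>(i, x). if i = j then v x else 0)"

text \<open>\<open>block A i j\<close> is \<open>A\<^sub>i\<^sub>j\<close> in \<open>A = \<Sum>\<^sub>i\<^sub>j e\<^sub>i\<^sub>j \<otimes> A\<^sub>i\<^sub>j\<close>.\<close>

definition block :: "(nat \<times> 'a) operator \<Rightarrow> nat \<Rightarrow> nat \<Rightarrow> 'a operator" where
  "block A i j v = (\<lambda>x. A (embed j v) (i, x))"

lemma nsq_finite_product:
  fixes w :: "(nat \<times> 'a) vector"
  assumes "\<And>i. i < n \<Longrightarrow> (\<lambda>x. w (i, x)) \<in> ell2 X" "\<And>p. p \<notin> {..<n} \<times> X \<Longrightarrow> w p = 0"
  shows "w \<in> ell2 ({..<n} \<times> X)" "nsq ({..<n} \<times> X) w = (\<Sum>i<n. nsq X (\<lambda>x. w (i, x)))"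
proof -
  have *: "((\<lambda>p. (cmod (w p))\<^sup>2) has_sum (\<Sum>i<n. nsq X (\<lambda>x. w (i, x)))) ({..<n} \<times> X)"
    by (rule has_sum_finite_product) (use assms(1)[THEN ell2D] in \<open>auto simp: nsq_def\<close>)
  show "w \<in> ell2 ({..<n} \<times> X)"
    using assms(2) has_sum_imp_summable[OF *] by (simp add: ell2_def)
  show "nsq ({..<n} \<times> X) w = (\<Sum>i<n. nsq X (\<lambda>x. w (i, x)))"
    unfolding nsq_def[of "{..<n} \<times> X"] using infsumI[OF *] .
qed

lemma embed_ell2:
  assumes "v \<in> ell2 X" "j < n"
  shows "embed j v \<in> ell2 ({..<n} \<times> X)" "nsq ({..<n} \<times> X) (embed j v) = nsq X v"
proof -
  have s: "(\<lambda>x. embed j v (i, x)) = (if i = j then v else (\<lambda>_. 0))" for i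
    by (auto simp: embed_def)
  have 1: "(\<lambda>x. embed j v (i, x)) \<in> ell2 X" for i
    unfolding s using assms by simp
  have 2: "embed j v p = 0" if "p \<notin> {..<n} \<times> X" for p
    using that assms ell2_outside[OF assms(1)] by (cases p) (auto simp: embed_def)
  show "embed j v \<in> ell2 ({..<n} \<times> X)"
    by (rule nsq_finite_product(1)[OF 1 2])
  have "nsq ({..<n} \<times> X) (embed j v) = (\<Sum>i<n. nsq X (\<lambda>x. embed j v (i, x)))"
    by (rule nsq_finite_product(2)[OF 1 2])
  also have "\<dots> = (\<Sum>i<n. if i = j then nsq X v else 0)"
    unfolding s by (intro sum.cong refl) (simp add: nsq_def)
  finally show "nsq ({..<n} \<times> X) (embed j v) = nsq X v"
    using assms by simp
qed

lemma block_contraction: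
  assumes A: "contraction ({..<n} \<times> X) A" and ij: "i < n" "j < n"
  shows "contraction X (block A i j)"
proof -
  note lin = contraction_linear[OF A]
  have Ae: "A (embed j v) \<in> ell2 ({..<n} \<times> X)" if "v \<in> ell2 X" for v
    by (rule linear_op_ell2[OF lin embed_ell2(1)[OF that ij(2)]])
  have "linear_op X (block A i j)"
    unfolding linear_op_def
  proof (intro conjI ballI allI)
    show "block A i j v \<in> ell2 X" if "v \<in> ell2 X" for v
      unfolding block_def by (rule slice_ell2[OF Ae[OF that]])
    have "embed j (\<lambda>x. u x + v x) = (\<lambda>p. embed j u p + embed j v p)" for u v :: "'a vector"
      by (auto simp: embed_def)
    then show "block A i j (\<lambda>x. u x + v x) = (\<lambda>x. block A i j u x + block A i j v x)"
      if "u \<in> ell2 X" "v \<in> ell2 X" for u v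
      using linear_op_add[OF lin embed_ell2(1)[OF that(1) ij(2)] embed_ell2(1)[OF that(2) ij(2)]]
      by (simp add: block_def)
    have "embed j (\<lambda>x. a * v x) = (\<lambda>p. a * embed j v p)" for a and v :: "'a vector"
      by (auto simp: embed_def)
    then show "block A i j (\<lambda>x. a * v x) = (\<lambda>x. a * block A i j v x)" if "v \<in> ell2 X" for a v
      using linear_op_scale[OF lin embed_ell2(1)[OF that ij(2)]] by (simp add: block_def)
  qed
  moreover have "nsq X (block A i j v) \<le> nsq X v" if v: "v \<in> ell2 X" for v
  proof -
    have "nsq X (block A i j v) \<le> (\<Sum>i<n. nsq X (\<lambda>x. A (embed j v) (i, x)))"
      unfolding block_def by (rule member_le_sum) (use ij nsq_nonneg in auto)
    also have "\<dots> = nsq ({..<n} \<times> X) (A (embed j v))"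
      by (rule nsq_finite_product(2)[symmetric])
        (use slice_ell2[OF Ae[OF v]] ell2_outside[OF Ae[OF v]] in auto)
    also have "\<dots> \<le> nsq ({..<n} \<times> X) (embed j v)"
      by (rule contraction_le[OF A embed_ell2(1)[OF v ij(2)]])
    also have "\<dots> = nsq X v"
      by (rule embed_ell2(2)[OF v ij(2)])
    finally show ?thesis .
  qed
  ultimately show ?thesis
    by (simp add: contraction_def)
qed

lemma ell2_inner_embed:
  assumes "u \<in> ell2 X" "w \<in> ell2 ({..<n} \<times> X)" "i < n"
  shows "ell2_inner ({..<n} \<times> X) (embed i u) w = ell2_inner X u (\<lambda>x. w (i, x))"
proof -
  have "ell2_inner ({..<n} \<times> X)
      (embed i u) w = (\<Sum>\<^sub>\<infinity>l\<in>{..<n}. ell2_inner X (\<lambda>x. embed i u (l, x)) (\<lambda>x. w (l, x)))"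
    by (rule ell2_inner_slices[OF embed_ell2(1)[OF assms(1,3)] assms(2)])
  also have "\<dots> = (\<Sum>l<n. if l = i then ell2_inner X u (\<lambda>x. w (i, x)) else 0)"
    unfolding infsum_finite[OF finite_lessThan]
    by (intro sum.cong refl) (auto simp: embed_def ell2_inner_def)
  finally show ?thesis
    using assms(3) by simp
qed

lemma block_adjoint:
  assumes A: "selfadjoint_contraction ({..<n} \<times> X) A" and ij: "i < n" "j < n"
  shows "adjoint_pair X (block A i j) (block A j i)"
  unfolding adjoint_pair_def
proof (intro ballI)
  fix u v assume uv: "u \<in> ell2 X" "v \<in> ell2 X"
  note lin = contraction_linear[OF selfadjoint_contraction_contraction[OF A]]
  have Ae: "A (embed k w) \<in> ell2 ({..<n} \<times> X)" if "w \<in> ell2 X" "k < n" for w k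
    by (rule linear_op_ell2[OF lin embed_ell2(1)[OF that]])
  have "ell2_inner X u (block A i j v) = ell2_inner ({..<n} \<times> X) (embed i u) (A (embed j v))"
    unfolding block_def by (rule ell2_inner_embed[OF uv(1) Ae[OF uv(2) ij(2)] ij(1), symmetric])
  also have "\<dots> = ell2_inner ({..<n} \<times> X) (A (embed i u)) (embed j v)"
    using selfadjoint_contraction_adjoint[OF A]
        embed_ell2(1)[OF uv(1) ij(1)] embed_ell2(1)[OF uv(2) ij(2)]
    by (simp add: adjoint_pair_def)
  also have "\<dots> = cnj (ell2_inner X v (block A j i u))"
    unfolding block_def
    using ell2_inner_embed[OF uv(2) Ae[OF uv(1) ij(1)] ij(2)]
      ell2_inner_cnj[of "{..<n} \<times> X" "A (embed i u)" "embed j v"] by simp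
  also have "\<dots> = ell2_inner X (block A j i u) v"
    by (rule ell2_inner_cnj[symmetric])
  finally show "ell2_inner X u (block A i j v) = ell2_inner X (block A j i u) v" .
qed

subsection \<open>The value on a vector state\<close>

lemma has_sum_finite_sum:
  fixes f :: "'i \<Rightarrow> 'a \<Rightarrow> 'b :: topological_comm_monoid_add"
  assumes "\<And>i. i \<in> F \<Longrightarrow> (f i has_sum s i) X"
  shows "((\<lambda>x. \<Sum>i\<in>F. f i x) has_sum (\<Sum>i\<in>F. s i)) X"
  using assms by (induction F rule: infinite_finite_induct) (auto intro: has_sum_add)

text \<open>This is where complete boundedness comes from. In an orthonormal basis, \<open>R\<close>
  is a sum of squares of functionals with coefficients \<open>W s\<close>. For each
  \<open>s\<close>, summing over \<open>i\<close> and \<open>x\<close> yields the squared norm of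
  \<open>A\<close> applied to the product vector \<open>W s \<otimes> v\<close>, so that
  \<open>A\<close> as a whole is used and not its single blocks.\<close>

lemma block_form_sum:
  assumes A: "contraction ({..<n} \<times> X) A" and R: "psd_form {..<n} R" and v: "v \<in> ell2 X"
  defines "g \<equiv> (\<lambda>x. \<Sum>i<n. Re (R (\<lambda>l. cnj (block A i l v x)) (\<lambda>l. cnj (block A i l v x))))"
  shows "g summable_on X" "infsum g X \<le> trace_form n R * nsq X v"
proof -
  interpret psd_form "{..<n}" R by fact
  obtain N z where con: "complete_orthonormal N z"
    using complete_orthonormal_exists by blast
  define W where "W s l = cnj (R (z s) (ket l))" for s l
  define w where "w s = (\<lambda>p. \<Sum>l<n. W s l * embed l v p)" for s
  note A_lin = contraction_linear[OF A]
  have emb: "embed l v \<in> ell2 ({..<n} \<times> X)" if "l \<in> {..<n}" for l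
    using embed_ell2(1)[OF v] that by simp
  have w_ell2: "w s \<in> ell2 ({..<n} \<times> X)" for s
    unfolding w_def by (rule ell2_sum[OF emb])
  have Aw: "A (w s) = (\<lambda>p. \<Sum>l<n. W s l * A (embed l v) p)" for s
    unfolding w_def by (rule linear_op_sum[OF A_lin emb])
  have Aw_ell2: "A (w s) \<in> ell2 ({..<n} \<times> X)" for s
    by (rule linear_op_ell2[OF A_lin w_ell2])
  have w_slice: "(\<lambda>x. w s (i, x)) = (\<lambda>x. W s i * v x)" if "i < n" for s i
  proof
    fix x
    have "w s (i, x) = (\<Sum>l<n. if l = i then W s i * v x else 0)"
      unfolding w_def by (intro sum.cong refl) (auto simp: embed_def)
    then show "w s (i, x) = W s i * v x"
      using that by simp
  qed
  have nsq_w: "nsq ({..<n} \<times> X) (w s) = (\<Sum>l<n. (cmod (W s l))\<^sup>2) * nsq X v" for s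
  proof -
    have "nsq ({..<n} \<times> X) (w s) = (\<Sum>i<n. nsq X (\<lambda>x. w s (i, x)))"
      by (rule nsq_finite_product(2)) (use slice_ell2[OF w_ell2] ell2_outside[OF w_ell2] in auto)
    also have "\<dots> = (\<Sum>i<n. (cmod (W s i))\<^sup>2 * nsq X v)"
      by (intro sum.cong refl)
        (simp add: w_slice, simp add: nsq_def norm_mult power_mult_distrib infsum_cmult_right')
    finally show ?thesis
      by (simp add: sum_distrib_right)
  qed
  have g_eq: "g x = (\<Sum>s<N. \<Sum>i<n. (cmod (A (w s) (i, x)))\<^sup>2)" for x
  proof -
    have "Re (R (\<lambda>l. cnj (block A i l v x)) (\<lambda>l. cnj (block A i l v x))) =
        (\<Sum>s<N. (cmod (A (w s) (i, x)))\<^sup>2)" for i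
    proof -
      have "R (z s) (\<lambda>l. cnj (block A i l v x)) = cnj (A (w s) (i, x))" for s
      proof -
        have "R (z s) (\<lambda>l. cnj (block A i l v x)) = (\<Sum>l<n. cnj (block A i l v x) * R (z s) (ket l))"
          by (rule linear_fun_expand[OF lin]) simp
        then show ?thesis
          by (simp add: Aw W_def block_def mult.commute)
      qed
      then show ?thesis
        by (simp add: parseval[OF con])
    qed
    then show ?thesis
      unfolding g_def by (simp add: sum.swap[of _ "{..<N}"])
  qed
  have hs: "((\<lambda>x. \<Sum>s<N. \<Sum>i<n. (cmod (A (w s) (i, x)))\<^sup>2) has_sum (\<Sum>s<N. nsq ({..<n} \<times> X) (A (w s)))) X"
  proof (intro has_sum_finite_sum)
    fix s
    have "nsq ({..<n} \<times> X) (A (w s)) = (\<Sum>i<n. nsq X (\<lambda>x. A (w s) (i, x)))"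
      by (rule nsq_finite_product(2)) (use slice_ell2[OF Aw_ell2] ell2_outside[OF Aw_ell2] in auto)
    moreover have "((\<lambda>x. \<Sum>i<n. (cmod (A (w s) (i, x)))\<^sup>2) has_sum (\<Sum>i<n. nsq X (\<lambda>x. A (w s) (i, x)))) X"
      unfolding nsq_def by (intro has_sum_finite_sum has_sum_infsum ell2D slice_ell2[OF Aw_ell2])
    ultimately show "((\<lambda>x. \<Sum>i<n. (cmod (A (w s) (i, x)))\<^sup>2) has_sum nsq ({..<n} \<times> X) (A (w s))) X"
      by simp
  qed
  then have gs: "(g has_sum (\<Sum>s<N. nsq ({..<n} \<times> X) (A (w s)))) X"
    by (simp only: g_eq[abs_def] ext[of g, OF g_eq])
  then show "g summable_on X"
    by (rule has_sum_imp_summable)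
  have "infsum g X = (\<Sum>s<N. nsq ({..<n} \<times> X) (A (w s)))"
    by (rule infsumI[OF gs])
  also have "\<dots> \<le> (\<Sum>s<N. (\<Sum>l<n. (cmod (W s l))\<^sup>2) * nsq X v)"
    by (intro sum_mono order_trans[OF contraction_le[OF A w_ell2]]) (simp add: nsq_w)
  also have "\<dots> = trace_form n R * nsq X v"
    unfolding sum_distrib_right[symmetric] trace_form_def parseval[OF con]
    by (subst sum.swap) (simp add: W_def)
  finally show "infsum g X \<le> trace_form n R * nsq X v" .
qed

text \<open>On each slice this is \<open>block_form_sum\<close>, and the squared norms of the slices
  add up.\<close>

lemma right_form_sum:
  assumes B: "contraction ({..<m} \<times> Y) B" and R: "psd_form {..<m} R" and w: "w \<in> ell2 (X \<times> Y)"
  defines "g \<equiv> (\<lambda>p. \<Sum>i<m. Re (R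
      (\<lambda>l. cnj (right_op (block B i l) w p)) (\<lambda>l. cnj (right_op (block B i l) w p))))"
  shows "g summable_on X \<times> Y" "infsum g (X \<times> Y) \<le> trace_form m R * nsq (X \<times> Y) w"
proof -
  note s = slice_ell2[OF w]
  define h where "h x y = (\<Sum>i<m.
      Re (R (\<lambda>l. cnj (block B i l (\<lambda>y'. w (x, y')) y))
          (\<lambda>l. cnj (block B i l (\<lambda>y'. w (x, y')) y))))" for x y
  have g: "g = (\<lambda>(x, y). h x y)"
    by (auto simp: g_def h_def right_op_def)
  have h: "h x summable_on Y" "infsum (h x) Y \<le> trace_form m R * nsq Y (\<lambda>y. w (x, y))" for x
    unfolding h_def using block_form_sum[OF B R s[of x]] by auto
  have nonneg: "0 \<le> h x y" for x y
    unfolding h_def by (intro sum_nonneg psd_form.nonneg[OF R])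
  have hs: "((\<lambda>x. trace_form m R * nsq Y (\<lambda>y. w (x, y))) has_sum (trace_form m R * nsq (X \<times> Y) w)) X"
    by (rule has_sum_cmult_right[OF nsq_slices[OF w]])
  show "g summable_on X \<times> Y" "infsum g (X \<times> Y) \<le> trace_form m R * nsq (X \<times> Y) w"
    unfolding g by (rule product_summable_bound[OF h(1) nonneg h(2) hs])+
qed

lemma left_form_sum:
  assumes A: "contraction ({..<n} \<times> X) A" and R: "psd_form {..<n} R" and w: "w \<in> ell2 (X \<times> Y)"
  defines "g \<equiv> (\<lambda>p. \<Sum>i<n. Re (R
      (\<lambda>l. cnj (left_op (block A i l) w p)) (\<lambda>l. cnj (left_op (block A i l) w p))))"
  shows "g summable_on X \<times> Y" "infsum g (X \<times> Y) \<le> trace_form n R * nsq (X \<times> Y) w"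
proof -
  define h where "h = (\<lambda>p. \<Sum>i<n.
      Re (R (\<lambda>l. cnj (right_op (block A i l) (swapv w) p))
          (\<lambda>l. cnj (right_op (block A i l) (swapv w) p))))"
  have g: "g = (\<lambda>(x, y). h (y, x))"
    by (auto simp: g_def h_def left_op_eq swapv_def)
  note h = right_form_sum[OF A R swapv_ell2[OF w], folded h_def]
  show "g summable_on X \<times> Y"
    unfolding g using h(1) summable_on_swap[of h Y X] by simp
  show "infsum g (X \<times> Y) \<le> trace_form n R * nsq (X \<times> Y) w"
    unfolding g using h(2) infsum_swapv[of h X Y] by (simp add: nsq_swapv)
qed

lemma bilin_has_sum:
  assumes "\<And>p q. p \<in> square n \<Longrightarrow> q \<in> square m \<Longrightarrow> ((\<lambda>r. a r p * b r q) has_sum h p q) Z"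
  shows "((\<lambda>r. bilin n m c (a r) (b r)) has_sum (\<Sum>p\<in>square n. \<Sum>q\<in>square m. c p q * h p q)) Z"
  unfolding bilin_def mult.assoc by (intro has_sum_finite_sum has_sum_cmult_right assms)

text \<open>At each coordinate \<open>r\<close> the scalar estimate applies to the matrices
  \<open>a r\<close> and \<open>b r\<close>; Cauchy-Schwarz over \<open>r\<close> then sums it
  up.\<close>

lemma bilin_sum_le:
  fixes p q :: "matrix \<Rightarrow> real"
  assumes bd: "\<And>a b. cmod (bilin n m c a b) \<le> sqrt (p a) * sqrt (q b)"
    and nn: "\<And>a. 0 \<le> p a" "\<And>b. 0 \<le> q b"
    and sum: "\<And>p q. p \<in> square n \<Longrightarrow> q \<in> square m \<Longrightarrow> ((\<lambda>r. a r p * b r q) has_sum h p q) Z"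
    and p: "(\<lambda>r. p (a r)) summable_on Z" "infsum (\<lambda>r. p (a r)) Z \<le> P"
    and q: "(\<lambda>r. q (b r)) summable_on Z" "infsum (\<lambda>r. q (b r)) Z \<le> Q"
  shows "cmod (\<Sum>p\<in>square n. \<Sum>q\<in>square m. c p q * h p q) \<le> sqrt P * sqrt Q"
proof -
  have "cmod (\<Sum>p\<in>square n. \<Sum>q\<in>square m. c p q * h p q) \<le> (\<Sum>\<^sub>\<infinity>r\<in>Z. sqrt (p (a r)) * sqrt (q (b r)))"
    by (rule norm_infsum_le[OF bilin_has_sum[OF sum] has_sum_infsum])
      (use infsum_sqrt_mult_le(1)[OF p(1) nn(1) q(1) nn(2)] bd in auto)
  also have "\<dots> \<le> sqrt (infsum (\<lambda>r. p (a r)) Z) * sqrt (infsum (\<lambda>r. q (b r)) Z)"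
    by (rule infsum_sqrt_mult_le(2)[OF p(1) nn(1) q(1) nn(2)])
  also have "\<dots> \<le> sqrt P * sqrt Q"
    using p(2) q(2) infsum_nonneg[of Z "\<lambda>r. p (a r)"] infsum_nonneg[of Z "\<lambda>r. q (b r)"] nn
    by (intro mult_mono real_sqrt_le_mono) auto
  finally show ?thesis .
qed

definition joint_block ::
    "(nat \<times> 'a) operator \<Rightarrow> (nat \<times> 'b) operator \<Rightarrow> nat \<times> nat \<Rightarrow> nat \<times> nat \<Rightarrow> ('a \<times> 'b) operator" where
  "joint_block A B p q = tensor_op (block A (fst p) (snd p)) (block B (fst q) (snd q))"

text \<open>The coordinates \<open>r\<close> of \<open>\<alpha> i l\<close> and \<open>\<phi> i l\<close> are matrices in \<open>i, l\<close>. The sum over \<open>p, q\<close> is the sum over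
  \<open>r\<close> of the bilinear form at \<open>\<alpha>\<^sup>*, \<phi>\<close>, which is used for \<open>c1\<close>, and also at \<open>\<alpha>, \<phi>\<^sup>*\<close>, which is used for \<open>c2\<close>.\<close>

lemma entangled_vector_le:
  assumes herm: "hermitian_coeff c"
    and bound: "\<And>l xs. 0 \<le> l \<Longrightarrow> (\<And>\<xi> b. (\<xi>, b) \<in> set xs \<Longrightarrow> b \<in> hermitian_contractions m) \<Longrightarrow>
      (\<And>v. (\<Sum>(\<xi>, b)\<leftarrow>xs. (cmod (dot n v \<xi>))\<^sup>2) \<le> l * sq_norm n v) \<Longrightarrow>
      (\<Sum>(\<xi>, b)\<leftarrow>xs. Re (bilin n m c (rank1 \<xi> \<xi>) b)) \<le> \<beta> * l"
    and A: "selfadjoint_contraction ({..<n} \<times> X) A" and B: "selfadjoint_contraction ({..<m} \<times> Y) B"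
    and \<psi>: "\<psi> \<in> ell2 (X \<times> Y)"
  shows "cmod (\<Sum>p\<in>square n. \<Sum>q\<in>square m. c p q * ell2_inner (X \<times> Y) \<psi> (joint_block A B p q \<psi>))
    \<le> 6 * \<beta> * nsq (X \<times> Y) \<psi>"
proof -
  obtain R Q Q' c1 c2 where
    psd: "psd_form {..<n} R" "psd_form {..<m} Q" "psd_form {..<m} Q'" and
    tr: "trace_form n R \<le> \<beta>" "trace_form m Q \<le> 8 * \<beta>" "trace_form m Q' \<le> 8 * \<beta>" and
    c: "\<And>p q. p \<in> square n \<Longrightarrow> q \<in> square m \<Longrightarrow> c p q = c1 p q + c2 p q" and
    bd1: "\<And>a b. cmod (bilin n m c1 a b) \<le> sqrt (Re (colform n R a a)) * sqrt (Re (rowform m Q b b))" and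
    bd2: "\<And>a b. cmod (bilin n m c2 a b) \<le> sqrt (Re (rowform n R a a)) * sqrt (Re (colform m Q' b b))"
    using grothendieck_splitting[OF herm bound] by blast
  note cA = selfadjoint_contraction_contraction[OF A] and cB = selfadjoint_contraction_contraction[OF B]
  let ?Z = "X \<times> Y"
  let ?h = "\<lambda>p q. ell2_inner ?Z \<psi> (joint_block A B p q \<psi>)"
  define \<alpha> where "\<alpha> i l = left_op (block A i l) \<psi>" for i l
  define \<phi> where "\<phi> i l = right_op (block B i l) \<psi>" for i l
  have \<alpha>: "\<alpha> i l \<in> ell2 ?Z" if "i < n" "l < n" for i l
    unfolding \<alpha>_def by (rule left_op_ell2[OF block_contraction[OF cA that] \<psi>])
  have \<phi>: "\<phi> i l \<in> ell2 ?Z" if "i < m" "l < m" for i l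
    unfolding \<phi>_def by (rule right_op_ell2[OF block_contraction[OF cB that] \<psi>])
  have inner: "?h (i, j) (k, l) =
      ell2_inner ?Z (\<alpha> j i) (\<phi> k l)" "?h (i, j) (k, l) = ell2_inner ?Z (\<phi> l k) (\<alpha> i j)"
    if "i < n" "j < n" "k < m" "l < m" for i j k l
    unfolding joint_block_def \<alpha>_def \<phi>_def
    using tensor_inner[OF block_contraction[OF cA that(1,2)]
        block_contraction[OF cA that(2,1)] block_adjoint[OF A that(1,2)]
        block_contraction[OF cB that(3,4)]
            block_contraction[OF cB that(4,3)] block_adjoint[OF B that(3,4)] \<psi> \<psi>]
    by simp_all
  \<comment> \<open>The indices are swapped since \<open>block A j i\<close> is the adjoint of
    \<open>block A i j\<close>.\<close>
  define a1 where "a1 r = (\<lambda>(i, j). cnj (\<alpha> j i r))" for r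
  define b1 where "b1 r = (\<lambda>(k, l). \<phi> k l r)" for r
  define a2 where "a2 r = (\<lambda>(i, j). \<alpha> i j r)" for r
  define b2 where "b2 r = (\<lambda>(k, l). cnj (\<phi> l k r))" for r
  have sum1: "((\<lambda>r. a1 r p * b1 r q) has_sum ?h p q) ?Z" if "p \<in> square n" "q \<in> square m" for p q
  proof -
    obtain i j k l where p: "p = (i, j)" "i < n" "j < n" and q: "q = (k, l)" "k < m" "l < m"
      using \<open>p \<in> square n\<close> \<open>q \<in> square m\<close> by auto
    have "((\<lambda>r. cnj (\<alpha> j i r) * \<phi> k l r) has_sum ell2_inner ?Z (\<alpha> j i) (\<phi> k l)) ?Z"
      unfolding ell2_inner_def using p q by (intro has_sum_infsum ell2_inner_summable \<alpha> \<phi>)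
    moreover have "?h p q = ell2_inner ?Z (\<alpha> j i) (\<phi> k l)"
      unfolding p(1) q(1) using inner(1) p q by simp
    ultimately show ?thesis
      by (simp only: a1_def b1_def p(1) q(1) prod.case)
  qed
  have sum2: "((\<lambda>r. a2 r p * b2 r q) has_sum ?h p q) ?Z" if "p \<in> square n" "q \<in> square m" for p q
  proof -
    obtain i j k l where p: "p = (i, j)" "i < n" "j < n" and q: "q = (k, l)" "k < m" "l < m"
      using \<open>p \<in> square n\<close> \<open>q \<in> square m\<close> by auto
    have "((\<lambda>r. cnj (\<phi> l k r) * \<alpha> i j r) has_sum ell2_inner ?Z (\<phi> l k) (\<alpha> i j)) ?Z"
      unfolding ell2_inner_def using p q by (intro has_sum_infsum ell2_inner_summable \<alpha> \<phi>)
    moreover have "?h p q = ell2_inner ?Z (\<phi> l k) (\<alpha> i j)"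
      unfolding p(1) q(1) using inner(2) p q by simp
    ultimately show ?thesis
      by (simp only: a2_def b2_def p(1) q(1) prod.case mult.commute)
  qed
  define M where "M = nsq ?Z \<psi>"
  have M: "0 \<le> M"
    unfolding M_def by (rule nsq_nonneg)
  have \<beta>: "0 \<le> \<beta>"
    by (rule order_trans[OF _ tr(1)]) (simp add: trace_form_def sum_nonneg psd_form.nonneg[OF psd(1)])
  have colrow_nn: "0 \<le> Re (colform k T x x)" "0 \<le> Re (rowform k T x x)" if "psd_form {..<k} T" for k T x
    using psd_form.nonneg[OF psd_form_colform[OF that]]
        psd_form.nonneg[OF psd_form_rowform[OF that]] by auto
  have A_le: "infsum g ?Z \<le> \<beta> * M" if "infsum g ?Z \<le> trace_form n R * nsq ?Z \<psi>" for g :: "_ \<Rightarrow> real"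
    using that mult_right_mono[OF tr(1) M] by (simp add: M_def)
  have B_le: "infsum g ?Z \<le> 8 * \<beta> * M" if "infsum g ?Z \<le>
      t * nsq ?Z \<psi>" "t \<le> 8 * \<beta>" for g :: "_ \<Rightarrow> real" and t
    using that(1) mult_right_mono[OF that(2) M] by (simp add: M_def)
  have "cmod (\<Sum>p\<in>square n. \<Sum>q\<in>square m. c1 p q * ?h p q) \<le> sqrt (\<beta> * M) * sqrt (8 * \<beta> * M)"
  proof (rule bilin_sum_le[OF bd1 colrow_nn(1)[OF psd(1)] colrow_nn(2)[OF psd(2)] sum1])
    \<comment> \<open>Columns of the conjugate transpose on Alice's side and rows on Bob's side
      produce the same shape, namely conjugated rows of blocks, which \<open>left_form_sum\<close>
      and \<open>right_form_sum\<close> control.\<close>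
    have e: "(\<lambda>r. Re (colform n R (a1 r) (a1 r))) =
        (\<lambda>r. \<Sum>i<n. Re (R (\<lambda>l. cnj (left_op (block A i l) \<psi> r)) (\<lambda>l. cnj (left_op (block A i l) \<psi> r))))"
      by (simp add: colform_def a1_def \<alpha>_def)
    show "(\<lambda>r. Re (colform n R (a1 r) (a1 r)))
        summable_on ?Z" "infsum (\<lambda>r. Re (colform n R (a1 r) (a1 r))) ?Z \<le> \<beta> * M"
      unfolding e using left_form_sum[OF cA psd(1) \<psi>] by (auto intro!: A_le)
    have e: "(\<lambda>r. Re (rowform m Q (b1 r) (b1 r))) =
        (\<lambda>r. \<Sum>i<m. Re (Q (\<lambda>l. cnj (right_op (block B i l) \<psi> r)) (\<lambda>l. cnj (right_op (block B i l) \<psi> r))))"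
      by (simp add: rowform_def b1_def \<phi>_def)
    show "(\<lambda>r. Re (rowform m Q (b1 r) (b1 r)))
        summable_on ?Z" "infsum (\<lambda>r. Re (rowform m Q (b1 r) (b1 r))) ?Z \<le> 8 * \<beta> * M"
      unfolding e using right_form_sum[OF cB psd(2) \<psi>] tr(2) by (auto intro!: B_le)
  qed
  moreover have "cmod (\<Sum>p\<in>square n. \<Sum>q\<in>square m. c2 p q * ?h p q) \<le> sqrt (\<beta> * M) * sqrt (8 * \<beta> * M)"
  proof (rule bilin_sum_le[OF bd2 colrow_nn(2)[OF psd(1)] colrow_nn(1)[OF psd(3)] sum2])
    have e: "(\<lambda>r. Re (rowform n R (a2 r) (a2 r))) =
        (\<lambda>r. \<Sum>i<n. Re (R (\<lambda>l. cnj (left_op (block A i l) \<psi> r)) (\<lambda>l. cnj (left_op (block A i l) \<psi> r))))"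
      by (simp add: rowform_def a2_def \<alpha>_def)
    show "(\<lambda>r. Re (rowform n R (a2 r) (a2 r)))
        summable_on ?Z" "infsum (\<lambda>r. Re (rowform n R (a2 r) (a2 r))) ?Z \<le> \<beta> * M"
      unfolding e using left_form_sum[OF cA psd(1) \<psi>] by (auto intro!: A_le)
    have e: "(\<lambda>r. Re (colform m Q' (b2 r) (b2 r))) =
        (\<lambda>r. \<Sum>i<m. Re (Q' (\<lambda>l. cnj (right_op (block B i l) \<psi> r)) (\<lambda>l. cnj (right_op (block B i l) \<psi> r))))"
      by (simp add: colform_def b2_def \<phi>_def)
    show "(\<lambda>r. Re (colform m Q' (b2 r) (b2 r)))
        summable_on ?Z" "infsum (\<lambda>r. Re (colform m Q' (b2 r) (b2 r))) ?Z \<le> 8 * \<beta> * M"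
      unfolding e using right_form_sum[OF cB psd(3) \<psi>] tr(3) by (auto intro!: B_le)
  qed
  moreover have "(\<Sum>p\<in>square n. \<Sum>q\<in>square m. c p q * ?h p q) =
      (\<Sum>p\<in>square n. \<Sum>q\<in>square m. c1 p q * ?h p q) + (\<Sum>p\<in>square n. \<Sum>q\<in>square m. c2 p q * ?h p q)"
    unfolding sum.distrib[symmetric] distrib_right[symmetric] by (intro sum.cong refl) (simp only: c)
  then have "cmod (\<Sum>p\<in>square n. \<Sum>q\<in>square m. c p q * ?h p q) \<le>
      cmod (\<Sum>p\<in>square n. \<Sum>q\<in>square m. c1 p q * ?h p q) + cmod (\<Sum>p\<in>square n. \<Sum>q\<in>square m. c2 p q * ?h p q)"
    by (simp only: norm_triangle_ineq)
  ultimately have "cmod (\<Sum>p\<in>square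
      n. \<Sum>q\<in>square m. c p q * ?h p q) \<le> 2 * (sqrt (\<beta> * M) * sqrt (8 * \<beta> * M))"
    by linarith
  also have "\<dots> \<le> 2 * (3 * (\<beta> * M))"
  proof -
    \<comment> \<open>\<open>8 \<le> 3\<^sup>2\<close>; the two parts of the form together give the
      constant 6.\<close>
    have "sqrt (\<beta> * M) * sqrt (8 * \<beta> * M) \<le> sqrt ((3 * (\<beta> * M))\<^sup>2)"
      unfolding real_sqrt_mult[symmetric] using \<beta> M
      by (intro real_sqrt_le_mono) (simp add: power2_eq_square algebra_simps)
    also have "\<dots> = 3 * (\<beta> * M)"
      using \<beta> M by (intro real_sqrt_abs[THEN trans]) simp
    finally show ?thesis
      by (rule mult_left_mono) simp
  qed
  finally show ?thesis
    by (simp add: M_def algebra_simps)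
qed

subsection \<open>Decomposition of states\<close>

lemma ell2_inner_add_right:
  assumes "u \<in> ell2 X" "v \<in> ell2 X" "w \<in> ell2 X"
  shows "ell2_inner X u (\<lambda>x. v x + w x) = ell2_inner X u v + ell2_inner X u w"
  unfolding ell2_inner_def distrib_left using assms by (intro infsum_add ell2_inner_summable)

lemma ell2_inner_add_left:
  assumes "u \<in> ell2 X" "v \<in> ell2 X" "w \<in> ell2 X"
  shows "ell2_inner X (\<lambda>x. v x + w x) u = ell2_inner X v u + ell2_inner X w u"
  using ell2_inner_add_right[OF assms] ell2_inner_cnj[of X _ u] by (metis complex_cnj_add)

lemma ell2_inner_scale_right: "ell2_inner X u (\<lambda>x. c * v x) = c * ell2_inner X u v"
  unfolding ell2_inner_def by (simp add: mult.left_commute flip: infsum_cmult_right')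

lemma ell2_inner_scale_left: "ell2_inner X (\<lambda>x. c * v x) u = cnj c * ell2_inner X v u"
  unfolding ell2_inner_def by (simp add: mult.assoc flip: infsum_cmult_right')

text \<open>Polarization with \<open>u + c w\<close> for \<open>c = 1\<close> and \<open>c = \<i>\<close>.\<close>

lemma positive_op_hermitian:
  assumes T: "positive_op X T" and u: "u \<in> ell2 X" and w: "w \<in> ell2 X"
  shows "ell2_inner X u (T w) = cnj (ell2_inner X w (T u))"
proof -
  have lin: "linear_op X T"
    using T by (simp add: positive_op_def bounded_op_def)
  have real: "Im (ell2_inner X v (T v)) = 0" if "v \<in> ell2 X" for v
    using T that nonneg_Reals_subset_Reals complex_is_Real_iff unfolding positive_op_def by blast
  note Tu = linear_op_ell2[OF lin u] and Tw = linear_op_ell2[OF lin w]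
  have "Im (c * ell2_inner X u (T w) + cnj c * ell2_inner X w (T u)) = 0" for c
  proof -
    note cw = ell2_scale[OF w, of c]
    have "ell2_inner X (\<lambda>x. u x + c * w x) (T (\<lambda>x. u x + c * w x)) =
        ell2_inner X u (T u) + (cnj c * c) * ell2_inner X w (T w) +
        (c * ell2_inner X u (T w) + cnj c * ell2_inner X w (T u))"
      using linear_op_add[OF lin u cw] linear_op_scale[OF lin w]
      by (simp add: ell2_inner_add_right ell2_inner_add_left ell2_inner_scale_left ell2_inner_scale_right
        Tu Tw u cw ell2_scale ell2_add algebra_simps)
    moreover have "cnj c * c = complex_of_real ((cmod c)\<^sup>2)"
      unfolding complex_norm_square by (simp add: mult.commute)
    ultimately show ?thesis
      using real[OF ell2_add[OF u cw]] real[OF u] real[OF w] by simp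
  qed
  from this[of 1] this[of \<i>] show ?thesis
    by (simp add: complex_eq_iff)
qed

section \<open>Positive kernels and their Schur complements\<close>

definition psd_kernel :: "('a \<Rightarrow> 'a \<Rightarrow> complex) \<Rightarrow> bool" where
  "psd_kernel K \<longleftrightarrow> (\<forall>F. finite F \<longrightarrow> psd_form F (\<lambda>u v. \<Sum>x\<in>F. \<Sum>y\<in>F. cnj (u x) * K x y * v y))"

lemma psd_kernelD:
  "psd_kernel K \<Longrightarrow> finite F \<Longrightarrow> psd_form F (\<lambda>u v. \<Sum>x\<in>F. \<Sum>y\<in>F. cnj (u x) * K x y * v y)"
  unfolding psd_kernel_def by (drule spec, drule mp)

lemma psd_kernelI:
  assumes sym: "\<And>x y. K y x = cnj (K x y)"
    and nonneg: "\<And>F v. finite F \<Longrightarrow> 0 \<le> Re (\<Sum>x\<in>F. \<Sum>y\<in>F. cnj (v x) * K x y * v y)"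
  shows "psd_kernel K"
  unfolding psd_kernel_def
proof (intro allI impI)
  fix F :: "'a set" assume F: "finite F"
  show "psd_form F (\<lambda>u v. \<Sum>x\<in>F. \<Sum>y\<in>F. cnj (u x) * K x y * v y)"
  proof
    show "linear_fun F (\<lambda>v. \<Sum>x\<in>F. \<Sum>y\<in>F. cnj (u x) * K x y * v y)" for u
    proof -
      have "linear_fun F (\<lambda>v. \<Sum>x\<in>F. cnj (u x) * (\<Sum>y\<in>F. K x y * v y))"
        by (intro linear_fun_linear_combination linear_fun_coords subset_refl)
      then show ?thesis
        by (simp add: sum_distrib_left mult.assoc)
    qed
    show "(\<Sum>x\<in>F. \<Sum>y\<in>F. cnj (v x) * K x y * u y) = cnj (\<Sum>x\<in>F. \<Sum>y\<in>F. cnj (u x) * K x y * v y)" for u v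
      by (subst sum.swap) (simp add: sym[symmetric] mult.commute mult.left_commute)
    show "0 \<le> Re (\<Sum>x\<in>F. \<Sum>y\<in>F. cnj (v x) * K x y * v y)" for v
      by (rule nonneg[OF F])
  qed (rule F)
qed

lemma psd_kernel_form_ket:
  assumes "finite F" "x \<in> F"
  shows "(\<Sum>x'\<in>F. \<Sum>y\<in>F. cnj (ket x x') * K x' y * v y) = (\<Sum>y\<in>F. K x y * v y :: complex)"
proof -
  have "(\<Sum>x'\<in>F. \<Sum>y\<in>F. cnj (ket x x') * K x' y * v y) = (\<Sum>x'\<in>F. ket x x' * (\<Sum>y\<in>F. K x' y * v y))"
    by (simp add: sum_distrib_left mult.assoc)
  then show ?thesis
    by (simp add: sum_ket_mult assms)
qed

lemma psd_kernel_sym: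
  assumes "psd_kernel K"
  shows "K y x = cnj (K x y)"
proof -
  have F: "finite {x, y}"
    by simp
  interpret psd_form "{x, y}" "\<lambda>u v. \<Sum>a\<in>{x, y}. \<Sum>b\<in>{x, y}. cnj (u a) * K a b * v b"
    by (rule psd_kernelD[OF assms F])
  have e: "(\<Sum>a\<in>{x, y}. \<Sum>b\<in>{x, y}. cnj (ket i a) * K a b * ket j b) = K i j" if "i \<in> {x, y}" "j \<in> {x, y}"
      for i j
    unfolding psd_kernel_form_ket[OF F that(1)] by (rule sum_mult_ket[OF F that(2)])
  show ?thesis
    using sym[of "ket y" "ket x"] by (simp only: e insertI1 insertI2 singletonI)
qed

text \<open>Cauchy-Schwarz between \<open>ket e\<close> and \<open>v\<close>. As \<open>e\<close>
  may lie outside \<open>F\<close>, it is applied on \<open>insert e F\<close> with \<open>v\<close>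
  cut off to \<open>F\<close>.\<close>

lemma psd_kernel_cauchy_schwarz:
  assumes K: "psd_kernel K" and F: "finite F"
  shows "(cmod (\<Sum>y\<in>F. K e y * v y))\<^sup>2 \<le> Re (K e e) * Re (\<Sum>x\<in>F. \<Sum>y\<in>F. cnj (v x) * K x y * v y)"
proof -
  let ?G = "insert e F"
  have G: "finite ?G" "e \<in> ?G"
    using F by auto
  interpret psd_form ?G "\<lambda>u v. \<Sum>x\<in>?G. \<Sum>y\<in>?G. cnj (u x) * K x y * v y"
    by (rule psd_kernelD[OF K G(1)])
  define w where "w = (\<lambda>x. if x \<in> F then v x else 0)"
  have 1: "(\<Sum>x\<in>?G. \<Sum>y\<in>?G. cnj (ket e x) * K x y * w y) = (\<Sum>y\<in>F. K e y * v y)"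
    unfolding psd_kernel_form_ket[OF G]
    by (rule sum.mono_neutral_cong_right) (use F in \<open>auto simp: w_def\<close>)
  have 2: "(\<Sum>x\<in>?G. \<Sum>y\<in>?G. cnj (ket e x) * K x y * ket e y) = K e e"
    unfolding psd_kernel_form_ket[OF G] by (rule sum_mult_ket[OF G])
  have inner: "(\<Sum>y\<in>?G. cnj (w x) * K x y * w y) = (\<Sum>y\<in>F. cnj (w x) * K x y * v y)" for x
    by (rule sum.mono_neutral_cong_right) (use F in \<open>auto simp: w_def\<close>)
  have 3: "(\<Sum>x\<in>?G. \<Sum>y\<in>?G. cnj (w x) * K x y * w y) = (\<Sum>x\<in>F. \<Sum>y\<in>F. cnj (v x) * K x y * v y)"
    unfolding inner by (rule sum.mono_neutral_cong_right) (use F in \<open>auto simp: w_def\<close>)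
  show ?thesis
    using cauchy_schwarz[of "ket e" w] by (simp only: 1 2 3)
qed

lemma psd_kernel_diag:
  assumes K: "psd_kernel K"
  shows "0 \<le> Re (K e e)" "K e e = complex_of_real (Re (K e e))" "Re (K e e) = 0 \<Longrightarrow> K x e = 0"
proof -
  show nn: "0 \<le> Re (K e e)" for e
  proof -
    have "psd_form {e} (\<lambda>u v. \<Sum>x\<in>{e}. \<Sum>y\<in>{e}. cnj (u x) * K x y * v y)"
      by (rule psd_kernelD[OF K]) simp
    from psd_form.nonneg[OF this, of "\<lambda>_. 1"] show ?thesis
      by simp
  qed
  show "K e e = complex_of_real (Re (K e e))"
    using psd_kernel_sym[OF K, of e e] by (metis Reals_cnj_iff of_real_Re)
  show "K x e = 0" if "Re (K e e) = 0"
    using psd_kernel_cauchy_schwarz[OF K, of "{e}" x "\<lambda>_. 1"] that by simp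
qed

text \<open>The Cholesky column at \<open>e\<close>. For a zero diagonal entry the division gives 0,
  which is the right value because the whole column is then 0.\<close>

definition pivot :: "'a \<Rightarrow> ('a \<Rightarrow> 'a \<Rightarrow> complex) \<Rightarrow> 'a \<Rightarrow> complex" where
  "pivot e K x = K x e / complex_of_real (sqrt (Re (K e e)))"

definition schur :: "'a \<Rightarrow> ('a \<Rightarrow> 'a \<Rightarrow> complex) \<Rightarrow> 'a \<Rightarrow> 'a \<Rightarrow> complex" where
  "schur e K x y = K x y - pivot e K x * cnj (pivot e K y)"

text \<open>The subtracted form takes the value \<open>|S|^2 / K e e\<close>, which is at most the
  form of \<open>K\<close> by Cauchy-Schwarz.\<close>

lemma psd_kernel_schur:
  assumes K: "psd_kernel K"
  shows "psd_kernel (schur e K)"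
proof (rule psd_kernelI)
  show "schur e K y x = cnj (schur e K x y)" for x y
    by (simp add: schur_def psd_kernel_sym[OF K, of y x] mult.commute)
  fix F :: "'a set" and v :: "'a \<Rightarrow> complex" assume F: "finite F"
  define S where "S = (\<Sum>y\<in>F. K e y * v y)"
  define d where "d = Re (K e e)"
  have d: "0 \<le> d"
    unfolding d_def by (rule psd_kernel_diag(1)[OF K])
  have cS: "(\<Sum>x\<in>F. cnj (v x) * K x e) = cnj S"
    unfolding S_def cnj_sum by (intro sum.cong refl) (simp add: psd_kernel_sym[OF K, of _ e] mult.commute)
  have piv: "(\<Sum>x\<in>F. cnj (v x) * pivot e K x) = cnj S / complex_of_real (sqrt d)"
    by (simp add: pivot_def d_def cS flip: sum_divide_distrib)
  have piv': "(\<Sum>y\<in>F. cnj (pivot e K y) * v y) = cnj (\<Sum>x\<in>F. cnj (v x) * pivot e K x)"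
    by (simp add: mult.commute)
  have "(\<Sum>x\<in>F. \<Sum>y\<in>F. cnj (v x) * schur e K x y * v y) = (\<Sum>x\<in>F. \<Sum>y\<in>F. cnj (v x) * K x y * v y) -
      (\<Sum>x\<in>F. cnj (v x) * pivot e K x) * (\<Sum>y\<in>F. cnj (pivot e K y) * v y)"
    unfolding sum_product sum_subtractf[symmetric]
    by (intro sum.cong refl) (simp add: schur_def algebra_simps)
  then have "(\<Sum>x\<in>F. \<Sum>y\<in>F. cnj (v x) * schur e K x y * v y) =
      (\<Sum>x\<in>F. \<Sum>y\<in>F. cnj (v x) * K x y * v y) -
          (cnj S / complex_of_real (sqrt d)) * cnj (cnj S / complex_of_real (sqrt d))"
    unfolding piv' piv .
  also have "(cnj S / complex_of_real (sqrt d)) *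
      cnj (cnj S / complex_of_real (sqrt d)) = complex_of_real ((cmod S)\<^sup>2 / d)"
    unfolding complex_norm_square[symmetric] using d by (simp add: norm_divide power_divide)
  finally have eq: "Re (\<Sum>x\<in>F. \<Sum>y\<in>F. cnj (v x) * schur e K x y * v y) =
      Re (\<Sum>x\<in>F. \<Sum>y\<in>F. cnj (v x) * K x y * v y) - (cmod S)\<^sup>2 / d"
    by simp
  have cs: "(cmod S)\<^sup>2 \<le> d * Re (\<Sum>x\<in>F. \<Sum>y\<in>F. cnj (v x) * K x y * v y)"
    unfolding S_def d_def by (rule psd_kernel_cauchy_schwarz[OF K F])
  have "0 \<le> Re (\<Sum>x\<in>F. \<Sum>y\<in>F. cnj (v x) * K x y * v y)"
    by (rule psd_form.nonneg[OF psd_kernelD[OF K F]])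
  then show "0 \<le> Re (\<Sum>x\<in>F. \<Sum>y\<in>F. cnj (v x) * schur e K x y * v y)"
    unfolding eq using cs d by (cases "d = 0") (auto simp: divide_le_eq mult.commute)
qed

lemma schur_pivot_column:
  assumes K: "psd_kernel K"
  shows "schur e K x e = 0"
proof (cases "Re (K e e) = 0")
  case True
  then show ?thesis
    using psd_kernel_diag(3)[OF K True, of x] by (simp add: schur_def pivot_def)
next
  case False
  then have d: "0 < Re (K e e)"
    using psd_kernel_diag(1)[OF K, of e] by linarith
  define r where "r = Re (K e e)"
  have "K e e = complex_of_real r"
      "complex_of_real (sqrt r) * complex_of_real (sqrt r) = complex_of_real r"
    using psd_kernel_diag(2)[OF K, of e] d by (simp_all add: r_def flip: of_real_mult)
  then show ?thesis
    using d by (simp add: schur_def pivot_def r_def[symmetric] field_simps)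
qed

text \<open>A column that has been cleared stays cleared under later complements.\<close>

lemma schur_column_zero: "(\<And>x. K x y = 0) \<Longrightarrow> K y e = 0 \<Longrightarrow> schur e K x y = 0"
  by (simp add: schur_def pivot_def)

text \<open>Cholesky decomposition of an infinite matrix: the Schur complements are taken successively at
  all indices.\<close>

lemma psd_kernel_decomposition:
  fixes K :: "'a :: countable \<Rightarrow> 'a \<Rightarrow> complex"
  assumes K: "psd_kernel K"
  obtains v :: "nat \<Rightarrow> 'a \<Rightarrow> complex" where
    "\<And>x y. K x y = (\<Sum>s\<le>to_nat y. v s x * cnj (v s y))"
    "\<And>s x. to_nat x < s \<Longrightarrow> v s x = 0"
    "\<And>s x. (cmod (v s x))\<^sup>2 \<le> Re (K x x)"
    "\<And>s x. K x x = 0 \<Longrightarrow> v s x = 0"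
proof -
  \<comment> \<open>\<open>from_nat\<close> is total, so a number that encodes no index may pivot at
    an arbitrary one. This is harmless: a complement at any index preserves positivity and cleared
    columns.\<close>
  define L where "L = rec_nat K (\<lambda>s. schur (from_nat s))"
  have L: "L 0 = K" "L (Suc s) = schur (from_nat s) (L s)" for s
    by (simp_all add: L_def)
  define v where "v s = pivot (from_nat s) (L s)" for s
  have psd: "psd_kernel (L s)" for s
    by (induction s) (simp_all add: L K psd_kernel_schur)
  have L_eq: "L s x y = K x y - (\<Sum>r<s. v r x * cnj (v r y))" for s x y
    by (induction s) (simp_all add: L schur_def v_def)
  have zero: "L s x (from_nat r) = 0" if "r < s" for r s x
    using that
  proof (induction s arbitrary: x)
    case (Suc s)
    show ?case
    proof (cases "r = s")
      case True
      then show ?thesis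
        by (simp add: L schur_pivot_column[OF psd])
    next
      case False
      with Suc have col: "L s x (from_nat r) = 0" for x
        by simp
      moreover have "L s (from_nat r) (from_nat s) = 0"
        using psd_kernel_sym[OF psd, of s "from_nat r" "from_nat s"] col by simp
      ultimately show ?thesis
        unfolding L by (intro schur_column_zero)
    qed
  qed simp
  have zero': "L s x y = 0" if "to_nat y < s" for s x y
    using zero[OF that, of x] by simp
  \<comment> \<open>The column of \<open>y\<close> is cleared by the step numbered
    \<open>to_nat y\<close>, so the decomposition is a finite sum in each column.\<close>
  have dec: "K x y = (\<Sum>s\<le>to_nat y. v s x * cnj (v s y))" for x y
    using L_eq[of "Suc (to_nat y)" x y] zero'[of y "Suc (to_nat y)" x] by (simp add: lessThan_Suc_atMost)
  have vz: "v s x = 0" if "to_nat x < s" for s x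
    using psd_kernel_sym[OF psd, of s x "from_nat s"] zero'[OF that, of "from_nat s"]
    by (simp add: v_def pivot_def)
  have le: "(cmod (v s x))\<^sup>2 \<le> Re (K x x)" for s x
  proof -
    have "L (Suc s) x x = L s x x - complex_of_real ((cmod (v s x))\<^sup>2)"
      unfolding complex_norm_square by (simp add: L schur_def v_def)
    then have "(cmod (v s x))\<^sup>2 \<le> Re (L s x x)"
      using psd_kernel_diag(1)[OF psd, of "Suc s" x] by simp
    also have "\<dots> \<le> Re (K x x)"
    proof -
      have "Re (v r x * cnj (v r x)) \<ge> 0" for r
        by simp
      then show ?thesis
        unfolding L_eq minus_complex.sel Re_sum by (simp add: sum_nonneg)
    qed
    finally show ?thesis .
  qed
  have "v s x = 0" if "K x x = 0" for s x
    using le[of s x] that by simp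
  with dec vz le show thesis
    using that by blast
qed

lemma linear_op_expand_finite:
  assumes T: "linear_op X T" and F: "finite F" "F \<subseteq> X"
  shows "T (\<lambda>x. if x \<in> F then v x else 0) = (\<lambda>x. \<Sum>y\<in>F. v y * T (ket y) x)"
proof -
  have "(\<lambda>x. if x \<in> F then v x else 0) = (\<lambda>x. \<Sum>y\<in>F. v y * ket y x)"
  proof
    fix x
    have "(\<Sum>y\<in>F. v y * ket y x) = (\<Sum>y\<in>F. if y = x then v y else 0)"
      by (intro sum.cong refl) (simp add: ket_def)
    then show "(if x \<in> F then v x else 0) = (\<Sum>y\<in>F. v y * ket y x)"
      using F by simp
  qed
  moreover have "T (\<lambda>x. \<Sum>y\<in>F. v y * ket y x) = (\<lambda>x. \<Sum>y\<in>F. v y * T (ket y) x)"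
    by (rule linear_op_sum[where F = F and z = ket and c = v, OF T], rule ket_ell2, use F(2) in auto)
  ultimately show ?thesis
    by (simp only:)
qed

lemma psd_kernel_positive_op:
  assumes T: "positive_op X T"
  shows "psd_kernel (\<lambda>x y. if x \<in> X \<and> y \<in> X then T (ket y) x else 0)" (is "psd_kernel ?K")
proof (rule psd_kernelI)
  have lin: "linear_op X T"
    using T by (simp add: positive_op_def bounded_op_def)
  show "?K y x = cnj (?K x y)" for x y
    using positive_op_hermitian[OF T ket_ell2 ket_ell2, of y x] by (auto simp: ell2_inner_ket)
  fix F :: "'a set" and v :: "'a \<Rightarrow> complex" assume F: "finite F"
  define w where "w = (\<lambda>x. if x \<in> F \<inter> X then v x else 0)"
  have w: "w \<in> ell2 X"
  proof -
    have "(\<lambda>x. (cmod (w x))\<^sup>2) summable_on X \<longleftrightarrow> (\<lambda>x. (cmod (w x))\<^sup>2) summable_on (F \<inter> X)"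
      by (rule summable_on_cong_neutral) (auto simp: w_def)
    then show ?thesis
      using F by (auto simp: ell2_def w_def)
  qed
  have Tw: "T w = (\<lambda>x. \<Sum>y\<in>F \<inter> X. v y * T (ket y) x)"
    unfolding w_def by (rule linear_op_expand_finite[OF lin]) (use F in auto)
  have "ell2_inner X w (T w) = (\<Sum>x\<in>F \<inter> X. cnj (v x) * T w x)"
  proof -
    have "ell2_inner X w (T w) = infsum (\<lambda>x. cnj (v x) * T w x) (F \<inter> X)"
      unfolding ell2_inner_def by (rule infsum_cong_neutral) (auto simp: w_def)
    then show ?thesis
      using F by simp
  qed
  also have "\<dots> = (\<Sum>x\<in>F. \<Sum>y\<in>F. cnj (v x) * ?K x y * v y)"
  proof (rule sum.mono_neutral_cong_left)
    show "cnj (v x) * T w x = (\<Sum>y\<in>F. cnj (v x) * ?K x y * v y)" if "x \<in> F \<inter> X" for x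
      unfolding Tw sum_distrib_left
      by (rule sum.mono_neutral_cong_left) (use F that in auto)
  qed (use F in auto)
  finally have eq: "ell2_inner X w (T w) = (\<Sum>x\<in>F. \<Sum>y\<in>F. cnj (v x) * ?K x y * v y)" .
  have "ell2_inner X w (T w) \<in> \<real>\<^sub>\<ge>\<^sub>0"
    using T w by (simp add: positive_op_def)
  then show "0 \<le> Re (\<Sum>x\<in>F. \<Sum>y\<in>F. cnj (v x) * ?K x y * v y)"
    unfolding eq[symmetric] complex_nonneg_Reals_iff by simp
qed

section \<open>Mixed states as sums of vector states\<close>

lemma op_trace_eq: "op_trace X T = (\<Sum>\<^sub>\<infinity>x\<in>X. T (ket x) x)"
  unfolding op_trace_def by (rule infsum_cong) (rule ell2_inner_ket)

lemma quantum_state_diag: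
  assumes "quantum_state X \<rho>"
  shows "((\<lambda>x. Re (\<rho> (ket x) x)) has_sum 1) X" "x \<in> X \<Longrightarrow> \<rho> (ket x) x = complex_of_real (Re (\<rho> (ket x) x))"
    "x \<in> X \<Longrightarrow> 0 \<le> Re (\<rho> (ket x) x)"
proof -
  have pos: "positive_op X \<rho>" and tr: "op_trace X \<rho> = 1"
    using assms by (auto simp: quantum_state_def)
  have "(\<lambda>x. \<rho> (ket x) x) summable_on X"
    using tr infsum_not_exists[of "\<lambda>x. \<rho> (ket x) x" X] unfolding op_trace_eq by fastforce
  then have "((\<lambda>x. \<rho> (ket x) x) has_sum 1) X"
    using tr has_sum_infsum unfolding op_trace_eq by fastforce
  then show "((\<lambda>x. Re (\<rho> (ket x) x)) has_sum 1) X"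
    using has_sum_Re by fastforce
  show "\<rho> (ket x) x = complex_of_real (Re (\<rho> (ket x) x))" "0 \<le> Re (\<rho> (ket x) x)" if "x \<in> X"
    using psd_kernel_diag(1,2)[OF psd_kernel_positive_op[OF pos], of x] that by auto
qed

text \<open>The Cholesky decomposition replaces the spectral theorem, and each
  \<open>\<rho> (ket x)\<close> is a finite combination of the \<open>v s\<close>, so linear
  operators can be applied to it without a convergence argument.\<close>

lemma state_decomposition:
  fixes X :: "'a :: countable set"
  assumes \<rho>: "quantum_state X \<rho>"
  obtains v :: "nat \<Rightarrow> 'a vector" where
    "\<And>s. v s \<in> ell2 X" "((\<lambda>s. nsq X (v s)) has_sum 1) UNIV"
    "\<And>x. x \<in> X \<Longrightarrow> \<rho> (ket x) = (\<lambda>y. \<Sum>s\<le>to_nat x. cnj (v s x) * v s y)"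
    "\<And>s x. to_nat x < s \<Longrightarrow> v s x = 0"
proof -
  have pos: "positive_op X \<rho>"
    using \<rho> by (simp add: quantum_state_def)
  then have lin: "linear_op X \<rho>"
    by (simp add: positive_op_def bounded_op_def)
  define K where "K x y = (if x \<in> X \<and> y \<in> X then \<rho> (ket y) x else 0)" for x y
  have "psd_kernel K"
    using psd_kernel_positive_op[OF pos] by (simp add: K_def[abs_def])
  then obtain v :: "nat \<Rightarrow> 'a \<Rightarrow> complex" where
    dec: "\<And>x y. K x y = (\<Sum>s\<le>to_nat y. v s x * cnj (v s y))" and
    vz: "\<And>s x. to_nat x < s \<Longrightarrow> v s x = 0" and
    le: "\<And>s x. (cmod (v s x))\<^sup>2 \<le> Re (K x x)" and
    vK: "\<And>s x. K x x = 0 \<Longrightarrow> v s x = 0"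
    using psd_kernel_decomposition by blast
  note diag = quantum_state_diag[OF \<rho>]
  have out: "v s x = 0" if "x \<notin> X" for s x
    by (rule vK) (simp add: K_def that)
  have v: "v s \<in> ell2 X" for s
  proof -
    have "(\<lambda>x. (cmod (v s x))\<^sup>2) summable_on X"
    proof (rule summable_on_comparison_test)
      show "(\<lambda>x. Re (\<rho> (ket x) x)) summable_on X"
        using diag(1) by (rule has_sum_imp_summable)
      show "(cmod (v s x))\<^sup>2 \<le> Re (\<rho> (ket x) x)" if "x \<in> X" for x
        using le[of s x] that by (simp add: K_def)
    qed simp
    then show ?thesis
      using out by (simp add: ell2_def)
  qed
  have row: "((\<lambda>s. (cmod (v s x))\<^sup>2) has_sum Re (\<rho> (ket x) x)) UNIV" if "x \<in> X" for x
  proof -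
    have "Re (\<rho> (ket x) x) = Re (\<Sum>s\<le>to_nat x. v s x * cnj (v s x))"
      using dec[of x x] that by (simp add: K_def)
    also have "\<dots> = (\<Sum>s\<le>to_nat x. (cmod (v s x))\<^sup>2)"
      unfolding complex_norm_square[symmetric] by simp
    finally have "((\<lambda>s. (cmod (v s x))\<^sup>2) has_sum Re (\<rho> (ket x) x)) {..to_nat x}"
      by simp
    moreover have "((\<lambda>s. (cmod (v s x))\<^sup>2) has_sum Re (\<rho> (ket x) x)) {..to_nat x} \<longleftrightarrow>
        ((\<lambda>s. (cmod (v s x))\<^sup>2) has_sum Re (\<rho> (ket x) x)) UNIV"
      by (rule has_sum_cong_neutral) (auto simp: vz)
    ultimately show ?thesis
      by simp
  qed
  \<comment> \<open>For fixed \<open>x\<close> the squares add up to the diagonal entry of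
    \<open>\<rho>\<close>, so their total is the trace 1; Tonelli's theorem regroups them by
    \<open>s\<close>.\<close>
  have sum: "(\<lambda>(x, s). (cmod (v s x))\<^sup>2) summable_on X \<times> UNIV"
    by (rule summable_on_SigmaI[where g = "\<lambda>x. Re (\<rho> (ket x) x)"])
      (use row has_sum_imp_summable[OF diag(1)] in auto)
  then have hs: "((\<lambda>(x, s). (cmod (v s x))\<^sup>2) has_sum 1) (X \<times> UNIV)"
    by (intro has_sum_SigmaI[where g = "\<lambda>x. Re (\<rho> (ket x) x)"]) (use row diag(1) in auto)
  then have "((\<lambda>(s, x). (cmod (v s x))\<^sup>2) has_sum 1) (UNIV \<times> X)"
    by (subst (asm) has_sum_swap) (simp add: split_def)
  then have "((\<lambda>s. nsq X (v s)) has_sum 1) UNIV"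
    by (rule has_sum_SigmaD) (simp add: nsq_def ell2D[OF v])
  moreover have "\<rho> (ket x) = (\<lambda>y. \<Sum>s\<le>to_nat x. cnj (v s x) * v s y)" if "x \<in> X" for x
  proof
    fix y
    show "\<rho> (ket x) y = (\<Sum>s\<le>to_nat x. cnj (v s x) * v s y)"
    proof (cases "y \<in> X")
      case True
      then show ?thesis
        using dec[of y x] that by (simp add: K_def mult.commute)
    next
      case False
      then show ?thesis
        using ell2_outside[OF linear_op_ell2[OF lin ket_ell2[OF that]] False] by (simp add: out)
    qed
  qed
  ultimately show thesis
    using v vz that by blast
qed

text \<open>Fubini's theorem for the summands \<open>cnj (v s x) * M (v s) x\<close>. Their absolute
  values are summable: for fixed \<open>s\<close> Cauchy-Schwarz bounds them by
  \<open>nsq X (v s)\<close>, and these numbers add up to 1.\<close>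

lemma state_trace:
  fixes X :: "'a :: countable set"
  assumes v: "\<And>s. v s \<in> ell2 X" and one: "((\<lambda>s. nsq X (v s)) has_sum 1) UNIV"
    and \<rho>: "\<And>x. x \<in> X \<Longrightarrow> \<rho> (ket x) = (\<lambda>y. \<Sum>s\<le>to_nat x. cnj (v s x) * v s y)"
    and vz: "\<And>s x. to_nat x < s \<Longrightarrow> v s x = 0"
    and M: "contraction X M"
  shows "(\<lambda>s. ell2_inner X (v s) (M (v s))) summable_on UNIV"
    "((\<lambda>x. M (\<rho> (ket x)) x) has_sum (\<Sum>\<^sub>\<infinity>s. ell2_inner X (v s) (M (v s)))) X"
proof -
  define f where "f s x = cnj (v s x) * M (v s) x" for s x
  note lin = contraction_linear[OF M]
  have Mv: "M (v s) \<in> ell2 X" for s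
    by (rule linear_op_ell2[OF lin v])
  have nsum: "(\<lambda>(s, x). cmod (f s x)) summable_on UNIV \<times> X"
  proof (rule product_summable_bound(1)[OF _ _ _ one])
    fix s
    have e: "cmod (f s x) = sqrt ((cmod (v s x))\<^sup>2) * sqrt ((cmod (M (v s) x))\<^sup>2)" for x
      by (simp add: f_def norm_mult)
    show "(\<lambda>x. cmod (f s x)) summable_on X"
      unfolding e by (rule infsum_sqrt_mult_le(1)[OF ell2D[OF v] _ ell2D[OF Mv]]) simp_all
    have "infsum (\<lambda>x. cmod (f s x)) X \<le> sqrt (nsq X (v s)) * sqrt (nsq X (M (v s)))"
      unfolding e nsq_def by (rule infsum_sqrt_mult_le(2)[OF ell2D[OF v] _ ell2D[OF Mv]]) simp_all
    also have "\<dots> \<le> sqrt (nsq X (v s)) * sqrt (nsq X (v s))"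
      by (intro mult_left_mono real_sqrt_le_mono contraction_le[OF M v]) (simp add: nsq_nonneg)
    finally show "infsum (\<lambda>x. cmod (f s x)) X \<le> nsq X (v s)"
      by (simp add: nsq_nonneg)
  qed simp
  have fsum: "(\<lambda>(s, x). f s x) summable_on UNIV \<times> X"
    by (rule abs_summable_summable) (use nsum in \<open>simp add: split_def\<close>)
  have cols: "((\<lambda>x. f s x) has_sum ell2_inner X (v s) (M (v s))) X" for s
    unfolding f_def ell2_inner_def by (intro has_sum_infsum ell2_inner_summable v Mv)
  have total: "((\<lambda>s. ell2_inner X (v s) (M (v s))) has_sum infsum (\<lambda>(s, x). f s x) (UNIV \<times> X)) UNIV"
    by (rule has_sum_SigmaD[OF has_sum_infsum[OF fsum]]) (use cols in simp)
  then show "(\<lambda>s. ell2_inner X (v s) (M (v s))) summable_on UNIV"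
    by (rule has_sum_imp_summable)
  have rows: "((\<lambda>s. f s x) has_sum M (\<rho> (ket x)) x) UNIV" if "x \<in> X" for x
  proof -
    have "M (\<rho> (ket x)) x = (\<Sum>s\<le>to_nat x. f s x)"
      unfolding \<rho>[OF that] linear_op_sum[OF lin v] f_def ..
    then have "((\<lambda>s. f s x) has_sum M (\<rho> (ket x)) x) {..to_nat x}"
      by simp
    moreover have "((\<lambda>s. f s x) has_sum M (\<rho> (ket x)) x)
        {..to_nat x} \<longleftrightarrow> ((\<lambda>s. f s x) has_sum M (\<rho> (ket x)) x) UNIV"
      by (rule has_sum_cong_neutral) (auto simp: vz f_def)
    ultimately show ?thesis
      by simp
  qed
  have "((\<lambda>(x, s). f s x) has_sum infsum (\<lambda>(s, x). f s x) (UNIV \<times> X)) (X \<times> UNIV)"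
    using has_sum_infsum[OF fsum] by (subst (asm) has_sum_swap) (simp add: split_def)
  then have "((\<lambda>x. M (\<rho> (ket x)) x) has_sum infsum (\<lambda>(s, x). f s x) (UNIV \<times> X)) X"
    by (rule has_sum_SigmaD) (use rows in simp)
  then show "((\<lambda>x. M (\<rho> (ket x)) x) has_sum (\<Sum>\<^sub>\<infinity>s. ell2_inner X (v s) (M (v s)))) X"
    using infsumI[OF total] by simp
qed

subsection \<open>The value of an entangled strategy\<close>

lemma right_op_contraction:
  assumes S: "contraction Y S"
  shows "contraction (X \<times> Y) (right_op S)"
  unfolding contraction_def linear_op_def
proof (intro conjI ballI allI)
  note lin = contraction_linear[OF S]
  fix u w :: "('b \<times> 'a) vector" and a
  assume w: "w \<in> ell2 (X \<times> Y)"
  show "right_op S w \<in> ell2 (X \<times> Y)"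
    by (rule right_op_ell2[OF S w])
  show "right_op S (\<lambda>x. a * w x) = (\<lambda>x. a * right_op S w x)"
    using linear_op_scale[OF lin slice_ell2[OF w]] by (auto simp: right_op_def)
  show "nsq (X \<times> Y) (right_op S w) \<le> nsq (X \<times> Y) w"
  proof -
    have "((\<lambda>x. nsq Y (\<lambda>y. right_op S w (x, y))) has_sum nsq (X \<times> Y) (right_op S w)) X"
      by (rule nsq_slices[OF right_op_ell2[OF S w]])
    then show ?thesis
      by (rule has_sum_mono[OF _ nsq_slices[OF w]])
        (use contraction_le[OF S slice_ell2[OF w]] in \<open>simp add: right_op_def\<close>)
  qed
  assume u: "u \<in> ell2 (X \<times> Y)"
  show "right_op S (\<lambda>x. u x + w x) = (\<lambda>x. right_op S u x + right_op S w x)"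
    using linear_op_add[OF lin slice_ell2[OF u] slice_ell2[OF w]] by (auto simp: right_op_def)
qed

lemma left_op_contraction:
  assumes T: "contraction X T"
  shows "contraction (X \<times> Y) (left_op T)"
  unfolding contraction_def linear_op_def
proof (intro conjI ballI allI)
  note c = right_op_contraction[OF T, of Y]
  note lin = contraction_linear[OF c]
  fix u w :: "('a \<times> 'b) vector" and a
  assume w: "w \<in> ell2 (X \<times> Y)"
  show "left_op T w \<in> ell2 (X \<times> Y)"
    by (rule left_op_ell2[OF T w])
  have "swapv (\<lambda>x. a * w x) = (\<lambda>x. a * swapv w x)"
    by (auto simp: swapv_def)
  then show "left_op T (\<lambda>x. a * w x) = (\<lambda>x. a * left_op T w x)"
    using linear_op_scale[OF lin swapv_ell2[OF w], of a] by (auto simp: left_op_eq swapv_def)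
  show "nsq (X \<times> Y) (left_op T w) \<le> nsq (X \<times> Y) w"
    using contraction_le[OF c swapv_ell2[OF w]] by (simp add: left_op_eq nsq_swapv)
  assume u: "u \<in> ell2 (X \<times> Y)"
  have "swapv (\<lambda>x. u x + w x) = (\<lambda>x. swapv u x + swapv w x)"
    by (auto simp: swapv_def)
  then show "left_op T (\<lambda>x. u x + w x) = (\<lambda>x. left_op T u x + left_op T w x)"
    using linear_op_add[OF lin swapv_ell2[OF u] swapv_ell2[OF w]] by (auto simp: left_op_eq swapv_def)
qed

lemma contraction_compose:
  assumes S: "contraction X S" and T: "contraction X T"
  shows "contraction X (\<lambda>w. T (S w))"
proof -
  note lS = contraction_linear[OF S] and lT = contraction_linear[OF T]
  show ?thesis
    unfolding contraction_def linear_op_def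
  proof (intro conjI ballI allI)
    fix u v a assume v: "v \<in> ell2 X"
    note Sv = linear_op_ell2[OF lS v]
    show "T (S v) \<in> ell2 X"
      by (rule linear_op_ell2[OF lT Sv])
    show "T (S (\<lambda>x. a * v x)) = (\<lambda>x. a * T (S v) x)"
      by (simp only: linear_op_scale[OF lS v] linear_op_scale[OF lT Sv])
    show "nsq X (T (S v)) \<le> nsq X v"
      by (rule order_trans[OF contraction_le[OF T Sv] contraction_le[OF S v]])
    assume u: "u \<in> ell2 X"
    show "T (S (\<lambda>x. u x + v x)) = (\<lambda>x. T (S u) x + T (S v) x)"
      by (simp only: linear_op_add[OF lS u v] linear_op_add[OF lT linear_op_ell2[OF lS u] Sv])
  qed
qed

lemma joint_block_contraction:
  assumes "contraction ({..<n} \<times> X) A" "contraction ({..<m} \<times> Y) B" "p \<in> square n" "q \<in> square m"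
  shows "contraction (X \<times> Y) (joint_block A B p q)"
proof -
  have "fst p < n" "snd p < n" "fst q < m" "snd q < m"
    using assms(3,4) by auto
  then show ?thesis
    unfolding joint_block_def tensor_op_eq[abs_def]
    using contraction_compose[OF right_op_contraction[OF block_contraction[OF assms(2)]]
        left_op_contraction[OF block_contraction[OF assms(1)]]] by blast
qed

text \<open>The argument is expanded over the finite factors by \<open>embed\<close>, first inside
  \<open>B\<close>, then inside \<open>A\<close>; the reordering then only regroups indices.\<close>

lemma tensor_op_reorder:
  assumes A: "linear_op ({..<n} \<times> X) A" and B: "contraction ({..<m} \<times> Y) B"
    and g: "\<And>p. p \<notin> {..<n} \<times> {..<m} \<Longrightarrow> g p = 0" and v: "v \<in> ell2 (X \<times> Y)"
    and i: "i < n" and k: "k < m"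
  shows "reorder_op (tensor_op A B) (\<lambda>(p, z). g p * v z) ((i, k), (x, y)) =
    (\<Sum>q\<in>{..<n} \<times> {..<m}. g q * joint_block A B (i, fst q) (k, snd q) v (x, y))"
proof -
  note Blin = contraction_linear[OF B]
  note s = slice_ell2[OF v]
  define r where "r l = right_op (block B k l) v" for l
  have r: "(\<lambda>x'. r l (x', y)) \<in> ell2 X" if "l < m" for l
    using slice_ell2[OF swapv_ell2[OF right_op_ell2[OF block_contraction[OF B k that] v]], of y]
    by (simp add: r_def swapv_def)
  have inner: "B (\<lambda>(k', y'). g (i', k') * v (x', y')) (k, y) = (\<Sum>l<m. g (i', l) * r l (x', y))" for i' x'
  proof -
    have emb: "embed l (\<lambda>y'. v (x', y')) \<in> ell2 ({..<m} \<times> Y)" if "l \<in> {..<m}" for l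
      using that by (intro embed_ell2(1) s) simp
    have "(\<lambda>(k', y'). g (i', k') * v (x', y')) = (\<lambda>p. \<Sum>l<m. g (i', l) * embed l (\<lambda>y'. v (x', y')) p)"
    proof
      fix p :: "nat \<times> 'b"
      obtain k' y' where p: "p = (k', y')"
        by (cases p)
      have "(\<Sum>l<m. g (i', l) * embed l (\<lambda>y'. v (x', y')) p) =
          (\<Sum>l<m. if l = k' then g (i', k') * v (x', y') else 0)"
        by (intro sum.cong refl) (auto simp: embed_def p)
      then show "(case p of (k', y') \<Rightarrow> g (i', k') * v (x', y')) =
          (\<Sum>l<m. g (i', l) * embed l (\<lambda>y'. v (x', y')) p)"
        using g[of "(i', k')"] by (auto simp: p)
    qed
    then have "B (\<lambda>(k', y'). g (i', k') * v (x', y')) =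
        (\<lambda>p. \<Sum>l<m. g (i', l) * B (embed l (\<lambda>y'. v (x', y'))) p)"
      by (simp only: linear_op_sum[where F =
          "{..<m}" and z = "\<lambda>l. embed l (\<lambda>y'. v (x', y'))" and c = "\<lambda>l. g (i', l)", OF Blin emb])
    then show ?thesis
      by (simp add: r_def right_op_def block_def)
  qed
  have emb: "embed j (\<lambda>x'. \<Sum>l<m. g (j, l) * r l (x', y)) \<in> ell2 ({..<n} \<times> X)" if "j \<in> {..<n}" for j
    using that by (intro embed_ell2(1) ell2_sum r) auto
  have "(\<lambda>(i', x'). \<Sum>l<m. g (i', l) * r l (x', y)) =
      (\<lambda>p. \<Sum>j<n. 1 * embed j (\<lambda>x'. \<Sum>l<m. g (j, l) * r l (x', y)) p)"
  proof
    fix p :: "nat \<times> 'a"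
    obtain i' x' where p: "p = (i', x')"
      by (cases p)
    have "(\<Sum>j<n. 1 * embed j (\<lambda>x'. \<Sum>l<m. g (j, l) * r l (x', y)) p) =
        (\<Sum>j<n. if j = i' then \<Sum>l<m. g (i', l) * r l (x', y) else 0)"
      by (intro sum.cong refl) (auto simp: embed_def p)
    then show "(case p of (i', x') \<Rightarrow> \<Sum>l<m. g (i', l) * r l (x', y)) =
        (\<Sum>j<n. 1 * embed j (\<lambda>x'. \<Sum>l<m. g (j, l) * r l (x', y)) p)"
      using g[of "(i', _)"] by (auto simp: p)
  qed
  then have outer: "A (\<lambda>(i', x'). \<Sum>l<m. g (i', l) * r l (x', y)) =
      (\<lambda>p. \<Sum>j<n. 1 * A (embed j (\<lambda>x'. \<Sum>l<m. g (j, l) * r l (x', y))) p)"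
    by (simp only: linear_op_sum[where F =
        "{..<n}" and z = "\<lambda>j. embed j (\<lambda>x'. \<Sum>l<m. g (j, l) * r l (x', y))" and c = "\<lambda>_. 1", OF A emb])
  have blk: "A (embed j (\<lambda>x'. \<Sum>l<m. g (j, l) * r l (x', y))) (i, x) =
      (\<Sum>l<m. g (j, l) * joint_block A B (i, j) (k, l) v (x, y))" if "j < n" for j
  proof -
    have emb': "embed j (\<lambda>x'. r l (x', y)) \<in> ell2 ({..<n} \<times> X)" if "l \<in> {..<m}" for l
      using \<open>j < n\<close> that by (intro embed_ell2(1) r) simp_all
    have "embed j (\<lambda>x'. \<Sum>l<m. g (j, l) * r l (x', y)) =
        (\<lambda>p. \<Sum>l<m. g (j, l) * embed j (\<lambda>x'. r l (x', y)) p)"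
      by (auto simp: embed_def)
    then have "A (embed j (\<lambda>x'. \<Sum>l<m. g (j, l) * r l (x', y))) =
        (\<lambda>p. \<Sum>l<m. g (j, l) * A (embed j (\<lambda>x'. r l (x', y))) p)"
      by (simp only: linear_op_sum[where F =
          "{..<m}" and z = "\<lambda>l. embed j (\<lambda>x'. r l (x', y))" and c = "\<lambda>l. g (j, l)", OF A emb'])
    then show ?thesis
      by (simp add: joint_block_def tensor_op_eq left_op_def block_def[of A] r_def)
  qed
  have "reorder_op (tensor_op A B) (\<lambda>(p, z). g p * v z) ((i, k), (x, y)) =
      A (\<lambda>(i', x'). B (\<lambda>(k', y'). g (i', k') * v (x', y')) (k, y)) (i, x)"
    by (simp add: reorder_op_def swap_mid_def tensor_op_def o_def split_def)
  also have "\<dots> = (\<Sum>j<n. \<Sum>l<m. g (j, l) * joint_block A B (i, j) (k, l) v (x, y))"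
    unfolding inner outer by (simp add: blk)
  also have "\<dots> = (\<Sum>q\<in>{..<n} \<times> {..<m}. g q * joint_block A B (i, fst q) (k, snd q) v (x, y))"
    by (simp add: sum.cartesian_product')
  finally show ?thesis .
qed

text \<open>The diagonal entry at \<open>(p, z)\<close> of the operator whose trace is the value of
  the strategy.\<close>

definition value_term where
  "value_term n m G A B \<rho> = (\<lambda>(p, z). \<Sum>q\<in>{..<n} \<times> {..<m}.
     G (ket p) q * joint_block A B (fst p, fst q) (snd p, snd q) (\<rho> (ket z)) z)"

lemma op_trace_value:
  assumes G: "linear_op ({..<n} \<times> {..<m}) G" and \<rho>: "linear_op (X \<times> Y) \<rho>"
    and A: "contraction ({..<n} \<times> X) A" and B: "contraction ({..<m} \<times> Y) B"
  shows "op_trace (({..<n} \<times> {..<m}) \<times> (X \<times> Y)) (reorder_op (tensor_op A B) \<circ> tensor_op G \<rho>) =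
    infsum (value_term n m G A B \<rho>) (({..<n} \<times> {..<m}) \<times> (X \<times> Y))"
  unfolding op_trace_eq
proof (rule infsum_cong)
  fix t assume t: "t \<in> ({..<n} \<times> {..<m}) \<times> (X \<times> Y)"
  then obtain i k x y where t_eq: "t = ((i, k), (x, y))" and ik: "i < n" "k < m" and xy: "(x, y) \<in> X \<times> Y"
    by auto
  have ik': "(i, k) \<in> {..<n} \<times> {..<m}"
    using ik by simp
  have "ket t = (\<lambda>(p, z). ket (i, k) p * ket (x, y) z)"
    by (auto simp: ket_def t_eq)
  then have "tensor_op G \<rho> (ket t) = (\<lambda>(p, z). G (ket (i, k)) p * \<rho> (ket (x, y)) z)"
    using tensor_op_product[OF G \<rho> ket_ell2[OF ik'] ket_ell2[OF xy]] by simp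
  then show "(reorder_op (tensor_op A B) \<circ> tensor_op G \<rho>) (ket t) t = value_term n m G A B \<rho> t"
    using tensor_op_reorder[where x = x and y = y, OF contraction_linear[OF A] B
        ell2_outside[OF linear_op_ell2[OF G ket_ell2[OF ik']]] linear_op_ell2[OF \<rho> ket_ell2[OF xy]] ik]
    by (simp add: t_eq value_term_def)
qed

text \<open>\<open>bilin n m (game_coeff n m G) a b = tr ((a \<otimes> b) G)\<close>: the index pairs of \<open>G\<close> are regrouped by player.\<close>

definition game_coeff :: "nat \<Rightarrow> nat \<Rightarrow> (nat \<times> nat) operator \<Rightarrow> nat \<times> nat \<Rightarrow> nat \<times> nat \<Rightarrow> complex" where
  "game_coeff n m G = (\<lambda>(i, j) (k, l). if i
      < n \<and> j < n \<and> k < m \<and> l < m then G (ket (i, k)) (j, l) else 0)"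

lemma sum_game_coeff:
  "(\<Sum>p\<in>{..<n} \<times> {..<m}. \<Sum>q\<in>{..<n} \<times> {..<m}. G (ket p) q * h (fst p, fst q) (snd p, snd q)) =
    (\<Sum>p\<in>square n. \<Sum>q\<in>square m. game_coeff n m G p q * h p q)"
proof -
  have "(\<Sum>p\<in>{..<n} \<times> {..<m}. \<Sum>q\<in>{..<n} \<times> {..<m}. G (ket p) q * h (fst p, fst q) (snd p, snd q)) =
      (\<Sum>i<n. \<Sum>k<m. \<Sum>j<n. \<Sum>l<m. G (ket (i, k)) (j, l) * h (i, j) (k, l))"
    by (simp add: sum.cartesian_product')
  also have "\<dots> = (\<Sum>i<n. \<Sum>j<n. \<Sum>k<m. \<Sum>l<m. G (ket (i, k)) (j, l) * h (i, j) (k, l))"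
    by (intro sum.cong refl sum.swap)
  also have "\<dots> = (\<Sum>p\<in>square n. \<Sum>q\<in>square m. game_coeff n m G p q * h p q)"
    by (simp add: sum.cartesian_product' game_coeff_def)
  finally show ?thesis .
qed

text \<open>The value is the sum of the values on the vectors \<open>v s\<close> of the state, and
  the numbers \<open>nsq (X \<times> Y) (v s)\<close> add up to 1.\<close>

lemma entangled_value_le:
  fixes X Y :: "'a :: countable set"
  assumes G: "linear_op ({..<n} \<times> {..<m}) G" and \<rho>: "quantum_state (X \<times> Y) \<rho>"
    and A: "selfadjoint_contraction ({..<n} \<times> X) A" and B: "selfadjoint_contraction ({..<m} \<times> Y) B"
    and vec: "\<And>\<psi>. \<psi> \<in> ell2 (X \<times> Y) \<Longrightarrow>
      cmod (\<Sum>p\<in>square n. \<Sum>q\<in>square m. game_coeff n m G p q * ell2_inner (X \<times> Y) \<psi> (joint_block A B p q \<psi>))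
        \<le> C * nsq (X \<times> Y) \<psi>"
  shows "Re (op_trace (({..<n} \<times> {..<m}) \<times> (X \<times> Y)) (reorder_op (tensor_op A B) \<circ> tensor_op G \<rho>)) \<le> C"
proof -
  have \<rho>lin: "linear_op (X \<times> Y) \<rho>"
    using \<rho> by (simp add: quantum_state_def positive_op_def bounded_op_def)
  note cA = selfadjoint_contraction_contraction[OF A] and cB = selfadjoint_contraction_contraction[OF B]
  obtain v :: "nat \<Rightarrow> ('a \<times> 'a) vector" where v: "\<And>s. v s \<in> ell2 (X \<times> Y)"
    and one: "((\<lambda>s. nsq (X \<times> Y) (v s)) has_sum 1) UNIV"
    and dec: "\<And>x. x \<in> X \<times> Y \<Longrightarrow> \<rho> (ket x) = (\<lambda>y. \<Sum>s\<le>to_nat x. cnj (v s x) * v s y)"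
    and vz: "\<And>s x. to_nat x < s \<Longrightarrow> v s x = 0"
    using state_decomposition[OF \<rho>] by blast
  let ?J = "joint_block A B"
  define f where "f p q = (\<lambda>s. ell2_inner (X \<times> Y) (v s) (?J p q (v s)))" for p q
  have f_sum: "(f p q has_sum infsum (f p q) UNIV) UNIV"
    and J_sum: "((\<lambda>x. ?J p q (\<rho> (ket x)) x) has_sum infsum (f p q) UNIV) (X \<times> Y)"
    if "p \<in> square n" "q \<in> square m" for p q
    using state_trace[OF v one dec vz joint_block_contraction[OF cA cB that]]
    by (simp_all add: f_def)
  have "(value_term n m G A B \<rho> has_sum
      (\<Sum>p\<in>{..<n} \<times> {..<m}. \<Sum>q\<in>{..<n} \<times>
          {..<m}. G (ket p) q * infsum (f (fst p, fst q) (snd p, snd q)) UNIV))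
      (({..<n} \<times> {..<m}) \<times> (X \<times> Y))"
    unfolding value_term_def
    by (rule has_sum_finite_product) (auto intro!: has_sum_finite_sum has_sum_cmult_right J_sum)
  then have tr: "op_trace (({..<n} \<times> {..<m}) \<times> (X \<times> Y)) (reorder_op (tensor_op A B) \<circ> tensor_op G \<rho>) =
      (\<Sum>p\<in>square n. \<Sum>q\<in>square m. game_coeff n m G p q * infsum (f p q) UNIV)"
    unfolding op_trace_value[OF G \<rho>lin cA cB]
    by (subst sum_game_coeff[where
        n = n and m = m and G = G and h = "\<lambda>p q. infsum (f p q) UNIV", symmetric]) (rule infsumI)
  have "((\<lambda>s. \<Sum>p\<in>square n. \<Sum>q\<in>square m. game_coeff n m G p q * f p q s) has_sum
      (\<Sum>p\<in>square n. \<Sum>q\<in>square m. game_coeff n m G p q * infsum (f p q) UNIV)) UNIV"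
    by (intro has_sum_finite_sum has_sum_cmult_right f_sum)
  moreover have "((\<lambda>s. C * nsq (X \<times> Y) (v s)) has_sum (C * 1)) UNIV"
    by (rule has_sum_cmult_right[OF one])
  ultimately have "cmod (\<Sum>p\<in>square n. \<Sum>q\<in>square m. game_coeff n m G p q * infsum (f p q) UNIV) \<le> C * 1"
    by (rule norm_infsum_le) (use vec[OF v] in \<open>simp add: f_def\<close>)
  then show ?thesis
    unfolding tr by (intro order_trans[OF complex_Re_le_cmod]) simp
qed

subsection \<open>Reduction to countable index sets\<close>

text \<open>For \<open>X0 \<subseteq> X\<close> and \<open>\<gamma>\<close> injective on
  \<open>X0\<close>, \<open>pull\<close> is an isometric embedding into the space over
  \<open>X\<close>, and \<open>push\<close> (restrict, then relabel) is its adjoint.\<close>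

definition pull :: "'a set \<Rightarrow> ('a \<Rightarrow> 'b) \<Rightarrow> 'b vector \<Rightarrow> 'a vector" where
  "pull X0 \<gamma> v = (\<lambda>x. if x \<in> X0 then v (\<gamma> x) else 0)"

definition push :: "'a set \<Rightarrow> ('a \<Rightarrow> 'b) \<Rightarrow> 'a vector \<Rightarrow> 'b vector" where
  "push X0 \<gamma> w = (\<lambda>y. if y \<in> \<gamma> ` X0 then w (inv_into X0 \<gamma> y) else 0)"

text \<open>The compression of \<open>T\<close> to the coordinates in \<open>X0\<close>, relabelled
  by \<open>\<gamma>\<close>.\<close>

definition transport :: "'a set \<Rightarrow> ('a \<Rightarrow> 'b) \<Rightarrow> 'a operator \<Rightarrow> 'b operator" where
  "transport X0 \<gamma> T v = push X0 \<gamma> (T (pull X0 \<gamma> v))"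

context
  fixes X X0 :: "'a set" and \<gamma> :: "'a \<Rightarrow> 'b"
  assumes sub: "X0 \<subseteq> X" and inj: "inj_on \<gamma> X0"
begin

lemma push_apply: "x \<in> X0 \<Longrightarrow> push X0 \<gamma> w (\<gamma> x) = w x"
  using inj by (simp add: push_def)

lemma pull_ell2:
  assumes v: "v \<in> ell2 (\<gamma> ` X0)"
  shows "pull X0 \<gamma> v \<in> ell2 X" "nsq X (pull X0 \<gamma> v) = nsq (\<gamma> ` X0) v"
proof -
  have "(\<lambda>x. (cmod (v (\<gamma> x)))\<^sup>2) summable_on X0"
    using ell2D[OF v] summable_on_reindex[OF inj, of "\<lambda>y. (cmod (v y))\<^sup>2"] by (simp add: o_def)
  moreover have "(\<lambda>x. (cmod (v (\<gamma> x)))\<^sup>2) summable_on X0 \<longleftrightarrow> (\<lambda>x. (cmod (pull X0 \<gamma> v x))\<^sup>2) summable_on X"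
    using sub by (intro summable_on_cong_neutral) (auto simp: pull_def)
  ultimately show "pull X0 \<gamma> v \<in> ell2 X"
    using sub by (auto simp: ell2_def pull_def)
  have "nsq X (pull X0 \<gamma> v) = (\<Sum>\<^sub>\<infinity>x\<in>X0. (cmod (v (\<gamma> x)))\<^sup>2)"
    unfolding nsq_def using sub by (intro infsum_cong_neutral) (auto simp: pull_def)
  also have "\<dots> = nsq (\<gamma> ` X0) v"
    unfolding nsq_def using infsum_reindex[OF inj, of "\<lambda>y. (cmod (v y))\<^sup>2"] by (simp add: o_def)
  finally show "nsq X (pull X0 \<gamma> v) = nsq (\<gamma> ` X0) v" .
qed

lemma push_ell2:
  assumes w: "w \<in> ell2 X"
  shows "push X0 \<gamma> w \<in> ell2 (\<gamma> ` X0)" "nsq (\<gamma> ` X0) (push X0 \<gamma> w) \<le> nsq X w"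
proof -
  have s: "(\<lambda>x. (cmod (w x))\<^sup>2) summable_on X0"
    by (rule summable_on_subset_banach[OF ell2D[OF w] sub])
  have e: "(\<lambda>x. (cmod (push X0 \<gamma> w (\<gamma> x)))\<^sup>2) summable_on X0 \<longleftrightarrow> (\<lambda>x. (cmod (w x))\<^sup>2) summable_on X0"
    by (rule summable_on_cong) (simp add: push_apply)
  have "(\<lambda>y. (cmod (push X0 \<gamma> w y))\<^sup>2) summable_on (\<gamma> ` X0)"
    using s e summable_on_reindex[OF inj, of "\<lambda>y. (cmod (push X0 \<gamma> w y))\<^sup>2"] by (simp add: o_def)
  then show "push X0 \<gamma> w \<in> ell2 (\<gamma> ` X0)"
    by (simp add: ell2_def push_def)
  have "nsq (\<gamma> ` X0) (push X0 \<gamma> w) = (\<Sum>\<^sub>\<infinity>x\<in>X0. (cmod (push X0 \<gamma> w (\<gamma> x)))\<^sup>2)"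
    unfolding nsq_def using infsum_reindex[OF inj, of "\<lambda>y. (cmod (push X0 \<gamma> w y))\<^sup>2"] by (simp add: o_def)
  also have "\<dots> = (\<Sum>\<^sub>\<infinity>x\<in>X0. (cmod (w x))\<^sup>2)"
    by (rule infsum_cong) (simp add: push_apply)
  also have "\<dots> \<le> nsq X w"
    unfolding nsq_def by (rule infsum_mono2[OF s ell2D[OF w] sub]) simp
  finally show "nsq (\<gamma> ` X0) (push X0 \<gamma> w) \<le> nsq X w" .
qed

lemma inner_pull: "ell2_inner X (pull X0 \<gamma> u) w = ell2_inner (\<gamma> ` X0) u (push X0 \<gamma> w)"
proof -
  have "ell2_inner (\<gamma> ` X0) u (push X0 \<gamma> w) = (\<Sum>\<^sub>\<infinity>x\<in>X0. cnj (u (\<gamma> x)) * push X0 \<gamma> w (\<gamma> x))"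
    unfolding ell2_inner_def using infsum_reindex[OF inj,
        of "\<lambda>y. cnj (u y) * push X0 \<gamma> w y"] by (simp add: o_def)
  also have "\<dots> = ell2_inner X (pull X0 \<gamma> u) w"
    unfolding ell2_inner_def using sub
    by (intro infsum_cong_neutral) (auto simp: pull_def push_apply)
  finally show ?thesis
    by simp
qed

lemma linear_op_transport:
  assumes T: "linear_op X T"
  shows "linear_op (\<gamma> ` X0) (transport X0 \<gamma> T)"
  unfolding linear_op_def transport_def
proof (intro conjI ballI allI)
  fix u v a assume v: "v \<in> ell2 (\<gamma> ` X0)"
  show "push X0 \<gamma> (T (pull X0 \<gamma> v)) \<in> ell2 (\<gamma> ` X0)"
    by (rule push_ell2(1)[OF linear_op_ell2[OF T pull_ell2(1)[OF v]]])
  have "pull X0 \<gamma> (\<lambda>x. a * v x) = (\<lambda>x. a * pull X0 \<gamma> v x)"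
    by (auto simp: pull_def)
  then show "push X0 \<gamma> (T (pull X0 \<gamma> (\<lambda>x. a * v x))) = (\<lambda>x. a * push X0 \<gamma> (T (pull X0 \<gamma> v)) x)"
    by (simp add: linear_op_scale[OF T pull_ell2(1)[OF v]]) (auto simp: push_def)
  assume u: "u \<in> ell2 (\<gamma> ` X0)"
  have "pull X0 \<gamma> (\<lambda>x. u x + v x) = (\<lambda>x. pull X0 \<gamma> u x + pull X0 \<gamma> v x)"
    by (auto simp: pull_def)
  then show "push X0 \<gamma> (T (pull X0 \<gamma> (\<lambda>x. u x + v x))) =
      (\<lambda>x. push X0 \<gamma> (T (pull X0 \<gamma> u)) x + push X0 \<gamma> (T (pull X0 \<gamma> v)) x)"
    by (simp add: linear_op_add[OF T pull_ell2(1)[OF u] pull_ell2(1)[OF v]]) (auto simp: push_def)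
qed

lemma selfadjoint_contraction_transport:
  assumes T: "selfadjoint_contraction X T"
  shows "selfadjoint_contraction (\<gamma> ` X0) (transport X0 \<gamma> T)"
proof -
  note c = selfadjoint_contraction_contraction[OF T]
  note lin = contraction_linear[OF c]
  have "nsq (\<gamma> ` X0) (transport X0 \<gamma> T v) \<le> nsq (\<gamma> ` X0) v" if v: "v \<in> ell2 (\<gamma> ` X0)" for v
    unfolding transport_def
    using push_ell2(2)[OF linear_op_ell2[OF lin pull_ell2(1)[OF v]]]
        contraction_le[OF c pull_ell2(1)[OF v]]
      pull_ell2(2)[OF v] by linarith
  moreover have "ell2_inner (\<gamma> ` X0) u (transport X0 \<gamma> T v) = ell2_inner (\<gamma> ` X0) (transport X0 \<gamma> T u) v"
    if u: "u \<in> ell2 (\<gamma> ` X0)" and v: "v \<in> ell2 (\<gamma> ` X0)" for u v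
  proof -
    have "ell2_inner (\<gamma> ` X0) u (transport X0 \<gamma> T v) = ell2_inner X (pull X0 \<gamma> u) (T (pull X0 \<gamma> v))"
      unfolding transport_def by (rule inner_pull[symmetric])
    also have "\<dots> = ell2_inner X (T (pull X0 \<gamma> u)) (pull X0 \<gamma> v)"
      using T pull_ell2(1)[OF u] pull_ell2(1)[OF v] by (simp add: selfadjoint_contraction_def)
    also have "\<dots> = cnj (ell2_inner X (pull X0 \<gamma> v) (T (pull X0 \<gamma> u)))"
      by (rule ell2_inner_cnj)
    also have "\<dots> = cnj (ell2_inner (\<gamma> ` X0) v (transport X0 \<gamma> T u))"
      unfolding transport_def by (simp only: inner_pull)
    also have "\<dots> = ell2_inner (\<gamma> ` X0) (transport X0 \<gamma> T u) v"
      by (rule ell2_inner_cnj[symmetric])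
    finally show ?thesis .
  qed
  ultimately show ?thesis
    unfolding selfadjoint_contraction_def ell2_norm_eq using linear_op_transport[OF lin] by auto
qed

lemma pull_ket: "x \<in> X0 \<Longrightarrow> pull X0 \<gamma> (ket (\<gamma> x)) = ket x"
  using inj by (auto simp: pull_def ket_def inj_on_def)

lemma quantum_state_transport:
  assumes \<rho>: "quantum_state X \<rho>" and zero: "\<And>x. x \<in> X - X0 \<Longrightarrow> \<rho> (ket x) x = 0"
  shows "quantum_state (\<gamma> ` X0) (transport X0 \<gamma> \<rho>)"
proof -
  have pos: "positive_op X \<rho>" and tr: "op_trace X \<rho> = 1"
    using \<rho> by (auto simp: quantum_state_def)
  then have lin: "linear_op X \<rho>"
    by (simp add: positive_op_def bounded_op_def)
  obtain C where C: "\<And>v. v \<in> ell2 X \<Longrightarrow> ell2_norm X (\<rho> v) \<le> C * ell2_norm X v"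
    using pos unfolding positive_op_def bounded_op_def by blast
  have "ell2_norm (\<gamma> ` X0) (transport X0 \<gamma> \<rho> v) \<le>
      C * ell2_norm (\<gamma> ` X0) v" if v: "v \<in> ell2 (\<gamma> ` X0)" for v
  proof -
    have "ell2_norm (\<gamma> ` X0) (transport X0 \<gamma> \<rho> v) \<le> ell2_norm X (\<rho> (pull X0 \<gamma> v))"
      unfolding transport_def ell2_norm_eq
      by (intro real_sqrt_le_mono push_ell2(2) linear_op_ell2[OF lin] pull_ell2(1) v)
    also have "\<dots> \<le> C * ell2_norm X (pull X0 \<gamma> v)"
      by (rule C[OF pull_ell2(1)[OF v]])
    finally show ?thesis
      by (simp add: ell2_norm_eq pull_ell2(2)[OF v])
  qed
  then have "bounded_op (\<gamma> ` X0) (transport X0 \<gamma> \<rho>)"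
    using linear_op_transport[OF lin] by (auto simp: bounded_op_def)
  moreover have "ell2_inner (\<gamma> ` X0) v (transport X0 \<gamma> \<rho> v) \<in> \<real>\<^sub>\<ge>\<^sub>0" if "v \<in> ell2 (\<gamma> ` X0)" for v
    using pos pull_ell2(1)[OF that] by (simp add: transport_def positive_op_def flip: inner_pull)
  moreover have "op_trace (\<gamma> ` X0) (transport X0 \<gamma> \<rho>) = 1"
  proof -
    have "op_trace (\<gamma> ` X0) (transport X0 \<gamma> \<rho>) = (\<Sum>\<^sub>\<infinity>x\<in>X0. transport X0 \<gamma> \<rho> (ket (\<gamma> x)) (\<gamma> x))"
      unfolding op_trace_eq by (simp add: infsum_reindex[OF inj] o_def)
    also have "\<dots> = op_trace X \<rho>"
      unfolding op_trace_eq transport_def using sub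
      by (intro infsum_cong_neutral) (auto simp: pull_ket push_apply zero)
    finally show ?thesis
      using tr by simp
  qed
  ultimately show ?thesis
    by (simp add: quantum_state_def positive_op_def)
qed

end

lemma block_transport:
  assumes inj: "inj_on g I0" and ij: "i < n" "j < n" and x: "x \<in> I0"
  shows "block (transport ({..<n} \<times> I0) (map_prod id g) A) i j v (g x) = block A i j (pull I0 g v) x"
proof -
  have inj': "inj_on (map_prod id g) ({..<n} \<times> I0)"
    using inj by (auto simp: inj_on_def)
  have "pull ({..<n} \<times> I0) (map_prod id g) (embed j v) = embed j (pull I0 g v)"
    using ij by (auto simp: pull_def embed_def)
  moreover have "push ({..<n} \<times> I0) (map_prod id g) w (i, g x) = w (i, x)" for w
    using push_apply[OF subset_refl inj', of "(i, x)" w] ij x by simp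
  ultimately show ?thesis
    by (simp add: block_def transport_def)
qed

text \<open>Compression is not multiplicative in general. Here Bob's operator acts on slices with
  fixed \<open>x\<close> and Alice's on slices with fixed \<open>y\<close>, so for a vector
  supported in \<open>I0 \<times> J0\<close> no coordinate outside is read.\<close>

lemma joint_block_transport:
  assumes g: "inj_on g I0" and h: "inj_on h J0" and p: "p \<in> square n" and q: "q \<in> square m"
    and B: "contraction ({..<m} \<times> J) B" and x: "x \<in> I0" and y: "y \<in> J0"
    and supp: "\<And>z. z \<notin> I0 \<times> J0 \<Longrightarrow> v z = 0"
  shows "joint_block (transport
      ({..<n} \<times> I0) (map_prod id g) A) (transport ({..<m} \<times> J0) (map_prod id h) B) p q
      (push (I0 \<times> J0) (map_prod g h) v) (g x, h y) = joint_block A B p q v (x, y)"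
proof -
  have pq: "fst p < n" "snd p < n" "fst q < m" "snd q < m"
    using p q by auto
  have inj: "inj_on (map_prod g h) (I0 \<times> J0)"
    using g h by (auto simp: inj_on_def)
  let ?w = "push (I0 \<times> J0) (map_prod g h) v"
  let ?B = "block B (fst q) (snd q)"
  have w: "?w (g x', h y') = v (x', y')" if "x' \<in> I0" "y' \<in> J0" for x' y'
    using push_apply[OF subset_refl inj, of "(x', y')" v] that by simp
  have pw: "pull J0 h (\<lambda>y'. ?w (g x', y')) = (\<lambda>y'. v (x', y'))" if "x' \<in> I0" for x'
    using w[OF that] supp by (auto simp: pull_def)
  have B0: "?B (\<lambda>_. 0) = (\<lambda>_. 0)"
    by (rule linear_op_zero[OF contraction_linear[OF block_contraction[OF B pq(3,4)]]])
  have "pull I0 g (\<lambda>x'. block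
      (transport ({..<m} \<times> J0) (map_prod id h) B) (fst q) (snd q) (\<lambda>y'. ?w (x', y')) (h y)) =
      (\<lambda>x'. ?B (\<lambda>y'. v (x', y')) y)"
  proof
    fix x'
    show "pull I0 g (\<lambda>x'. block
        (transport ({..<m} \<times> J0) (map_prod id h) B) (fst q) (snd q) (\<lambda>y'. ?w (x', y')) (h y)) x' =
        ?B (\<lambda>y'. v (x', y')) y"
    proof (cases "x' \<in> I0")
      case True
      then show ?thesis
        by (simp add: pull_def[of I0] block_transport[OF h pq(3,4) y] pw)
    next
      case False
      then have "(\<lambda>y'. v (x', y')) = (\<lambda>_. 0)"
        using supp by auto
      then show ?thesis
        using False by (simp add: pull_def B0)
    qed
  qed
  then show ?thesis
    unfolding joint_block_def tensor_op_def prod.case by (simp only: block_transport[OF g pq(1,2) x])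
qed

text \<open>The diagonal of a state is summable, so its support \<open>D\<close> is countable. The
  state lives on the product of the two projections of \<open>D\<close>, and both players' operators
  may be compressed to them.\<close>

lemma entangled_value_transport:
  fixes n m :: nat and I J :: "'h set"
  assumes G: "linear_op ({..<n} \<times> {..<m}) G" and \<rho>: "quantum_state (I \<times> J) \<rho>"
    and A: "selfadjoint_contraction ({..<n} \<times> I) A" and B: "selfadjoint_contraction ({..<m} \<times> J) B"
  obtains I' J' :: "nat set" and \<rho>' A' B' where
    "quantum_state (I' \<times> J') \<rho>'"
        "selfadjoint_contraction ({..<n} \<times> I') A'" "selfadjoint_contraction ({..<m} \<times> J') B'"
    "op_trace (({..<n} \<times> {..<m}) \<times> (I' \<times> J')) (reorder_op (tensor_op A' B') \<circ> tensor_op G \<rho>') =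
     op_trace (({..<n} \<times> {..<m}) \<times> (I \<times> J)) (reorder_op (tensor_op A B) \<circ> tensor_op G \<rho>)"
proof -
  let ?Z = "I \<times> J"
  have pos: "positive_op ?Z \<rho>"
    using \<rho> by (simp add: quantum_state_def)
  then have \<rho>lin: "linear_op ?Z \<rho>"
    by (simp add: positive_op_def bounded_op_def)
  note diag = quantum_state_diag[OF \<rho>]
  define D where "D = {z \<in> ?Z. Re (\<rho> (ket z) z) \<noteq> 0}"
  have "countable D"
    unfolding D_def by (rule summable_countable_real[OF has_sum_imp_summable[OF diag(1)]])
  define I0 where "I0 = fst ` D"
  define J0 where "J0 = snd ` D"
  have sub: "I0 \<subseteq> I" "J0 \<subseteq> J" "D \<subseteq> I0 \<times> J0"
    by (force simp: I0_def J0_def D_def)+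
  define g where "g = to_nat_on I0"
  define h where "h = to_nat_on J0"
  have g: "inj_on g I0" and h: "inj_on h J0"
    unfolding g_def h_def I0_def J0_def using \<open>countable D\<close> by (auto intro: inj_on_to_nat_on)
  have zero_diag: "\<rho> (ket z) z = 0" if "z \<in> ?Z - I0 \<times> J0" for z
    using that sub(3) diag(2)[of z] by (auto simp: D_def)
  \<comment> \<open>A zero on the diagonal of a positive kernel forces its column to vanish, and by
    symmetry its row.\<close>
  have col0: "\<rho> (ket z) y = 0" if z: "z \<in> ?Z - I0 \<times> J0" for z y
  proof (cases "y \<in> ?Z")
    case True
    then show ?thesis
      using psd_kernel_diag(3)[OF psd_kernel_positive_op[OF pos], of z y] zero_diag[OF z] z by auto
  next
    case False
    then show ?thesis
      using ell2_outside[OF linear_op_ell2[OF \<rho>lin ket_ell2] False] z by blast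
  qed
  have row0: "\<rho> (ket z) y = 0" if z: "z \<in> ?Z" and y: "y \<notin> I0 \<times> J0" for z y
  proof (cases "y \<in> ?Z")
    case True
    then show ?thesis
      using psd_kernel_sym[OF psd_kernel_positive_op[OF pos], of y z] col0[of y z] y z by auto
  next
    case False
    then show ?thesis
      using ell2_outside[OF linear_op_ell2[OF \<rho>lin ket_ell2] False] z by blast
  qed
  define A' where "A' = transport ({..<n} \<times> I0) (map_prod id g) A"
  define B' where "B' = transport ({..<m} \<times> J0) (map_prod id h) B"
  define \<rho>' where "\<rho>' = transport (I0 \<times> J0) (map_prod g h) \<rho>"
  have injs: "inj_on (map_prod id g) ({..<n} \<times> I0)" "inj_on (map_prod id h) ({..<m} \<times> J0)"
    "inj_on (map_prod g h) (I0 \<times> J0)"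
    using g h by (auto simp: inj_on_def)
  have imgs: "map_prod id g `
      ({..<n} \<times> I0) = {..<n} \<times> g ` I0" "map_prod id h ` ({..<m} \<times> J0) = {..<m} \<times> h ` J0"
    "map_prod g h ` (I0 \<times> J0) = g ` I0 \<times> h ` J0"
    by (simp_all add: map_prod_surj_on)
  have A': "selfadjoint_contraction ({..<n} \<times> g ` I0) A'"
    unfolding A'_def imgs(1)[symmetric]
    by (rule selfadjoint_contraction_transport[OF _ injs(1) A]) (use sub in auto)
  have B': "selfadjoint_contraction ({..<m} \<times> h ` J0) B'"
    unfolding B'_def imgs(2)[symmetric]
    by (rule selfadjoint_contraction_transport[OF _ injs(2) B]) (use sub in auto)
  have \<rho>': "quantum_state (g ` I0 \<times> h ` J0) \<rho>'"
    unfolding \<rho>'_def imgs(3)[symmetric]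
    by (rule quantum_state_transport[OF _ injs(3) \<rho> zero_diag]) (use sub in auto)
  let ?P = "{..<n} \<times> {..<m}"
  note cA = selfadjoint_contraction_contraction[OF A] and cB = selfadjoint_contraction_contraction[OF B]
  have \<rho>'lin: "linear_op (g ` I0 \<times> h ` J0) \<rho>'"
    using \<rho>' by (simp add: quantum_state_def positive_op_def bounded_op_def)
  have term_eq: "value_term n m G A' B' \<rho>' (p, map_prod g h z) = value_term n m G A B \<rho> (p, z)"
    if p: "p \<in> ?P" and z: "z \<in> I0 \<times> J0" for p z
  proof -
    obtain x y where xy: "z = (x, y)" "x \<in> I0" "y \<in> J0"
      using z by auto
    have "pull (I0 \<times> J0) (map_prod g h) (ket (map_prod g h z)) = ket z"
      by (rule pull_ket[OF subset_refl injs(3) z])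
    then have "\<rho>' (ket (g x, h y)) = push (I0 \<times> J0) (map_prod g h) (\<rho> (ket (x, y)))"
      by (simp add: \<rho>'_def transport_def xy)
    moreover have "joint_block A' B'
        (fst p, fst q) (snd p, snd q) (push (I0 \<times> J0) (map_prod g h) (\<rho> (ket (x, y)))) (g x, h y) =
        joint_block A B (fst p, fst q) (snd p, snd q) (\<rho> (ket (x, y))) (x, y)" if "q \<in> ?P" for q
      unfolding A'_def B'_def using p that sub xy
      by (intro joint_block_transport[OF g h _ _ cB xy(2,3)] row0) auto
    ultimately show ?thesis
      by (simp add: value_term_def xy)
  qed
  have "infsum (value_term n m G A' B' \<rho>') (?P \<times> (g ` I0 \<times> h ` J0)) =
      infsum (value_term n m G A' B' \<rho>') (map_prod id (map_prod g h) ` (?P \<times> (I0 \<times> J0)))"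
    by (simp add: map_prod_surj_on)
  also have "\<dots> = infsum (value_term n m G A' B' \<rho>' \<circ> map_prod id (map_prod g h)) (?P \<times> (I0 \<times> J0))"
    by (rule infsum_reindex) (use injs(3) in \<open>auto simp: inj_on_def\<close>)
  also have "\<dots> = infsum (value_term n m G A B \<rho>) (?P \<times> ?Z)"
  proof (rule infsum_cong_neutral)
    fix t assume t: "t \<in> ?P \<times> ?Z - ?P \<times> (I0 \<times> J0)"
    obtain p z where pz: "t = (p, z)"
      by (cases t)
    have z: "z \<in> ?Z - I0 \<times> J0" and p: "p \<in> ?P"
      using t by (auto simp: pz)
    have "\<rho> (ket z) = (\<lambda>_. 0)"
      using col0[OF z] by auto
    moreover have "joint_block A B (fst p, fst q) (snd p, snd q) (\<lambda>_. 0) = (\<lambda>_. 0)" if "q \<in> ?P" for q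
      by (rule linear_op_zero[OF
          contraction_linear[OF joint_block_contraction[OF cA cB]]]) (use p that in auto)
    ultimately show "value_term n m G A B \<rho> t = 0"
      by (simp add: value_term_def pz)
  next
    fix t assume "t \<in> ?P \<times> (I0 \<times> J0) - ?P \<times> ?Z"
    then show "(value_term n m G A' B' \<rho>' \<circ> map_prod id (map_prod g h)) t = 0"
      using sub by auto
  next
    fix t assume "t \<in> ?P \<times> (I0 \<times> J0) \<inter> ?P \<times> ?Z"
    then show "(value_term n m G A' B' \<rho>' \<circ> map_prod id (map_prod g h)) t = value_term n m G A B \<rho> t"
      using term_eq[of "fst t" "snd t"] by (cases t) auto
  qed
  finally have "op_trace (?P \<times> (g ` I0 \<times> h ` J0)) (reorder_op (tensor_op A' B') \<circ> tensor_op G \<rho>') =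
      op_trace (?P \<times> ?Z) (reorder_op (tensor_op A B) \<circ> tensor_op G \<rho>)"
    unfolding op_trace_value[OF G \<rho>lin cA cB]
      op_trace_value[OF G \<rho>'lin selfadjoint_contraction_contraction[OF A']
          selfadjoint_contraction_contraction[OF B']] .
  then show thesis
    using that[OF \<rho>' A' B'] by blast
qed

subsection \<open>The one-way communication bias\<close>

definition matrix_op :: "nat \<Rightarrow> matrix \<Rightarrow> nat operator" where
  "matrix_op n M v = (\<lambda>i. if i < n then \<Sum>j<n. M (i, j) * v j else 0)"

lemma linear_op_matrix_op: "linear_op {..<n} (matrix_op n M)"
  unfolding linear_op_def
  by (auto simp: ell2_finite
      matrix_op_def sum.distrib distrib_left sum_distrib_left mult.left_commute fun_eq_iff)

lemma bounded_op_matrix_op: "bounded_op {..<n} (matrix_op n M)"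
proof -
  define C where "C = (\<Sum>i<n. \<Sum>j<n. (cmod (M (i, j)))\<^sup>2)"
  have C: "0 \<le> C"
    unfolding C_def by (intro sum_nonneg) simp
  have "ell2_norm {..<n} (matrix_op n M v) \<le> sqrt C * ell2_norm {..<n} v" for v
  proof -
    have "(cmod (matrix_op n M v i))\<^sup>2 \<le> (\<Sum>j<n. (cmod (M (i, j)))\<^sup>2) * nsq {..<n} v" if "i < n" for i
    proof -
      have "cmod (matrix_op n M v i) \<le> sqrt (\<Sum>j<n. (cmod (M (i, j)))\<^sup>2) * sqrt (\<Sum>j<n. (cmod (v j))\<^sup>2)"
        using that cmod_sum_mult_le[of "\<lambda>j. M (i, j)" v "{..<n}"] by (simp add: matrix_op_def)
      from power_mono[OF this norm_ge_zero, of 2] show ?thesis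
        by (simp add: power_mult_distrib nsq_def sum_nonneg)
    qed
    then have "nsq {..<n} (matrix_op n M v) \<le> (\<Sum>i<n. (\<Sum>j<n. (cmod (M (i, j)))\<^sup>2) * nsq {..<n} v)"
      unfolding nsq_def[of _ "matrix_op n M v"] infsum_finite[OF finite_lessThan] by (intro sum_mono) simp
    then have "nsq {..<n} (matrix_op n M v) \<le> C * nsq {..<n} v"
      by (simp add: C_def sum_distrib_right)
    from real_sqrt_le_mono[OF this] show ?thesis
      by (simp add: ell2_norm_eq real_sqrt_mult)
  qed
  then show ?thesis
    using linear_op_matrix_op by (auto simp: bounded_op_def)
qed

lemma inner_matrix_op: "ell2_inner {..<n} v (matrix_op n M v) = matrix_form n M v v"
  by (simp add: ell2_inner_def matrix_op_def kernel_form_def sum_distrib_left mult.assoc)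

lemma positive_op_matrix_op:
  assumes "\<And>v. 0 \<le> Re (matrix_form n M v v)" "\<And>v. Im (matrix_form n M v v) = 0"
  shows "positive_op {..<n} (matrix_op n M)"
  using assms by (simp add: positive_op_def bounded_op_matrix_op inner_matrix_op complex_nonneg_Reals_iff)

lemma hermitian_form_real: "madj b = b \<Longrightarrow> Im (matrix_form m b v v) = 0"
  using matrix_form_madj[of m b v] by (metis Reals_cnj_iff complex_is_Real_iff)

lemma trace_matrix_ops:
  "op_trace ({..<n} \<times> {..<m})
      (tensor_op (matrix_op n a) (matrix_op m b) \<circ> G) = bilin n m (game_coeff n m G) a b"
proof -
  have "op_trace ({..<n} \<times> {..<m}) (tensor_op (matrix_op n a) (matrix_op m b) \<circ> G) =
      (\<Sum>p\<in>{..<n} \<times> {..<m}. \<Sum>q\<in>{..<n} \<times> {..<m}. G (ket p) q * (a (fst p, fst q) * b (snd p, snd q)))"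
    unfolding op_trace_eq
    by (simp add: sum.cartesian_product' tensor_op_def matrix_op_def sum_distrib_left algebra_simps)
  also have "\<dots> = (\<Sum>p\<in>square n. \<Sum>q\<in>square m. game_coeff n m G p q * (a p * b q))"
    by (rule sum_game_coeff[where h = "\<lambda>p q. a p * b q"])
  finally show ?thesis
    by (simp add: bilin_def mult.assoc)
qed

text \<open>\<open>A1\<close> and \<open>B1\<close> belong to the answer 1, \<open>A2\<close> and
  \<open>B2\<close> to the answer -1, and \<open>k\<close> is the message.\<close>

lemma owc_bias_ge:
  fixes A1 A2 B1 B2 :: "nat \<Rightarrow> matrix"
  assumes A: "\<And>k. k \<in> {1..2 ^ c} \<Longrightarrow>
      positive_op {..<n} (matrix_op n (A1 k)) \<and> positive_op {..<n} (matrix_op n (A2 k))"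
    and A_one: "\<And>p. p \<in> square n \<Longrightarrow> (\<Sum>k\<in>{1..2 ^ c}. A1 k p + A2 k p) = mone n p"
    and B: "\<And>k. k \<in> {1..2 ^ c} \<Longrightarrow>
        positive_op {..<m} (matrix_op m (B1 k)) \<and> positive_op {..<m} (matrix_op m (B2 k))"
    and B_one: "\<And>k p. k \<in> {1..2 ^ c} \<Longrightarrow> p \<in> square m \<Longrightarrow> B1 k p + B2 k p = mone m p"
  shows "ereal (\<Sum>k\<in>{1..2 ^ c}.
      Re (bilin n m (game_coeff n m G) (\<lambda>p. A1 k p - A2 k p) (\<lambda>p. B1 k p - B2 k p)))
    \<le> owc_bias n m G"
proof -
  define E where "E a k = matrix_op n (if a = 1 then A1 k else A2 k)" for a :: int and k
  define F where "F a k = matrix_op m (if a = 1 then B1 k else B2 k)" for a :: int and k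
  have mone_op: "matrix_op k M v = v" if "v \<in> ell2 {..<k}" "\<And>p. p \<in> square k \<Longrightarrow> M p = mone k p" for k M v
  proof
    fix i
    have "(\<Sum>j<k. M (i, j) * v j) = (\<Sum>j<k. if j = i then v i else 0)" if "i < k"
      using that \<open>\<And>p. p \<in> square k \<Longrightarrow> M p = mone k p\<close> by (intro sum.cong refl) (simp add: mone_def)
    then show "matrix_op k M v i = v i"
      using ell2_outside[OF that(1), of i] by (simp add: matrix_op_def)
  qed
  have 1: "\<forall>a\<in>{-1, 1}. \<forall>k\<in>{1..2 ^ c}. positive_op {..<n} (E a k)"
    using A by (simp add: E_def)
  have 2: "\<forall>v\<in>ell2 {..<n}. (\<lambda>i. \<Sum>a\<in>{-1, 1}. \<Sum>k\<in>{1..2 ^ c}. E a k v i) = v"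
  proof
    fix v :: "nat \<Rightarrow> complex" assume v: "v \<in> ell2 {..<n}"
    have "(\<lambda>i. \<Sum>a\<in>{-1, 1 :: int}. \<Sum>k\<in>{1..2 ^ c}. E a k v i) =
        matrix_op n (\<lambda>p. \<Sum>k\<in>{1..2 ^ c}. A1 k p + A2 k p) v"
    proof
      fix i
      have "(\<Sum>j<n. (\<Sum>k\<in>{1..2 ^ c}. A1 k (i, j) + A2 k (i, j)) * v j) =
          (\<Sum>k\<in>{1..2 ^ c}. (\<Sum>j<n. A2 k (i, j) * v j)) + (\<Sum>k\<in>{1..2 ^ c}. (\<Sum>j<n. A1 k (i, j) * v j))"
        unfolding sum_distrib_right by (subst sum.swap) (simp add: sum.distrib algebra_simps)
      then show "(\<Sum>a\<in>{-1, 1 :: int}. \<Sum>k\<in>{1..2 ^ c}. E a k v i) =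
          matrix_op n (\<lambda>p. \<Sum>k\<in>{1..2 ^ c}. A1 k p + A2 k p) v i"
        by (simp add: E_def matrix_op_def)
    qed
    then show "(\<lambda>i. \<Sum>a\<in>{-1, 1 :: int}. \<Sum>k\<in>{1..2 ^ c}. E a k v i) = v"
      using mone_op[OF v A_one] by simp
  qed
  have 3: "\<forall>a\<in>{-1, 1}. \<forall>k\<in>{1..2 ^ c}. positive_op {..<m} (F a k)"
    using B by (simp add: F_def)
  have 4: "\<forall>k\<in>{1..2 ^ c}. \<forall>v\<in>ell2 {..<m}. (\<lambda>j. \<Sum>b\<in>{-1, 1}. F b k v j) = v"
  proof (intro ballI)
    fix k :: nat and v :: "nat \<Rightarrow> complex" assume k: "k \<in> {1..2 ^ c}" and v: "v \<in> ell2 {..<m}"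
    have "(\<lambda>j. \<Sum>b\<in>{-1, 1 :: int}. F b k v j) = matrix_op m (\<lambda>p. B1 k p + B2 k p) v"
      by (auto simp: F_def matrix_op_def sum.distrib[symmetric] algebra_simps)
    then show "(\<lambda>j. \<Sum>b\<in>{-1, 1 :: int}. F b k v j) = v"
      using mone_op[OF v B_one[OF k]] by simp
  qed
  have diff: "(\<lambda>v i. matrix_op k M v i - matrix_op k M' v i) = matrix_op k (\<lambda>p. M p - M' p)" for k M M'
    by (auto simp: matrix_op_def sum_subtractf left_diff_distrib fun_eq_iff)
  have "(\<Sum>k\<in>{1..2 ^ c}. Re (bilin n m (game_coeff n m G) (\<lambda>p. A1 k p - A2 k p) (\<lambda>p. B1 k p - B2 k p))) =
      (\<Sum>k\<in>{1..2 ^ c}. Re (op_trace ({..<n} \<times> {..<m})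
        (tensor_op (\<lambda>v i. E 1 k v i - E (-1) k v i) (\<lambda>v j. F 1 k v j - F (-1) k v j) \<circ> G)))"
    by (simp add: E_def F_def diff trace_matrix_ops)
  then show ?thesis
    unfolding owc_bias_def using 1 2 3 4 by (intro Sup_upper) blast
qed

lemma matrix_form_rank1: "matrix_form n (rank1 w w) v v = complex_of_real ((cmod (dot n v w))\<^sup>2)"
  unfolding complex_norm_square dot_def cnj_sum sum_product kernel_form_def
  by (intro sum.cong refl) (simp add: rank1_def algebra_simps)

lemma matrix_form_mone: "matrix_form n (mone n) v v = complex_of_real (sq_norm n v)"
proof -
  have "matrix_form n (mone n) v v = (\<Sum>i<n. \<Sum>j<n. if i = j then v i * cnj (v i) else 0)"
    unfolding kernel_form_def by (intro sum.cong refl) (simp add: mone_def mult.commute)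
  then show ?thesis
    by (simp add: sq_norm_def flip: complex_norm_square)
qed

lemma matrix_form_sum_list:
  "matrix_form n (\<lambda>p. \<Sum>x\<leftarrow>xs. M x p) v v = (\<Sum>x\<leftarrow>xs. matrix_form n (M x) v v)"
proof (induction xs)
  case Nil
  show ?case
    by (simp add: kernel_form_def)
next
  case (Cons x xs)
  then show ?case
    using matrix_form_add[of n "M x" "\<lambda>p. \<Sum>x\<leftarrow>xs. M x p" v] by simp
qed

text \<open>The list is turned into a protocol. Alice measures with effects
  \<open>\<xi> \<xi>\<^sup>* / l\<close>, always answers 1 and sends the outcome; Bob measures the
  observable \<open>b\<close> of that outcome.\<close>

lemma owc_bound_pos:
  assumes owc: "owc_bias n m G \<le> ereal \<beta>" and l: "0 < l"
    and xs: "\<And>\<xi> b. (\<xi>, b) \<in> set xs \<Longrightarrow> b \<in> hermitian_contractions m"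
    and le: "\<And>v. (\<Sum>(\<xi>, b)\<leftarrow>xs. (cmod (dot n v \<xi>))\<^sup>2) \<le> l * sq_norm n v"
  shows "(\<Sum>(\<xi>, b)\<leftarrow>xs. Re (bilin n m (game_coeff n m G) (rank1 \<xi> \<xi>) b)) \<le> \<beta> * l"
proof -
  let ?c = "game_coeff n m G"
  define L where "L = length xs"
  define \<xi> where "\<xi> k = fst (xs ! (k - 1))" for k
  define b where "b k = snd (xs ! (k - 1))" for k
  define w where "w = complex_of_real (1 / l)"
  \<comment> \<open>The rest of Alice's measurement. It is divided equally between her two answers
    for the message \<open>Suc L\<close>, so it cancels in their difference.\<close>
  define R where "R = (\<lambda>p. mone n p + (- w) * (\<Sum>x\<leftarrow>xs. rank1 (fst x) (fst x) p))"
  define A1 where "A1 k = (if k \<le>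
      L then (\<lambda>p. w * rank1 (\<xi> k) (\<xi> k) p) else if k = Suc L then (\<lambda>p. (1 / 2) * R p) else (\<lambda>_. 0))" for k
  define A2 where "A2 k = (if k = Suc L then (\<lambda>p. (1 / 2) * R p) else (\<lambda>_. 0))" for k
  \<comment> \<open>Bob's effects \<open>(1 + b) / 2\<close> and \<open>(1 - b) / 2\<close>; beyond
    \<open>L\<close> he answers at random.\<close>
  define B where "B s k = (if k \<le>
      L then (\<lambda>p. (1 / 2) * (mone m p + s * b k p)) else (\<lambda>p. (1 / 2) * mone m p))" for s :: complex and k
  \<comment> \<open>\<open>L\<close> bits leave room for the \<open>L\<close> outcomes and the rest;
    all further messages have effect 0.\<close>
  have Suc_L: "Suc L \<le> 2 ^ L"
    by (induction L) auto
  have sum_xs: "(\<Sum>k=1..L. h (xs ! (k - 1))) = (\<Sum>x\<leftarrow>xs. h x)" for h :: "_ \<Rightarrow> 'z :: comm_monoid_add"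
  proof -
    have "(\<Sum>x\<leftarrow>xs. h x) = (\<Sum>i<L. h (xs ! i))"
      by (simp add: sum_list_sum_nth L_def atLeast0LessThan)
    also have "\<dots> = (\<Sum>k=1..L. h (xs ! (k - 1)))"
      by (rule sum.reindex_bij_witness[of _ "\<lambda>k. k - 1" Suc]) auto
    finally show ?thesis
      by simp
  qed
  have sum_split: "(\<Sum>k=1..2 ^ L. h k) = (\<Sum>k=1..L. h k) + h (Suc L)"
    if "\<And>k. Suc L < k \<Longrightarrow> h k = 0" for h :: "nat \<Rightarrow> 'z :: comm_monoid_add"
  proof -
    have "(\<Sum>k=1..2 ^ L. h k) = (\<Sum>k=1..Suc L. h k)"
      by (rule sum.mono_neutral_right) (use Suc_L that in auto)
    then show ?thesis
      by simp
  qed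
  have R_form: "matrix_form n R v v =
      complex_of_real (sq_norm n v - (\<Sum>(\<xi>, b)\<leftarrow>xs. (cmod (dot n v \<xi>))\<^sup>2) / l)" for v
  proof -
    have "matrix_form n R v v =
        complex_of_real (sq_norm n v) + (- w) * (\<Sum>x\<leftarrow>xs. complex_of_real ((cmod (dot n v (fst x)))\<^sup>2))"
      unfolding R_def matrix_form_add[of n "mone n" "\<lambda>p. (- w) * (\<Sum>x\<leftarrow>xs. rank1 (fst x) (fst x) p)" v]
        matrix_form_scale[of n "- w" "\<lambda>p. \<Sum>x\<leftarrow>xs. rank1 (fst x) (fst x) p" v]
        matrix_form_sum_list[of n "\<lambda>x. rank1 (fst x) (fst x)" xs v] matrix_form_rank1 matrix_form_mone ..
    also have "(\<Sum>x\<leftarrow>xs. complex_of_real ((cmod (dot n v (fst x)))\<^sup>2)) =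
        complex_of_real (\<Sum>(\<xi>, b)\<leftarrow>xs. (cmod (dot n v \<xi>))\<^sup>2)"
      by (induction xs) auto
    finally show ?thesis
      by (simp add: w_def)
  qed
  have R_pos: "positive_op {..<n} (matrix_op n (\<lambda>p. (1 / 2) * R p))"
  proof (rule positive_op_matrix_op)
    fix v
    note f = matrix_form_scale[of n "1 / 2" R v, unfolded R_form]
    have "(\<Sum>(\<xi>, b)\<leftarrow>xs. (cmod (dot n v \<xi>))\<^sup>2) / l \<le> sq_norm n v"
      using le[of v] l by (simp add: divide_le_eq mult.commute)
    then show "0 \<le> Re (matrix_form n (\<lambda>p. (1 / 2) * R p) v v)"
      by (simp only: f) simp
    show "Im (matrix_form n (\<lambda>p. (1 / 2) * R p) v v) = 0"
      by (simp only: f) simp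
  qed
  have zero_pos: "positive_op {..<n} (matrix_op n (\<lambda>_. 0))"
    by (rule positive_op_matrix_op) (simp_all add: kernel_form_def)
  have rank1_pos: "positive_op {..<n} (matrix_op n (\<lambda>p. w * rank1 u u p))" for u
  proof (rule positive_op_matrix_op)
    fix v
    note f = matrix_form_scale[of n w "rank1 u u" v, unfolded matrix_form_rank1]
    show "0 \<le> Re (matrix_form n (\<lambda>p. w * rank1 u u p) v v)"
        "Im (matrix_form n (\<lambda>p. w * rank1 u u p) v v) = 0"
      unfolding f using l by (simp_all add: w_def)
  qed
  have mone_pos: "positive_op {..<m} (matrix_op m (\<lambda>p. (1 / 2) * mone m p))"
  proof (rule positive_op_matrix_op)
    fix v
    note f = matrix_form_scale[of m "1 / 2" "mone m" v, unfolded matrix_form_mone]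
    show "0 \<le> Re (matrix_form m
        (\<lambda>p. (1 / 2) * mone m p) v v)" "Im (matrix_form m (\<lambda>p. (1 / 2) * mone m p) v v) = 0"
      unfolding f by (simp_all add: sq_norm_def sum_nonneg)
  qed
  have b: "b k \<in> hermitian_contractions m" if "1 \<le> k" "k \<le> L" for k
    by (rule xs[of "\<xi> k"]) (use that in \<open>simp add: b_def \<xi>_def L_def\<close>)
  have b_pos: "positive_op {..<m} (matrix_op m (\<lambda>p. (1 / 2) * (mone m p + s * b k p)))"
    if "1 \<le> k" "k \<le> L" and s: "s = 1 \<or> s = -1" for k s
  proof (rule positive_op_matrix_op)
    fix v
    have f: "matrix_form m (\<lambda>p. (1 / 2) * (mone m p + s * b k p)) v v =
        (1 / 2) * (complex_of_real (sq_norm m v) + s * matrix_form m (b k) v v)"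
      using matrix_form_scale[of m "1 / 2"
          "\<lambda>p. mone m p + s * b k p" v] matrix_form_add[of m "mone m" "\<lambda>p. s * b k p" v]
        matrix_form_scale[of m s "b k" v] matrix_form_mone[of m v] by (simp only:)
    have "\<bar>Re (matrix_form m (b k) v v)\<bar> \<le> sq_norm m v" "Im (matrix_form m (b k) v v) = 0"
      using b[OF that(1,2)] hermitian_form_real[of "b k" m v] by (auto simp: hermitian_contractions_def)
    then show "0 \<le> Re (matrix_form m (\<lambda>p. (1 / 2) * (mone m p + s * b k p)) v v)"
      "Im (matrix_form m (\<lambda>p. (1 / 2) * (mone m p + s * b k p)) v v) = 0"
      unfolding f using s by auto
  qed
  have "ereal (\<Sum>k=1..2 ^ L. Re (bilin
      n m ?c (\<lambda>p. A1 k p - A2 k p) (\<lambda>p. B 1 k p - B (-1) k p))) \<le> owc_bias n m G"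
  proof (rule owc_bias_ge)
    show "positive_op {..<n} (matrix_op n (A1 k)) \<and> positive_op {..<n} (matrix_op n (A2 k))" for k
      by (simp only: A1_def A2_def
          if_distrib[of "matrix_op n"] split: if_split) (use R_pos zero_pos rank1_pos in simp)
    show "positive_op {..<m} (matrix_op m (B 1 k)) \<and>
        positive_op {..<m} (matrix_op m (B (-1) k))" if "k \<in> {1..2 ^ L}" for k
    proof (cases "k \<le> L")
      case True
      then show ?thesis
        using b_pos[of k 1] b_pos[of k "-1"] that by (simp add: B_def)
    next
      case False
      then show ?thesis
        using mone_pos by (simp add: B_def)
    qed
    show "B 1 k p + B (-1) k p = mone m p" for k p
      by (simp add: B_def field_simps)
    show "(\<Sum>k=1..2 ^ L. A1 k p + A2 k p) = mone n p" for p
    proof -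
      have "(\<Sum>k=1..2 ^ L. A1 k p + A2 k p) = (\<Sum>k=1..L. A1 k p + A2 k p) + (A1 (Suc L) p + A2 (Suc L) p)"
        by (rule sum_split) (simp add: A1_def A2_def)
      also have "(\<Sum>k=1..L. A1 k p + A2 k p) = (\<Sum>k=1..L. w *
          rank1 (fst (xs ! (k - 1))) (fst (xs ! (k - 1))) p)"
        by (intro sum.cong refl) (simp add: A1_def A2_def \<xi>_def)
      also have "\<dots> = w * (\<Sum>x\<leftarrow>xs. rank1 (fst x) (fst x) p)"
        by (simp only: sum_distrib_left[symmetric] sum_xs[of "\<lambda>x. rank1 (fst x) (fst x) p"])
      finally show ?thesis
        by (simp add: A1_def A2_def R_def field_simps)
    qed
  qed
  then have "(\<Sum>k=1..2 ^ L. Re (bilin n m ?c (\<lambda>p. A1 k p - A2 k p) (\<lambda>p. B 1 k p - B (-1) k p))) \<le> \<beta>"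
    using owc by (meson ereal_less_eq(3) order_trans)
  also have "(\<Sum>k=1..2 ^ L. Re (bilin n m ?c (\<lambda>p. A1 k p - A2 k p) (\<lambda>p. B 1 k p - B (-1) k p))) =
      (\<Sum>k=1..L. Re (bilin n m ?c (\<lambda>p. A1 k p - A2 k p) (\<lambda>p. B 1 k p - B (-1) k p)))"
  proof -
    have "bilin n m ?c (\<lambda>p. A1 k p - A2 k p) d = 0" if "Suc L \<le> k" for k d
      using that linear_fun_zero[OF linear_fun_bilin_left, of n m ?c d] by (auto simp: A1_def A2_def)
    then show ?thesis
      by (subst sum_split) simp_all
  qed
  also have "\<dots> = (\<Sum>k=1..L. (1 / l) * Re (bilin n m ?c (rank1 (\<xi> k) (\<xi> k)) (b k)))"
  proof (rule sum.cong)
    fix k assume k: "k \<in> {1..L}"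
    have "(\<lambda>p. A1 k p - A2 k p) = (\<lambda>p. w * rank1 (\<xi> k) (\<xi> k) p)" "(\<lambda>p. B 1 k p - B (-1) k p) = b k"
      using k by (auto simp: A1_def A2_def B_def field_simps)
    then show "Re (bilin n m ?c (\<lambda>p. A1 k p - A2 k p) (\<lambda>p. B 1 k p - B (-1) k p)) =
        (1 / l) * Re (bilin n m ?c (rank1 (\<xi> k) (\<xi> k)) (b k))"
      by (simp only: linear_fun_scale[OF linear_fun_bilin_left]) (simp add: w_def)
  qed simp
  also have "\<dots> = (1 / l) * (\<Sum>(\<xi>, b)\<leftarrow>xs. Re (bilin n m ?c (rank1 \<xi> \<xi>) b))"
    unfolding sum_distrib_left[symmetric] \<xi>_def b_def
    using sum_xs[of "\<lambda>x. Re (bilin n m ?c (rank1 (fst x) (fst x)) (snd x))"] by (simp add: split_def)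
  finally show ?thesis
    using l by (simp add: divide_le_eq mult.commute)
qed

text \<open>The protocol divides by \<open>l\<close>; the case \<open>l = 0\<close> is the limit of
  \<open>l + e\<close> for \<open>e\<close> tending to 0 from above.\<close>

lemma owc_bound:
  assumes owc: "owc_bias n m G \<le> ereal \<beta>" and l: "0 \<le> l"
    and xs: "\<And>\<xi> b. (\<xi>, b) \<in> set xs \<Longrightarrow> b \<in> hermitian_contractions m"
    and le: "\<And>v. (\<Sum>(\<xi>, b)\<leftarrow>xs. (cmod (dot n v \<xi>))\<^sup>2) \<le> l * sq_norm n v"
  shows "(\<Sum>(\<xi>, b)\<leftarrow>xs. Re (bilin n m (game_coeff n m G) (rank1 \<xi> \<xi>) b)) \<le> \<beta> * l"
proof -
  let ?S = "\<Sum>(\<xi>, b)\<leftarrow>xs. Re (bilin n m (game_coeff n m G) (rank1 \<xi> \<xi>) b)"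
  have ev: "eventually (\<lambda>e. ?S \<le> \<beta> * (l + e)) (at_right 0)"
    unfolding eventually_at_right_field
  proof (intro exI[of _ 1] conjI allI impI)
    fix e :: real assume e: "0 < e" "e < 1"
    have "l * sq_norm n v \<le> (l + e) * sq_norm n v" for v
      using e by (intro mult_right_mono) (simp_all add: sq_norm_def sum_nonneg)
    then show "?S \<le> \<beta> * (l + e)"
      using e l by (intro owc_bound_pos[OF owc _ xs] order_trans[OF le]) auto
  qed simp
  have "((\<lambda>e. \<beta> * (l + e)) \<longlongrightarrow> \<beta> * (l + 0)) (at_right 0)"
    by (intro tendsto_intros)
  from tendsto_lowerbound[OF this ev] show ?thesis
    by simp
qed

section \<open>Games and their two biases\<close>

lemma xor_game_linear:
  assumes "xor_game n m G"
  shows "linear_op ({..<n} \<times> {..<m}) G"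
proof -
  obtain N \<rho> c p where \<rho>: "\<And>x. x \<in> {1..N::nat} \<Longrightarrow> quantum_state ({..<n} \<times> {..<m}) (\<rho> x)"
    and G: "G = (\<lambda>v i. \<Sum>x\<in>{1..N}. complex_of_real (c x * p x) * \<rho> x v i)"
    using assms unfolding xor_game_def by blast
  have lin: "linear_op ({..<n} \<times> {..<m}) (\<rho> x)" if "x \<in> {1..N}" for x
    using \<rho>[OF that] by (simp add: quantum_state_def positive_op_def bounded_op_def)
  show ?thesis
    unfolding linear_op_def G
  proof (intro conjI ballI allI)
    fix u v a assume v: "v \<in> ell2 ({..<n} \<times> {..<m})"
    show "(\<lambda>i. \<Sum>x\<in>{1..N}. complex_of_real (c x * p x) * \<rho> x v i) \<in> ell2 ({..<n} \<times> {..<m})"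
      by (rule ell2_sum) (rule linear_op_ell2[OF lin v])
    show "(\<lambda>i. \<Sum>x\<in>{1..N}. complex_of_real (c x * p x) * \<rho> x (\<lambda>i. a * v i) i) =
        (\<lambda>i. a * (\<Sum>x\<in>{1..N}. complex_of_real (c x * p x) * \<rho> x v i))"
      unfolding sum_distrib_left by (intro ext sum.cong refl) (simp add: linear_op_scale[OF lin v])
    assume u: "u \<in> ell2 ({..<n} \<times> {..<m})"
    show "(\<lambda>i. \<Sum>x\<in>{1..N}. complex_of_real (c x * p x) * \<rho> x (\<lambda>i. u i + v i) i) =
        (\<lambda>i. (\<Sum>x\<in>{1..N}. complex_of_real (c x * p x) * \<rho> x u i) +
            (\<Sum>x\<in>{1..N}. complex_of_real (c x * p x) * \<rho> x v i))"
      unfolding sum.distrib[symmetric]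
          by (intro ext sum.cong refl) (simp add: linear_op_add[OF lin u v] distrib_left)
  qed
qed

lemma xor_game_hermitian:
  assumes "xor_game n m G"
  shows "hermitian_coeff (game_coeff n m G)"
proof -
  obtain N \<rho> c p where \<rho>: "\<And>x. x \<in> {1..N::nat} \<Longrightarrow> quantum_state ({..<n} \<times> {..<m}) (\<rho> x)"
    and G: "G = (\<lambda>v i. \<Sum>x\<in>{1..N}. complex_of_real (c x * p x) * \<rho> x v i)"
    using assms unfolding xor_game_def by blast
  have "cnj (G (ket q) r) = G (ket r) q" if "q \<in> {..<n} \<times> {..<m}" "r \<in> {..<n} \<times> {..<m}" for q r
  proof -
    have "cnj (\<rho> x (ket q) r) = \<rho> x (ket r) q" if "x \<in> {1..N}" for x
    proof -
      have "positive_op ({..<n} \<times> {..<m}) (\<rho> x)"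
        using \<rho>[OF that] by (simp add: quantum_state_def)
      from positive_op_hermitian[OF this ket_ell2 ket_ell2, of q r]
      show ?thesis
        using \<open>q \<in> _\<close> \<open>r \<in> _\<close> by (simp add: ell2_inner_ket)
    qed
    then show ?thesis
      unfolding G cnj_sum by (intro sum.cong refl) simp
  qed
  then show ?thesis
    by (auto simp: hermitian_coeff_def game_coeff_def)
qed

lemma entangled_bias_le_nat:
  assumes "linear_op ({..<n} \<times> {..<m}) G"
  shows "entangled_bias TYPE('h) n m G \<le> entangled_bias TYPE(nat) n m G"
  unfolding entangled_bias_def[of "TYPE('h)"]
proof (rule Sup_least, clarify)
  fix I J :: "'h set" and \<rho> A B
  assume "quantum_state (I \<times> J) \<rho>"
      "selfadjoint_contraction ({..<n} \<times> I) A" "selfadjoint_contraction ({..<m} \<times> J) B"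
  then obtain I' J' :: "nat set" and \<rho>' A' B' where
    *: "quantum_state (I' \<times> J') \<rho>'"
        "selfadjoint_contraction ({..<n} \<times> I') A'" "selfadjoint_contraction ({..<m} \<times> J') B'"
    and eq: "op_trace (({..<n} \<times> {..<m}) \<times> (I' \<times> J')) (reorder_op (tensor_op A' B') \<circ> tensor_op G \<rho>') =
     op_trace (({..<n} \<times> {..<m}) \<times> (I \<times> J)) (reorder_op (tensor_op A B) \<circ> tensor_op G \<rho>)"
    using entangled_value_transport[OF assms] by metis
  show "ereal (Re (op_trace (({..<n} \<times> {..<m}) \<times> I \<times> J) (reorder_op (tensor_op A B) \<circ> tensor_op G \<rho>)))
      \<le> entangled_bias TYPE(nat) n m G"
    unfolding entangled_bias_def eq[symmetric] using * by (intro Sup_upper) blast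
qed

lemma entangled_bias_le_owc:
  assumes G: "xor_game n m G" and owc: "owc_bias n m G \<le> ereal \<beta>"
  shows "entangled_bias TYPE(nat) n m G \<le> ereal (6 * \<beta>)"
  unfolding entangled_bias_def
proof (rule Sup_least, clarify)
  fix I J :: "nat set" and \<rho> A B
  assume \<rho>: "quantum_state (I \<times> J) \<rho>" and A: "selfadjoint_contraction ({..<n} \<times> I) A"
    and B: "selfadjoint_contraction ({..<m} \<times> J) B"
  show "ereal (Re (op_trace (({..<n} \<times> {..<m}) \<times> I \<times> J) (reorder_op (tensor_op A B) \<circ> tensor_op G \<rho>)))
      \<le> ereal (6 * \<beta>)"
    unfolding ereal_less_eq
    by (rule entangled_value_le[OF xor_game_linear[OF G] \<rho> A B])
      (rule entangled_vector_le[OF xor_game_hermitian[OF G] owc_bound[OF owc] A B])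
qed

theorem corollary1p2:
  "\<exists>K :: real. \<forall>(n :: nat) (m :: nat) (G :: (nat \<times> nat) operator).
     1 \<le> n \<longrightarrow> 1 \<le> m \<longrightarrow> xor_game n m G \<longrightarrow>
       entangled_bias TYPE('h) n m G \<le> entangled_bias TYPE(nat) n m G \<and>
       entangled_bias TYPE(nat) n m G \<le> ereal K * owc_bias n m G"
proof (intro exI[of _ 6] allI impI conjI)
  fix n m :: nat and G :: "(nat \<times> nat) operator"
  assume G: "xor_game n m G"
  show "entangled_bias TYPE('h) n m G \<le> entangled_bias TYPE(nat) n m G"
    by (rule entangled_bias_le_nat[OF xor_game_linear[OF G]])
  show "entangled_bias TYPE(nat) n m G \<le> ereal 6 * owc_bias n m G"
  proof (cases "owc_bias n m G")
    case (real r)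
    then show ?thesis
      using entangled_bias_le_owc[OF G, of r] by simp
  next
    case PInf
    then show ?thesis
      by simp
  next
    case MInf
    \<comment> \<open>The bias is not minus infinity: otherwise -1 would bound it, and the empty
      list with \<open>l = 1\<close> would give \<open>0 \<le> -1\<close>.\<close>
    then have "(0 :: real) \<le> - 1 * 1"
      using owc_bound[of n m G "-1" 1 "[]"] by (simp add: sq_norm_def sum_nonneg)
    then show ?thesis
      by simp
  qed
qed

end
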